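(* Let $A,B$ be linear operators on $\mathbb{R}^n$ such that $\lambda A+B$ is a regular pencil of index not higher than $1$, with spectral projectors $P_1,P_2,Q_1,Q_2$, subspaces $X_j=P_j\mathbb{R}^n$, $Y_j=Q_j\mathbb{R}^n$ ($j=1,2$) and operator $G=A+BP_2$. Let $f\in C([0,\infty)\times\mathbb{R}^n,\mathbb{R}^n)$ with $\frac{\partial f}{\partial x}\in C([0,\infty)\times\mathbb{R}^n,L(\mathbb{R}^n))$, and put $L_0=\{(t,x)\in[0,\infty)\times\mathbb{R}^n : Q_2[Bx-f(t,x)]=0\}$. Assume: (i) for any $t\ge 0$ and any $x_{p_1}\in X_1$ there exists $x_{p_2}\in X_2$ such that $(t,x_{p_1}+x_{p_2})\in L_0$; (ii) for any $t_*\ge 0$, $x_{p_1}^*\in X_1$ and any $x_{p_2}^1,x_{p_2}^2\in X_2$ such that $(t_*,x_{p_1}^*+x_{p_2}^i)\in L_0$, $i=1,2$, the operator function $\Phi\colon X_2\to L(X_2,Y_2)$, $\Phi(x_{p_2})=\left[\frac{\partial (Q_2f)}{\partial x}(t_*,x_{p_1}^*+x_{p_2})-B\right]P_2$, is basis invertible on $[x_{p_2}^1,x_{p_2}^2]$; (iii) at least one of the following holds: (a) there exists a self-adjoint positive operator $H\in L(X_1)$ and for each $T'>0$ there exists $R_{T'}>0$ such that $(HP_1x,G^{-1}Q_1f(t,x))\le 0$ for all $(t,x)\in L_0$ with $0\le t\le T'$ and $\|P_1x\|\ge R_{T'}$; (b) $Q_1f(t,x)=S_1(t)P_1x+\psi(t,x)+\Pi(x)e(t)$,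 where $S_1\in C([0,\infty),L(X_1,Y_1))$, $\psi\in C([0,\infty)\times\mathbb{R}^n,Y_1)$, $\frac{\partial\psi}{\partial x}\in C([0,\infty)\times\mathbb{R}^n,L(\mathbb{R}^n,Y_1))$, $e\in C([0,\infty),\mathbb{R}^n)$, $\Pi\in C^1(\mathbb{R}^n,L(\mathbb{R}^n,Y_1))$, there exist $C,r>0$ such that $\|\Pi(x)\|\le C$ for all $x$ with $\|P_1x\|\ge r$, and there exists a self-adjoint positive operator $H\in L(X_1)$ and for each $T'>0$ there exists $R_{T'}>0$ such that $(HP_1x,G^{-1}\psi(t,x))\le 0$ for all $(t,x)\in L_0$ with $0\le t\le T'$ and $\|P_1x\|\ge R_{T'}$; (c) for some self-adjoint positive operator $H\in L(X_1)$ and some number $R>0$ there exist functions $k\in C([0,\infty),\mathbb{R})$ and $U\in C((0,\infty),(0,\infty))$ such that $\int_c^{+\infty}\frac{dv}{U(v)}=+\infty$ ($c>0$) and $\big(HP_1x,G^{-1}[-BP_1x+Q_1f(t,x)]\big)\le k(t)\,U\big(\tfrac12(HP_1x,P_1x)\big)$ for all $(t,x)\in L_0$ with $\|P_1x\|\ge R$. Let $(t_0,x_0)\in L_0$ and $T>t_0$. Let, additionally, $f\in C^1([t_0,T]\times\mathbb{R}^n,\mathbb{R}^n)$, and let the operator $\left[\frac{\partial (Q_2f)}{\partial x}(t,z+u)-B\right]P_2\in L(X_2,Y_2)$ be invertible for all $t\in[t_0,T]$, $z\in X_1$, $u\in X_2$. Let $x(t)$ be the unique global solution (which exists under these hypotheses)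 of $$\frac{d}{dt}[Ax]+Bx=f(t,x),\qquad x(t_0)=x_0,$$ and put $z(t)=P_1x(t)$, $u(t)=P_2x(t)$. For $N\in\mathbb{N}$ let $h=(T-t_0)/N$, $t_i=t_0+ih$ ($i=0,\dots,N$), $z_0=P_1x_0$, $u_0=P_2x_0$. Then the method $$x_0=z_0+u_0,$$ $$z_{i+1}=(I-hG^{-1}B)z_i+hG^{-1}Q_1f(t_i,z_i+u_i),$$ $$u_{i+1}=u_i-\Big[I-G^{-1}\tfrac{\partial (Q_2f)}{\partial x}(t_{i+1},z_{i+1}+u_i)\Big]^{-1}\big[u_i-G^{-1}Q_2f(t_{i+1},z_{i+1}+u_i)\big],$$ $$x_{i+1}=z_{i+1}+u_{i+1},\qquad i=0,\dots,N-1,$$ approximating the initial value problem on $[t_0,T]$, converges and has the first order of accuracy: $$\max_{0\le i\le N}\|z(t_i)-z_i\|=O(h),\qquad \max_{0\le i\le N}\|u(t_i)-u_i\|=O(h)\qquad (h\to 0).$$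
   Context: $L(X,Y)$ is the space of (continuous) linear operators from $X$ to $Y$, $L(X)=L(X,X)$, and $I$ is the identity. $A$ and $B$ may be noninvertible. $(\cdot,\cdot)$ is the inner product on $\mathbb{R}^n$; a self-adjoint operator $H\in L(X_1)$ is positive if $(Hx,x)>0$ for all $x\in X_1$, $x\neq 0$. Pencil. The pencil $\lambda A+B$ ($\lambda$ a complex parameter) is regular if $\det(\lambda_0A+B)\ne 0$ for some $\lambda_0$. A regular pencil has index not higher than $1$ if there are constants $C_1,C_2>0$ with $\|(\lambda A+B)^{-1}\|\le C_1$ for all $|\lambda|\ge C_2$. In that case the spectral projectors are $$P_1=\frac{1}{2\pi i}\oint_{|\lambda|=C_2}(\lambda A+B)^{-1}A\,d\lambda,\quad P_2=I-P_1,\quad Q_1=\frac{1}{2\pi i}\oint_{|\lambda|=C_2}A(\lambda A+B)^{-1}d\lambda,\quad Q_2=I-Q_1.$$ They are real and give direct decompositions $\mathbb{R}^n=X_1\dot+X_2=Y_1\dot+Y_2$, with $X_j=P_j\mathbb{R}^n$, $Y_j=Q_j\mathbb{R}^n$. $A$ and $B$ map $X_j$ into $Y_j$, $A|_{X_2}=0$, and $A|_{X_1}\colon X_1\to Y_1$, $B|_{X_2}\colon X_2\to Y_2$ are invertible. The operator $G=A+BP_2=A+Q_2B\in L(\mathbb{R}^n)$ is invertible and $GX_j=Y_j$. If $A$ is invertible (index $0$), then $P_2=Q_2=0$, $P_1=Q_1=I$, and the conditions involving $X_2$ and $\Phi$ are vacuous. Solutions. A solution of the initial value problem on $[t_0,t_1)$,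 $t_1\le\infty$, is a function $x\in C([t_0,t_1),\mathbb{R}^n)$ with $Ax\in C^1([t_0,t_1),\mathbb{R}^n)$ satisfying the equation on $[t_0,t_1)$ and the initial condition. It is global if $t_1=\infty$. Basis invertibility. Let $W,Z$ be $s$-dimensional linear spaces, $D\subset W$, $\hat w,\tilde w\in D$, and $[\hat w,\tilde w]=\{\alpha\tilde w+(1-\alpha)\hat w:\alpha\in[0,1]\}$. An additive resolution of the identity in $Z$ is a family $\{\Theta_k\}_{k=1}^s$ of one-dimensional projectors in $Z$ with $\Theta_i\Theta_j=\delta_{ij}\Theta_i$ and $\sum_{k=1}^s\Theta_k=I_Z$. A mapping $\Phi\colon D\to L(W,Z)$ is basis invertible on $[\hat w,\tilde w]$ if for some additive resolution of the identity $\{\Theta_k\}_{k=1}^s$ in $Z$ and for any set of vectors $\{w^k\}_{k=1}^s\subset[\hat w,\tilde w]$ the operator $\Lambda=\sum_{k=1}^s\Theta_k\Phi(w^k)\in L(W,Z)$ has an inverse $\Lambda^{-1}\in L(Z,W)$. *)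

theory Defs
  imports "HOL-Complex_Analysis.Complex_Analysis" "HOL-Library.Landau_Symbols"
begin

text \<open>
  Conventions: operators between Euclidean spaces are matrices acting by \<open>*v\<close>.  An element of
  \<open>L(W,Z)\<close>, for subspaces \<open>W\<close> and \<open>Z\<close>, is represented by a matrix that maps \<open>W\<close> into \<open>Z\<close> and of
  which only the restriction to \<open>W\<close> matters; every linear map from \<open>W\<close> to \<open>Z\<close> is such a
  restriction.  The zero subspace is allowed everywhere.
\<close>

definition ops :: "(real^'a) set \<Rightarrow> (real^'b) set \<Rightarrow> (real^'a^'b) set" where
  "ops W Z = {M. \<forall>w\<in>W. M *v w \<in> Z}"

definition invertible_op :: "(real^'a) set \<Rightarrow> (real^'b) set \<Rightarrow> real^'a^'b \<Rightarrow> bool" where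
  "invertible_op W Z M \<longleftrightarrow>
     M \<in> ops W Z \<and>
     (\<exists>M' \<in> ops Z W. (\<forall>w\<in>W. M' *v (M *v w) = w) \<and> (\<forall>z\<in>Z. M *v (M' *v z) = z))"

definition self_adjoint_positive :: "(real^'a) set \<Rightarrow> real^'a^'a \<Rightarrow> bool" where
  "self_adjoint_positive W H \<longleftrightarrow>
     H \<in> ops W W \<and>
     (\<forall>x\<in>W. \<forall>y\<in>W. (H *v x) \<bullet> y = x \<bullet> (H *v y)) \<and>
     (\<forall>x\<in>W. x \<noteq> 0 \<longrightarrow> (H *v x) \<bullet> x > 0)"


subsection \<open>The operator pencil\<close>

definition pencil :: "real^'n^'n \<Rightarrow> real^'n^'n \<Rightarrow> complex \<Rightarrow> complex^'n^'n" where
  "pencil A B l = (\<chi> i j. l * of_real (A $ i $ j) + of_real (B $ i $ j))"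

definition regular_pencil :: "real^'n^'n \<Rightarrow> real^'n^'n \<Rightarrow> bool" where
  "regular_pencil A B \<longleftrightarrow> (\<exists>l. det (pencil A B l) \<noteq> 0)"

definition index_le_1_with :: "real^'n^'n \<Rightarrow> real^'n^'n \<Rightarrow> real \<Rightarrow> real \<Rightarrow> bool" where
  "index_le_1_with A B C1 C2 \<longleftrightarrow>
     C1 > 0 \<and> C2 > 0 \<and>
     (\<forall>l. cmod l \<ge> C2 \<longrightarrow>
        invertible (pencil A B l) \<and> onorm ((*v) (matrix_inv (pencil A B l))) \<le> C1)"

text \<open>
  The contour integrals below are matrices with real entries, because the integrands commute with
  complex conjugation and the contour is symmetric about the real axis; taking \<^const>\<open>Re\<close> only
  changes the type.
\<close>

definition spectral_P1 :: "real^'n^'n \<Rightarrow> real^'n^'n \<Rightarrow> real \<Rightarrow> real^'n^'n" where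
  "spectral_P1 A B C2 =
     (\<chi> i j. Re (1 / (2 * of_real pi * \<i>) *
        contour_integral (circlepath 0 C2)
          (\<lambda>l. (matrix_inv (pencil A B l) ** map_matrix of_real A) $ i $ j)))"

definition spectral_Q1 :: "real^'n^'n \<Rightarrow> real^'n^'n \<Rightarrow> real \<Rightarrow> real^'n^'n" where
  "spectral_Q1 A B C2 =
     (\<chi> i j. Re (1 / (2 * of_real pi * \<i>) *
        contour_integral (circlepath 0 C2)
          (\<lambda>l. (map_matrix of_real A ** matrix_inv (pencil A B l)) $ i $ j)))"


subsection \<open>Basis invertibility\<close>

definition additive_resolution :: "(real^'b) set \<Rightarrow> (nat \<Rightarrow> real^'b^'b) \<Rightarrow> bool" where
  "additive_resolution Z \<Theta> \<longleftrightarrow>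
     (\<forall>k\<in>{1..dim Z}. \<Theta> k \<in> ops Z Z \<and> dim ((*v) (\<Theta> k) ` Z) = 1) \<and>
     (\<forall>i\<in>{1..dim Z}. \<forall>j\<in>{1..dim Z}. \<forall>z\<in>Z.
        \<Theta> i *v (\<Theta> j *v z) = (if i = j then \<Theta> i *v z else 0)) \<and>
     (\<forall>z\<in>Z. (\<Sum>k=1..dim Z. \<Theta> k *v z) = z)"

text \<open>
  Here \<open>dim W = dim Z\<close> is intended; it is not demanded separately, as it follows from the
  invertibility of any one of the operators below.
\<close>

definition basis_invertible ::
  "(real^'a) set \<Rightarrow> (real^'b) set \<Rightarrow> (real^'a \<Rightarrow> real^'a^'b) \<Rightarrow> real^'a \<Rightarrow> real^'a \<Rightarrow> bool" where
  "basis_invertible W Z \<Phi> w1 w2 \<longleftrightarrow>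
     (\<exists>\<Theta>. additive_resolution Z \<Theta> \<and>
        (\<forall>w :: nat \<Rightarrow> real^'a. (\<forall>k\<in>{1..dim Z}. w k \<in> closed_segment w1 w2) \<longrightarrow>
           invertible_op W Z (\<Sum>k=1..dim Z. \<Theta> k ** \<Phi> (w k))))"


subsection \<open>Smoothness classes\<close>

text \<open>On \<open>[a,b] \<times> R^n\<close> and \<open>[a,\<infinity>)\<close> the derivative at the boundary is one-sided.\<close>

definition C1_on :: "'a::real_normed_vector set \<Rightarrow> ('a \<Rightarrow> 'b::real_normed_vector) \<Rightarrow> bool" where
  "C1_on S g \<longleftrightarrow>
     (\<exists>g' :: 'a \<Rightarrow> 'a \<Rightarrow>\<^sub>L 'b.
        (\<forall>p\<in>S. (g has_derivative blinfun_apply (g' p)) (at p within S)) \<and> continuous_on S g')"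

definition continuous_with_x_derivative :: "(real \<Rightarrow> real^'n \<Rightarrow> real^'m) \<Rightarrow> bool" where
  "continuous_with_x_derivative g \<longleftrightarrow>
     continuous_on ({0..} \<times> UNIV) (\<lambda>(t,x). g t x) \<and>
     (\<forall>t\<ge>0. \<forall>x. g t differentiable (at x)) \<and>
     continuous_on ({0..} \<times> UNIV) (\<lambda>(t,x). jacobian (g t) (at x))"


subsection \<open>The initial value problem and the numerical method\<close>

definition ivp_solution_on ::
  "real set \<Rightarrow> real^'n^'n \<Rightarrow> real^'n^'n \<Rightarrow> (real \<Rightarrow> real^'n \<Rightarrow> real^'n) \<Rightarrow> real \<Rightarrow> real^'n \<Rightarrow>
   (real \<Rightarrow> real^'n) \<Rightarrow> bool" where
  "ivp_solution_on J A B f t0 x0 x \<longleftrightarrow>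
     continuous_on J x \<and>
     C1_on J (\<lambda>t. A *v x t) \<and>
     (\<forall>t\<in>J. vector_derivative (\<lambda>s. A *v x s) (at t within J) + B *v x t = f t (x t)) \<and>
     x t0 = x0"

abbreviation global_ivp_solution where
  "global_ivp_solution A B f t0 x0 x \<equiv> ivp_solution_on {t0..} A B f t0 x0 x"

text \<open>The pair of components \<open>(z_i, u_i)\<close> of the approximation \<open>x_i = z_i + u_i\<close>, with step \<open>h\<close>.\<close>

primrec dae_method ::
  "real^'n^'n \<Rightarrow> real^'n^'n \<Rightarrow> real^'n^'n \<Rightarrow> real^'n^'n \<Rightarrow> (real \<Rightarrow> real^'n \<Rightarrow> real^'n) \<Rightarrow>
   real \<Rightarrow> real \<Rightarrow> real^'n \<Rightarrow> real^'n \<Rightarrow> nat \<Rightarrow> (real^'n) \<times> (real^'n)" where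
  "dae_method B G Q1 Q2 f t0 h z0 u0 0 = (z0, u0)"
| "dae_method B G Q1 Q2 f t0 h z0 u0 (Suc i) =
     (let (z, u) = dae_method B G Q1 Q2 f t0 h z0 u0 i;
          t = t0 + real i * h;
          t' = t0 + real (Suc i) * h;
          G' = matrix_inv G;
          z' = (mat 1 - h *\<^sub>R (G' ** B)) *v z + h *\<^sub>R (G' *v (Q1 *v f t (z + u)));
          u' = u - matrix_inv (mat 1 - G' ** jacobian (\<lambda>x. Q2 *v f t' x) (at (z' + u)))
                     *v (u - G' *v (Q2 *v f t' (z' + u)))
      in (z', u'))"

end

theory Submission
  imports Defs
begin

text \<open>
  Write \<open>G'\<close> for the inverse of \<open>G\<close>.  On the decomposition given by the spectral projectors one has
  \<open>G' A = P1\<close>, \<open>G' B P2 = P2\<close> and \<open>G' Q1 = P1 G'\<close>.  Applying \<open>G'\<close> to the equation therefore splits it,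
  with \<open>z = P1 x\<close> and \<open>u = P2 x\<close>, into
    \<open>z' = G' Q1 f(t, z + u) - G' B z\<close>  and  \<open>u = G' Q2 f(t, z + u)\<close>.
  These identities come from the first three coefficients of the expansion of the inverse of
  \<open>l A + B\<close> in powers of \<open>1 / l\<close> (\<open>resolvent_coefficients\<close>): the contour integrals pick out the
  coefficient of \<open>1 / l\<close>, and comparing powers of \<open>l\<close> in \<open>R(l) (l A + B) = I\<close> gives everything else
  (\<open>spectral_projector_identities\<close>).

  The algebraic equation has exactly one solution \<open>u = eta t z\<close>: existence is the first hypothesis, and
  by the mean value theorem, applied in each of the one-dimensional components of the resolution of
  the identity, the difference of two solutions is annihilated by an operator that basis invertibility
  declares invertible (\<open>basis_invertible_imp_injective\<close>).  Basis invertibility on the degenerate segment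
  from a solution to itself says that the linearized equation is nonsingular there, so \<open>eta\<close> is
  continuous, and Lipschitz in whatever variables \<open>f\<close> is Lipschitz in (\<open>parametrized_root\<close>).  The problem is thus equivalent to the ordinary differential
  equation \<open>z' = rhs t z\<close> on \<open>X1\<close>, with a locally Lipschitz right-hand side.

  Solutions of that equation cannot blow up.  Each of the three alternatives of the growth hypothesis
  yields on a bounded time interval \<open>V' \<le> K U(V)\<close> for \<open>V = (H z, z) / 2\<close> and large \<open>z\<close>, where
  the integral of \<open>1 / U\<close> diverges; for the first two alternatives \<open>U(v) = v\<close> will do
  (\<open>osgood_growth\<close>, \<open>comparison_bound\<close>).  Picard iteration for a truncated right-hand side then gives
  the unique global solution (\<open>ode_exists_global\<close>).

  For convergence, let \<open>d_i\<close> be the distance of \<open>u_i\<close> from \<open>eta(t_i, z_i)\<close>.  As \<open>f\<close> is only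
  continuously differentiable, a Newton step need not converge quadratically, but close to the root it
  halves the error (\<open>newton_halves_error\<close>).  From one grid point to the next the root moves by at most
  \<open>c h\<close>, so \<open>d_i \<le> c h\<close> implies \<open>d_{i+1} \<le> (c h + c h) / 2 = c h\<close>.  The differential component is
  thus computed by the explicit Euler method with a perturbation of order \<open>h\<close> in the slope, and
  a discrete Gronwall estimate gives the error \<open>O(h)\<close> (\<open>euler_newton_converges\<close>).
\<close>

section \<open>Spectral projectors of an index-one pencil\<close>

lemma matrix_inv_inverse:
  fixes M :: "'a::semiring_1^'n^'n"
  assumes "invertible M"
  shows "M ** matrix_inv M = mat 1" and "matrix_inv M ** M = mat 1"
  using someI_ex[OF assms[unfolded invertible_def]] by (auto simp: matrix_inv_def)

lemma matrix_diff_ldistrib: "(A :: 'a::ring_1^'n^'m) ** (B - C) = A ** B - A ** C"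
  by (simp add: matrix_matrix_mult_def vec_eq_iff right_diff_distrib sum_subtractf)

lemma matrix_add_rdistrib: "(A + B) ** (C :: 'a::semiring_1^'n^'m) = A ** C + B ** C"
  by (simp add: matrix_matrix_mult_def vec_eq_iff distrib_right sum.distrib)

lemma matrix_diff_rdistrib: "(A - B) ** (C :: 'a::ring_1^'n^'m) = A ** C - B ** C"
  by (simp add: matrix_matrix_mult_def vec_eq_iff left_diff_distrib sum_subtractf)

lemma matrix_vector_mult_axis_nth:
  fixes M :: "'a::semiring_1^'n^'m"
  shows "(M *v axis j 1) $ i = M $ i $ j"
  by (simp add: matrix_vector_mult_def axis_def if_distrib[where f = "\<lambda>x. _ * x"] cong: if_cong)

lemma matrix_inv_entry_cramer:
  fixes M :: "complex^'n^'n"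
  assumes "det M \<noteq> 0"
  shows "matrix_inv M $ i $ j =
    det (\<chi> k l. if l = i then axis j 1 $ k else M $ k $ l) / det M"
proof -
  have inv: "invertible M" using assms by (simp add: invertible_det_nz)
  have "M *v (matrix_inv M *v axis j 1) = axis j 1"
    using matrix_inv_inverse(1)[OF inv] by (simp add: matrix_vector_mul_assoc)
  then have "matrix_inv M *v axis j 1 =
      (\<chi> q. det (\<chi> k l. if l = q then axis j 1 $ k else M $ k $ l) / det M)"
    using cramer[OF assms, of "matrix_inv M *v axis j 1" "axis j 1"] by simp
  then have "(matrix_inv M *v axis j 1) $ i =
      det (\<chi> k l. if l = i then axis j 1 $ k else M $ k $ l) / det M"
    by simp
  then show ?thesis
    by (simp add: matrix_vector_mult_axis_nth)
qed

lemma matrix_entry_le_onorm: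
  fixes M :: "complex^'n^'n"
  shows "cmod (M $ i $ j) \<le> onorm ((*v) M)"
proof -
  have "M $ i $ j = (M *v axis j 1) $ i"
    by (simp add: matrix_vector_mult_axis_nth)
  also have "cmod \<dots> \<le> norm (M *v axis j 1)"
    by (rule Finite_Cartesian_Product.norm_nth_le)
  also have "\<dots> \<le> onorm ((*v) M) * norm (axis j 1 :: complex^'n)"
    by (rule onorm) (rule matrix_vector_mul_bounded_linear)
  finally show ?thesis by (simp add: norm_axis_1)
qed

lemma det_holomorphic_on:
  fixes M :: "complex \<Rightarrow> complex^'n^'n"
  assumes "\<And>i j. (\<lambda>l. M l $ i $ j) holomorphic_on S"
  shows "(\<lambda>l. det (M l)) holomorphic_on S"
  unfolding det_def by (intro holomorphic_intros assms)

lemma pencil_inverse_entry_holomorphic_on: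
  fixes A B :: "real^'n^'n"
  assumes "\<And>l. l \<in> S \<Longrightarrow> det (pencil A B l) \<noteq> 0"
  shows "(\<lambda>l. matrix_inv (pencil A B l) $ i $ j) holomorphic_on S"
proof -
  have ent: "(\<lambda>l. pencil A B l $ p $ q) holomorphic_on S" for p q
    unfolding pencil_def by (auto intro!: holomorphic_intros)
  have ent': "(\<lambda>l. (\<chi> k m. if m = i then axis j 1 $ k else pencil A B l $ k $ m) $ p $ q) holomorphic_on S" for p q
    by (cases "q = i") (auto intro: ent)
  have "(\<lambda>l. det (\<chi> k m. if m = i then axis j 1 $ k else pencil A B l $ k $ m) / det (pencil A B l))
      holomorphic_on S"
    by (intro holomorphic_intros det_holomorphic_on ent ent' assms)
  then show ?thesis
    by (rule holomorphic_transform) (simp add: matrix_inv_entry_cramer assms)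
qed

text \<open>
  The substitution \<open>l = 1 / w\<close> reverses the orientation of the circle and turns
  \<open>dl\<close> into \<open>- dw / w^2\<close>; the two signs cancel.
\<close>

lemma has_contour_integral_circle_inversion:
  fixes s :: "complex \<Rightarrow> complex" and r :: real
  assumes r: "r > 0"
    and int: "((\<lambda>w. s w / w ^ 2) has_contour_integral I) (circlepath 0 (1 / r))"
  shows "((\<lambda>l. s (1 / l)) has_contour_integral I) (circlepath 0 r)"
proof -
  define g where "g t = s (exp (2 * of_real pi * \<i> * t) / r) * (2 * pi * \<i> * r * exp (- (2 * of_real pi * \<i> * t)))"
    for t :: real
  have "((\<lambda>t. s (circlepath 0 (1/r) t) / (circlepath 0 (1/r) t) ^ 2 *
      vector_derivative (circlepath 0 (1/r)) (at t within {0..1})) has_integral I) {0..1}"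
    using int by (simp add: has_contour_integral_def)
  then have "(g has_integral I) {0..1}"
  proof (rule has_integral_eq[rotated])
    fix t :: real assume "t \<in> {0..1}"
    then show "s (circlepath 0 (1/r) t) / (circlepath 0 (1/r) t) ^ 2 *
      vector_derivative (circlepath 0 (1/r)) (at t within {0..1}) = g t"
      using r by (simp add: vector_derivative_circlepath01 g_def)
        (simp add: circlepath exp_minus field_simps power2_eq_square)
  qed
  then have "((\<lambda>t. g ((-1) *\<^sub>R t + 1)) has_integral (1 / \<bar>(-1)::real\<bar> ^ DIM(real)) *\<^sub>R I)
      ((\<lambda>t. (1 / (-1)) *\<^sub>R t + - ((1 / (-1)) *\<^sub>R 1)) ` cbox 0 1)"
    by (intro has_integral_affinity) (auto simp: box_real)
  moreover have "((\<lambda>t. (1 / (-1)) *\<^sub>R t + - ((1 / (-1)) *\<^sub>R 1)) ` cbox (0::real) 1) = {0..1}"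
  proof -
    have "(\<lambda>t::real. 1 - t) ` {0..1} = {0..1}"
      by (auto simp: image_def intro!: bexI[of _ "1 - x" for x])
    then show ?thesis by (simp add: box_real)
  qed
  ultimately have "((\<lambda>t. g (1 - t)) has_integral I) {0..1}" by simp
  then have "((\<lambda>t. s (1 / circlepath 0 r t) *
      vector_derivative (circlepath 0 r) (at t within {0..1})) has_integral I) {0..1}"
  proof (rule has_integral_eq[rotated])
    fix t :: real assume t: "t \<in> {0..1}"
    have e: "exp (2 * of_real pi * \<i> * of_real (1 - t)) = exp (- (2 * of_real pi * \<i> * of_real t))"
      by (simp add: algebra_simps exp_diff exp_minus field_simps)
    have e': "exp (- (2 * of_real pi * \<i> * of_real (1 - t))) = exp (2 * of_real pi * \<i> * of_real t)"
      using arg_cong[OF e, of inverse] by (simp add: exp_minus)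
    show "g (1 - t) = s (1 / circlepath 0 r t) *
      vector_derivative (circlepath 0 r) (at t within {0..1})"
      using t r unfolding g_def e e'
      by (simp add: vector_derivative_circlepath01) (simp add: circlepath exp_minus field_simps)
  qed
  then show ?thesis by (simp add: has_contour_integral_def)
qed

text \<open>
  Boundedness of the inverse near infinity is a removable singularity at \<open>w = 0\<close> in the
  variable \<open>w = 1 / l\<close>. This is how the index condition enters: for a higher index
  there would be a pole.
\<close>

lemma pencil_inverse_laurent_entries:
  fixes A B :: "real^'n^'n"
  assumes idx: "index_le_1_with A B C1 C2"
  obtains g :: "complex \<Rightarrow> complex^'n^'n" and U where
    "open U" "cball 0 (1 / C2) \<subseteq> U"
    "\<And>i j. (\<lambda>w. g w $ i $ j) holomorphic_on U"
    "\<And>w. w \<in> U \<Longrightarrow> w \<noteq> 0 \<Longrightarrow> det (pencil A B (1 / w)) \<noteq> 0"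
    "\<And>w. w \<in> U \<Longrightarrow> w \<noteq> 0 \<Longrightarrow> g w = matrix_inv (pencil A B (1 / w))"
proof -
  have C: "C1 > 0" "C2 > 0" and inv: "\<And>l. cmod l \<ge> C2 \<Longrightarrow> det (pencil A B l) \<noteq> 0"
    and bnd: "\<And>l. cmod l \<ge> C2 \<Longrightarrow> onorm ((*v) (matrix_inv (pencil A B l))) \<le> C1"
    using idx by (auto simp: index_le_1_with_def invertible_det_nz)
  define V where "V = {w \<in> - {0}. det (pencil A B (1 / w)) \<noteq> 0}"
  (* V is the domain of the inverse in the variable w = 1 / l; adding 0 gives an open set that contains
     the whole closed disc, so that Cauchy's formula applies on the boundary circle. *)
  define U where "U = V \<union> {0}"
  have V0: "0 \<notin> V" by (simp add: V_def)
  have far: "cmod (1 / w) \<ge> C2" if "w \<in> cball 0 (1 / C2)" "w \<noteq> 0" for w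
    using that C by (simp add: norm_divide field_simps)
  have ballV: "cball 0 (1 / C2) - {0} \<subseteq> V"
    using inv far by (auto simp: V_def)
  have "continuous_on (- {0}) (\<lambda>w. det (pencil A B (1 / w)))"
    by (intro holomorphic_on_imp_continuous_on det_holomorphic_on)
      (auto simp: pencil_def intro!: holomorphic_intros)
  then have "open (- {0} \<inter> (\<lambda>w. det (pencil A B (1 / w))) -` (- {0}))"
    by (rule continuous_open_preimage) auto
  moreover have "- {0} \<inter> (\<lambda>w. det (pencil A B (1 / w))) -` (- {0}) = V"
    by (auto simp: V_def)
  ultimately have oV: "open V" by simp
  have "ball 0 (1 / C2) \<subseteq> cball (0::complex) (1 / C2)" by (rule ball_subset_cball)
  then have "ball 0 (1 / C2) \<subseteq> U" using ballV unfolding U_def by blast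
  then have "U = V \<union> ball 0 (1 / C2)"
    using C by (auto simp: U_def)
  then have oU: "open U" using oV by auto
  have cU: "cball 0 (1 / C2) \<subseteq> U" using ballV by (auto simp: U_def)
  have UV: "U - {0} = V" using V0 by (auto simp: U_def)
  have ex: "\<exists>h. h holomorphic_on U \<and> (\<forall>w\<in>U - {0}. h w = matrix_inv (pencil A B (1 / w)) $ i $ j)" for i j
  proof -
    have "(\<lambda>l. matrix_inv (pencil A B l) $ i $ j) holomorphic_on {l. det (pencil A B l) \<noteq> 0}"
      by (rule pencil_inverse_entry_holomorphic_on) auto
    moreover have "(\<lambda>w. 1 / w) holomorphic_on V"
      using V0 by (auto intro!: holomorphic_intros)
    ultimately have hol: "(\<lambda>w. matrix_inv (pencil A B (1 / w)) $ i $ j) holomorphic_on V"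
      using holomorphic_on_compose_gen[of "\<lambda>w. 1 / w" V "\<lambda>l. matrix_inv (pencil A B l) $ i $ j"
          "{l. det (pencil A B l) \<noteq> 0}"]
      by (auto simp: V_def o_def)
    have "\<forall>\<^sub>F w in at 0. cmod (matrix_inv (pencil A B (1 / w)) $ i $ j) \<le> C1"
      unfolding eventually_at
    proof (intro exI conjI ballI impI)
      show "1 / C2 > 0" using C by simp
      fix w :: complex assume "w \<noteq> 0 \<and> dist w 0 < 1 / C2"
      then have "cmod (1 / w) \<ge> C2" by (intro far) auto
      then show "cmod (matrix_inv (pencil A B (1 / w)) $ i $ j) \<le> C1"
        using bnd matrix_entry_le_onorm order_trans by blast
    qed
    moreover have "0 \<in> interior U" using oU by (simp add: U_def interior_open)
    ultimately show ?thesis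
      using holomorphic_on_extend_bounded[of "\<lambda>w. matrix_inv (pencil A B (1 / w)) $ i $ j" U 0] hol UV
      by auto
  qed
  then obtain h where h: "\<And>i j. h i j holomorphic_on U"
      "\<And>i j w. w \<in> U - {0} \<Longrightarrow> h i j w = matrix_inv (pencil A B (1 / w)) $ i $ j"
    by metis
  show thesis
    by (rule that[of U "\<lambda>w. \<chi> i j. h i j w"])
      (use oU cU h in \<open>auto simp: vec_eq_iff U_def V_def\<close>)
qed

lemma pencil_inverse_mult:
  fixes A B :: "real^'n^'n"
  assumes "det (pencil A B l) \<noteq> 0"
  shows "(\<Sum>k\<in>UNIV. matrix_inv (pencil A B l) $ i $ k * (l * of_real (A $ k $ j) + of_real (B $ k $ j)))
      = (if i = j then 1 else 0)"
    and "(\<Sum>k\<in>UNIV. (l * of_real (A $ i $ k) + of_real (B $ i $ k)) * matrix_inv (pencil A B l) $ k $ j)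
      = (if i = j then 1 else 0)"
proof -
  have inv: "invertible (pencil A B l)" using assms by (simp add: invertible_det_nz)
  have "(matrix_inv (pencil A B l) ** pencil A B l) $ i $ j = mat 1 $ i $ j"
    "(pencil A B l ** matrix_inv (pencil A B l)) $ i $ j = mat 1 $ i $ j"
    using inv by (simp_all add: matrix_inv_inverse)
  then show "(\<Sum>k\<in>UNIV. matrix_inv (pencil A B l) $ i $ k * (l * of_real (A $ k $ j) + of_real (B $ k $ j)))
      = (if i = j then 1 else 0)"
    "(\<Sum>k\<in>UNIV. (l * of_real (A $ i $ k) + of_real (B $ i $ k)) * matrix_inv (pencil A B l) $ k $ j)
      = (if i = j then 1 else 0)"
    by (simp_all add: matrix_matrix_mult_def mat_def pencil_def)
qed

text \<open>
  Multiplied by \<open>w\<close>, the hypothesis says that a holomorphic function vanishes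
  identically; the three conclusions are its value and its first two derivatives at
  \<open>0\<close>.
\<close>

lemma taylor_coefficients_of_linear_identity:
  fixes g :: "'k::finite \<Rightarrow> complex \<Rightarrow> complex" and a b :: "'k \<Rightarrow> complex"
  assumes U: "open U" "0 \<in> U" and hol: "\<And>k. g k holomorphic_on U"
    and eq: "\<And>w. w \<in> U \<Longrightarrow> w \<noteq> 0 \<Longrightarrow> (\<Sum>k\<in>UNIV. g k w * (a k / w + b k)) = d"
  shows "(\<Sum>k\<in>UNIV. g k 0 * a k) = 0"
    and "(\<Sum>k\<in>UNIV. deriv (g k) 0 * a k + g k 0 * b k) = d"
    and "(\<Sum>k\<in>UNIV. deriv (deriv (g k)) 0 / 2 * a k + deriv (g k) 0 * b k) = 0"
proof -
  (* h vanishes on U; h1 and h2 are its first two derivatives. *)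
  define h where "h w = (\<Sum>k\<in>UNIV. g k w * (a k + w * b k)) - w * d" for w
  define h1 where "h1 w = (\<Sum>k\<in>UNIV. deriv (g k) w * (a k + w * b k) + g k w * b k) - d" for w
  define h2 where "h2 w = (\<Sum>k\<in>UNIV. deriv (deriv (g k)) w * (a k + w * b k) + deriv (g k) w * b k + deriv (g k) w * b k)" for w
  have hol1: "deriv (g k) holomorphic_on U" for k
    using hol U by (intro holomorphic_deriv) auto
  have g[derivative_intros]: "(g k has_field_derivative deriv (g k) w) (at w)" if "w \<in> U" for k w
    using holomorphic_derivI[OF hol U(1) that] .
  have g1[derivative_intros]: "(deriv (g k) has_field_derivative deriv (deriv (g k)) w) (at w)" if "w \<in> U" for k w
    using holomorphic_derivI[OF hol1 U(1) that] .
  have dh: "(h has_field_derivative h1 w) (at w)" if "w \<in> U" for w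
    unfolding h_def h1_def by (auto intro!: derivative_eq_intros that sum.cong simp: algebra_simps)
  have dh1: "(h1 has_field_derivative h2 w) (at w)" if "w \<in> U" for w
    unfolding h1_def h2_def by (auto intro!: derivative_eq_intros that sum.cong simp: algebra_simps)
  have h_off: "h w = 0" if "w \<in> U" "w \<noteq> 0" for w
  proof -
    have "(\<Sum>k\<in>UNIV. g k w * (a k + w * b k)) = w * (\<Sum>k\<in>UNIV. g k w * (a k / w + b k))"
      unfolding sum_distrib_left using that(2) by (intro sum.cong) (auto simp: field_simps)
    then show ?thesis using eq[OF that] by (simp add: h_def)
  qed
  have "h \<midarrow>0\<rightarrow> h 0"
    using dh[OF U(2)] DERIV_isCont isCont_def by blast
  moreover have "h \<midarrow>0\<rightarrow> 0"
  proof (rule tendsto_eventually)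
    have "\<forall>\<^sub>F w in at 0. w \<in> U" using U by (rule eventually_at_in_open')
    moreover have "\<forall>\<^sub>F w in at (0::complex). w \<noteq> 0" by (simp add: eventually_at_filter)
    ultimately show "\<forall>\<^sub>F w in at 0. h w = 0"
      by eventually_elim (use h_off in auto)
  qed
  ultimately have "h 0 = 0" by (rule LIM_unique)
  with h_off have h0: "h w = 0" if "w \<in> U" for w
    using that by (cases "w = 0") auto
  have h1: "h1 w = 0" if "w \<in> U" for w
  proof -
    have "((\<lambda>_. 0) has_field_derivative h1 w) (at w)"
      using dh[OF that] by (rule has_field_derivative_transform_within_open) (use U that h0 in auto)
    then show ?thesis using DERIV_unique DERIV_const by blast
  qed
  have h2: "h2 w = 0" if "w \<in> U" for w
  proof -
    have "((\<lambda>_. 0) has_field_derivative h2 w) (at w)"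
      using dh1[OF that] by (rule has_field_derivative_transform_within_open) (use U that h1 in auto)
    then show ?thesis using DERIV_unique DERIV_const by blast
  qed
  show "(\<Sum>k\<in>UNIV. g k 0 * a k) = 0" using h0[OF U(2)] by (simp add: h_def)
  show "(\<Sum>k\<in>UNIV. deriv (g k) 0 * a k + g k 0 * b k) = d" using h1[OF U(2)] by (simp add: h1_def)
  have "(\<Sum>k\<in>UNIV. deriv (deriv (g k)) 0 / 2 * a k + deriv (g k) 0 * b k) = h2 0 / 2"
    by (simp add: h2_def sum_divide_distrib field_simps)
  then show "(\<Sum>k\<in>UNIV. deriv (deriv (g k)) 0 / 2 * a k + deriv (g k) 0 * b k) = 0"
    using h2[OF U(2)] by simp
qed

text \<open>
  \<open>T0\<close>, \<open>T1\<close>, \<open>T2\<close> are the coefficients of \<open>1\<close>,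
  \<open>1 / l\<close>, \<open>1 / l^2\<close> in the expansion of the inverse of the pencil at
  infinity. All identities between them are linear with the real coefficients \<open>A\<close> and
  \<open>B\<close>, so they survive the passage to real parts.
\<close>

lemma resolvent_coefficients:
  fixes A B :: "real^'n^'n"
  assumes idx: "index_le_1_with A B C1 C2"
  obtains T0 T1 T2 :: "real^'n^'n" where
    "T0 ** A = 0" "T1 ** A + T0 ** B = mat 1" "T2 ** A + T1 ** B = 0"
    "A ** T0 = 0" "A ** T1 + B ** T0 = mat 1" "A ** T2 + B ** T1 = 0"
    "spectral_P1 A B C2 = T1 ** A" "spectral_Q1 A B C2 = A ** T1"
proof -
  have C2: "C2 > 0" using idx by (simp add: index_le_1_with_def)
  obtain g :: "complex \<Rightarrow> complex^'n^'n" and U where U: "open U" "cball 0 (1 / C2) \<subseteq> U"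
    and hol: "\<And>i j. (\<lambda>w. g w $ i $ j) holomorphic_on U"
    and det: "\<And>w. w \<in> U \<Longrightarrow> w \<noteq> 0 \<Longrightarrow> det (pencil A B (1 / w)) \<noteq> 0"
    and g: "\<And>w. w \<in> U \<Longrightarrow> w \<noteq> 0 \<Longrightarrow> g w = matrix_inv (pencil A B (1 / w))"
    using pencil_inverse_laurent_entries[OF idx] by metis
  have U0: "0 \<in> U" using U(2) C2 by (auto simp: subset_iff)
  define c0 c1 c2 where "c0 i j = g 0 $ i $ j"
    and "c1 i j = deriv (\<lambda>w. g w $ i $ j) 0"
    and "c2 i j = deriv (deriv (\<lambda>w. g w $ i $ j)) 0 / 2" for i j
  have left: "(\<Sum>k\<in>UNIV. g w $ i $ k * (of_real (A $ k $ j) / w + of_real (B $ k $ j)))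
      = (if i = j then 1 else 0)" if "w \<in> U" "w \<noteq> 0" for w i j
    using pencil_inverse_mult(1)[OF det[OF that], of i j] by (simp add: g that)
  have right: "(\<Sum>k\<in>UNIV. g w $ k $ j * (of_real (A $ i $ k) / w + of_real (B $ i $ k)))
      = (if i = j then 1 else 0)" if "w \<in> U" "w \<noteq> 0" for w i j
    using pencil_inverse_mult(2)[OF det[OF that], of i j] by (simp add: g that mult.commute)
  note L = taylor_coefficients_of_linear_identity[OF U(1) U0 hol left, folded c0_def c1_def c2_def]
  note R = taylor_coefficients_of_linear_identity[OF U(1) U0 hol right, folded c0_def c1_def c2_def]
  define T0 T1 T2 :: "real^'n^'n" where "T0 = (\<chi> i j. Re (c0 i j))"
    and "T1 = (\<chi> i j. Re (c1 i j))" and "T2 = (\<chi> i j. Re (c2 i j))"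
  note Tdefs = T0_def T1_def T2_def
  have res: "((\<lambda>l. matrix_inv (pencil A B l) $ i $ j) has_contour_integral 2 * of_real pi * \<i> * c1 i j)
      (circlepath 0 C2)" for i j
  proof -
    have hball: "(\<lambda>w. g w $ i $ j) holomorphic_on ball 0 (1 / C2)"
      by (rule holomorphic_on_subset[OF hol order_trans[OF ball_subset_cball U(2)]])
    have hcball: "continuous_on (cball 0 (1 / C2)) (\<lambda>w. g w $ i $ j)"
      by (rule holomorphic_on_imp_continuous_on[OF holomorphic_on_subset[OF hol U(2)]])
    have "((\<lambda>w. g w $ i $ j / (w - 0) ^ Suc 1) has_contour_integral
        2 * pi * \<i> / (fact 1) * (deriv ^^ 1) (\<lambda>w. g w $ i $ j) 0) (circlepath 0 (1 / C2))"
      by (rule Cauchy_has_contour_integral_higher_derivative_circlepath[where k = 1])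
        (use C2 hball hcball in auto)
    then have "((\<lambda>w. g w $ i $ j / w ^ 2) has_contour_integral 2 * of_real pi * \<i> * c1 i j)
        (circlepath 0 (1 / C2))"
      by (simp add: c1_def power2_eq_square)
    from has_contour_integral_circle_inversion[OF C2 this]
    show ?thesis
    proof (rule has_contour_integral_eq)
      fix l assume "l \<in> path_image (circlepath 0 C2)"
      then have "cmod l = C2" using C2 by simp
      then have "1 / l \<in> U" "1 / l \<noteq> 0" using U(2) C2 by (auto simp: subset_iff norm_divide)
      then show "g (1 / l) $ i $ j = matrix_inv (pencil A B l) $ i $ j" by (simp add: g)
    qed
  qed
  have Pint: "contour_integral (circlepath 0 C2)
      (\<lambda>l. (matrix_inv (pencil A B l) ** map_matrix of_real A) $ i $ j)
      = 2 * of_real pi * \<i> * (\<Sum>k\<in>UNIV. c1 i k * of_real (A $ k $ j))" for i j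
  proof (rule contour_integral_unique)
    have "((\<lambda>l. \<Sum>k\<in>UNIV. matrix_inv (pencil A B l) $ i $ k * of_real (A $ k $ j)) has_contour_integral
        (\<Sum>k\<in>UNIV. 2 * of_real pi * \<i> * c1 i k * of_real (A $ k $ j))) (circlepath 0 C2)"
      by (intro has_contour_integral_sum has_contour_integral_rmul res) auto
    then show "((\<lambda>l. (matrix_inv (pencil A B l) ** map_matrix of_real A) $ i $ j) has_contour_integral
        2 * of_real pi * \<i> * (\<Sum>k\<in>UNIV. c1 i k * of_real (A $ k $ j))) (circlepath 0 C2)"
      by (simp add: matrix_matrix_mult_def map_matrix_def sum_distrib_left mult.assoc)
  qed
  have Qint: "contour_integral (circlepath 0 C2)
      (\<lambda>l. (map_matrix of_real A ** matrix_inv (pencil A B l)) $ i $ j)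
      = 2 * of_real pi * \<i> * (\<Sum>k\<in>UNIV. of_real (A $ i $ k) * c1 k j)" for i j
  proof (rule contour_integral_unique)
    have "((\<lambda>l. \<Sum>k\<in>UNIV. of_real (A $ i $ k) * matrix_inv (pencil A B l) $ k $ j) has_contour_integral
        (\<Sum>k\<in>UNIV. of_real (A $ i $ k) * (2 * of_real pi * \<i> * c1 k j))) (circlepath 0 C2)"
      by (intro has_contour_integral_sum has_contour_integral_lmul res) auto
    then show "((\<lambda>l. (map_matrix of_real A ** matrix_inv (pencil A B l)) $ i $ j) has_contour_integral
        2 * of_real pi * \<i> * (\<Sum>k\<in>UNIV. of_real (A $ i $ k) * c1 k j)) (circlepath 0 C2)"
      by (simp add: matrix_matrix_mult_def map_matrix_def sum_distrib_left mult_ac)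
  qed
  have "spectral_P1 A B C2 = T1 ** A"
    unfolding spectral_P1_def Pint
    by (simp add: vec_eq_iff matrix_matrix_mult_def Tdefs)
  moreover have "spectral_Q1 A B C2 = A ** T1"
    unfolding spectral_Q1_def Qint
    by (simp add: vec_eq_iff matrix_matrix_mult_def Tdefs)
  moreover have "T0 ** A = 0" "T1 ** A + T0 ** B = mat 1" "T2 ** A + T1 ** B = 0"
    using L[THEN arg_cong[where f = Re]]
    by (simp_all add: vec_eq_iff matrix_matrix_mult_def mat_def Tdefs sum.distrib)
  moreover have "A ** T0 = 0" "A ** T1 + B ** T0 = mat 1" "A ** T2 + B ** T1 = 0"
    using R[THEN arg_cong[where f = Re]]
    by (simp_all add: vec_eq_iff matrix_matrix_mult_def mat_def Tdefs sum.distrib mult.commute)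
  ultimately show thesis using that by blast
qed

text \<open>
  With \<open>P1 = T1 A\<close>, \<open>P2 = T0 B\<close>, \<open>Q1 = A T1\<close>,
  \<open>Q2 = B T0\<close> everything is algebra in the coefficients. For instance
  \<open>A P2 = A T0 B = 0\<close>, whence \<open>P1 P2 = T1 A P2 = 0\<close>; and
  \<open>Q1 B\<close> and \<open>B P1\<close> both equal \<open>- A T2 A\<close>.
\<close>

lemma spectral_projector_identities:
  fixes A B :: "real^'n^'n"
  assumes idx: "index_le_1_with A B C1 C2"
    and P: "P1 = spectral_P1 A B C2" "P2 = mat 1 - P1"
    and Q: "Q1 = spectral_Q1 A B C2" "Q2 = mat 1 - Q1"
    and G: "G = A + B ** P2"
  shows "P1 ** P2 = 0" "P2 ** P1 = 0" "invertible G"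
    "matrix_inv G ** A = P1" "matrix_inv G ** B ** P2 = P2"
    "matrix_inv G ** Q1 = P1 ** matrix_inv G" "Q2 ** B = B ** P2" "A ** P2 = 0"
    "Q1 ** A = A" "Q2 ** Q2 = Q2"
proof -
  obtain T0 T1 T2 :: "real^'n^'n" where
    T: "T0 ** A = 0" "T1 ** A + T0 ** B = mat 1" "T2 ** A + T1 ** B = 0"
    "A ** T0 = 0" "A ** T1 + B ** T0 = mat 1" "A ** T2 + B ** T1 = 0"
    and P1: "P1 = T1 ** A" and Q1: "Q1 = A ** T1"
    using resolvent_coefficients[OF idx] P(1) Q(1) by metis
  have P2: "P2 = T0 ** B" using T(2) unfolding P(2) P1 by (metis add_diff_cancel_left')
  have Q2: "Q2 = B ** T0" using T(5) unfolding Q(2) Q1 by (metis add_diff_cancel_left')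
  show AP2: "A ** P2 = 0" by (simp add: P2 matrix_mul_assoc T(4))
  show P12: "P1 ** P2 = 0" by (simp add: P1 AP2 flip: matrix_mul_assoc)
  have "P1 ** P1 = P1"
    using P12 by (simp add: P(2) matrix_diff_ldistrib)
  then show "P2 ** P1 = 0" by (simp add: P(2) matrix_diff_rdistrib)
  show QA: "Q1 ** A = A"
  proof -
    have "Q1 ** A = A ** P1" by (simp add: Q1 P1 matrix_mul_assoc)
    also have "\<dots> = A" using AP2 by (simp add: P(2) matrix_diff_ldistrib)
    finally show ?thesis .
  qed
  have "A ** T2 ** A + B ** P1 = 0"
    using arg_cong[OF T(6), of "\<lambda>M. M ** A"] by (simp add: matrix_add_rdistrib P1 matrix_mul_assoc)
  moreover have "A ** T2 ** A + Q1 ** B = 0"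
    using arg_cong[OF T(3), of "\<lambda>M. A ** M"] by (simp add: matrix_add_ldistrib Q1 matrix_mul_assoc)
  ultimately have QB: "Q1 ** B = B ** P1" by (metis add_left_cancel)
  then show "Q2 ** B = B ** P2" by (simp add: P(2) Q(2) matrix_diff_rdistrib matrix_diff_ldistrib)
  have "Q1 ** Q1 = Q1"
    by (metis Q1 QA matrix_mul_assoc)
  then show "Q2 ** Q2 = Q2" by (simp add: Q(2) matrix_diff_rdistrib matrix_diff_ldistrib)
  have QG: "Q1 ** G = A"
    using QB P12 by (simp add: G matrix_add_ldistrib QA matrix_mul_assoc)
      (metis P12 matrix_mul_assoc times0_right)
  have GP1: "G ** P1 = A"
    using \<open>P2 ** P1 = 0\<close> AP2 by (simp add: G matrix_add_rdistrib flip: matrix_mul_assoc)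
      (simp add: P(2) matrix_diff_ldistrib)
  have "x = 0" if "G *v x = 0" for x
  proof -
    have "A *v x = 0" using QG that by (metis matrix_vector_mul_assoc matrix_vector_mult_0_right)
    then have P1x: "P1 *v x = 0" by (simp add: P1 flip: matrix_vector_mul_assoc)
    then have P2x: "P2 *v x = x" by (simp add: P(2) matrix_vector_mult_diff_rdistrib)
    have "B *v x = 0"
      using that \<open>A *v x = 0\<close> P2x by (simp add: G matrix_vector_mult_add_rdistrib flip: matrix_vector_mul_assoc)
    then show ?thesis using P2x by (simp add: P2 flip: matrix_vector_mul_assoc)
  qed
  then show inv: "invertible G"
    using invertible_left_inverse matrix_left_invertible_ker by blast
  note [simp] = matrix_inv_inverse[OF inv]
  show GA: "matrix_inv G ** A = P1"
    by (metis GP1 matrix_inv_inverse(2)[OF inv] matrix_mul_assoc matrix_mul_lid)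
  have "G ** P2 = B ** P2"
    using GP1 by (simp add: P(2) G matrix_diff_ldistrib)
  then show "matrix_inv G ** B ** P2 = P2"
    by (metis matrix_inv_inverse(2)[OF inv] matrix_mul_assoc matrix_mul_lid)
  show "matrix_inv G ** Q1 = P1 ** matrix_inv G"
    by (metis GA QG matrix_inv_inverse(1)[OF inv] matrix_mul_assoc matrix_mul_rid)
qed

section \<open>Global solutions of ordinary differential equations\<close>

definition ode_solution_on :: "(real \<Rightarrow> 'a \<Rightarrow> 'a::real_normed_vector) \<Rightarrow> real set \<Rightarrow> (real \<Rightarrow> 'a) \<Rightarrow> bool" where
  "ode_solution_on F J z \<longleftrightarrow> (\<forall>t\<in>J. (z has_vector_derivative F t (z t)) (at t within J))"

lemma ode_solution_on_subset:
  "ode_solution_on F J z \<Longrightarrow> J' \<subseteq> J \<Longrightarrow> ode_solution_on F J' z"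
  unfolding ode_solution_on_def using has_vector_derivative_within_subset by blast

lemma ode_solution_on_imp_continuous_on:
  "ode_solution_on F J z \<Longrightarrow> continuous_on J z"
  unfolding ode_solution_on_def continuous_on_eq_continuous_within
  using has_vector_derivative_continuous by blast

lemma integral_exp_scaled:
  fixes c a t :: real
  assumes "c > 0" "a \<le> t"
  shows "((\<lambda>s. exp (c * (s - a))) has_integral (exp (c * (t - a)) - 1) / c) {a..t}"
proof -
  have "((\<lambda>s. exp (c * (s - a))) has_integral exp (c * (t - a)) / c - exp (c * (a - a)) / c) {a..t}"
    by (rule fundamental_theorem_of_calculus)
      (use assms in \<open>auto intro!: derivative_eq_intros simp flip: has_real_derivative_iff_has_vector_derivative\<close>)
  then show ?thesis by (simp add: diff_divide_distrib)
qed

text \<open>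
  Picard's theorem on the whole interval at once: for \<open>y(t) = exp(- c (t - a)) z(t)\<close>
  the integral operator contracts the supremum norm by the factor \<open>L / c\<close>.
\<close>

lemma ode_exists_globally_lipschitz:
  fixes F :: "real \<Rightarrow> 'a::euclidean_space \<Rightarrow> 'a"
  assumes ab: "a \<le> b"
    and cont: "continuous_on ({a..b} \<times> UNIV) (\<lambda>(t, z). F t z)"
    and lip: "\<And>t. t \<in> {a..b} \<Longrightarrow> L-lipschitz_on UNIV (F t)"
  obtains z where "z a = z0" "ode_solution_on F {a..b} z"
proof -
  have L0: "L \<ge> 0" using lip[of a] ab by (auto simp: lipschitz_on_def)
  (* The weight exponent: L / c is at most 1/2, and c is positive even for L = 0. *)
  define c where "c = 2 * L + 1"
  have c: "c > 0" "L / c \<le> 1 / 2" using L0 by (auto simp: c_def field_simps)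
  define R where "R y s = F s (exp (c * (s - a)) *\<^sub>R apply_bcontfun y s)" for y and s :: real
  (* The Picard operator for the weighted function y(t) = exp (- c (t - a)) z(t). *)
  define I where "I y t = exp (- c * (t - a)) *\<^sub>R (z0 + integral {a..t} (R y))" for y t
  have contR: "continuous_on {a..b} (R y)" for y
  proof -
    have "continuous_on {a..b} (\<lambda>s. (s, exp (c * (s - a)) *\<^sub>R apply_bcontfun y s))"
      by (intro continuous_intros continuous_on_apply_bcontfun)
    from continuous_on_compose2[OF cont this] show ?thesis by (auto simp: R_def)
  qed
  have intR: "R y integrable_on {a..t}" if "t \<in> {a..b}" for y t
    using that by (intro integrable_continuous_real continuous_on_subset[OF contR]) auto
  have contI: "continuous_on {a..b} (I y)" for y
    unfolding I_def
    by (intro continuous_intros indefinite_integral_continuous_1 integrable_continuous_real contR)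
  have "\<exists>g. \<forall>t. apply_bcontfun g t = I y (clamp a b t)" for y
    using continuous_on_cbox_bcontfunE[of a b "I y"] contI by (metis box_real(2))
  then obtain \<Phi> where \<Phi>: "\<And>y t. apply_bcontfun (\<Phi> y) t = I y (clamp a b t)"
    by metis
  have Idist: "dist (I y t) (I w t) \<le> 1 / 2 * dist y w" if t: "t \<in> {a..b}" for y w t
  proof -
    have "norm (integral {a..t} (\<lambda>s. R y s - R w s)) \<le>
        integral {a..t} (\<lambda>s. L * dist y w * exp (c * (s - a)))"
    proof (rule integral_norm_bound_integral)
      show "(\<lambda>s. R y s - R w s) integrable_on {a..t}"
        by (intro integrable_diff intR t)
      show "(\<lambda>s. L * dist y w * exp (c * (s - a))) integrable_on {a..t}"
        by (intro integrable_continuous_real continuous_intros)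
      fix s assume s: "s \<in> {a..t}"
      have "norm (R y s - R w s) \<le> L * norm (exp (c * (s - a)) *\<^sub>R y s - exp (c * (s - a)) *\<^sub>R w s)"
        unfolding R_def dist_norm[symmetric] by (rule lipschitz_onD[OF lip]) (use s t in auto)
      also have "\<dots> = L * (exp (c * (s - a)) * dist (y s) (w s))"
        by (simp add: dist_norm flip: scaleR_diff_right)
      also have "\<dots> \<le> L * (exp (c * (s - a)) * dist y w)"
        using L0 by (intro mult_left_mono dist_bounded) auto
      finally show "norm (R y s - R w s) \<le> L * dist y w * exp (c * (s - a))"
        by (simp add: mult_ac)
    qed
    also have "\<dots> = L * dist y w * ((exp (c * (t - a)) - 1) / c)"
      using integral_exp_scaled[OF c(1), of a t] t by (simp add: integral_unique)
    also have "\<dots> \<le> L * dist y w * (exp (c * (t - a)) / c)"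
      using L0 c by (intro mult_left_mono divide_right_mono) auto
    also have "\<dots> = L / c * (exp (c * (t - a)) * dist y w)" by simp
    also have "\<dots> \<le> 1 / 2 * (exp (c * (t - a)) * dist y w)"
      using c by (intro mult_right_mono) auto
    finally have le: "norm (integral {a..t} (\<lambda>s. R y s - R w s)) \<le> exp (c * (t - a)) * (1 / 2 * dist y w)"
      by simp
    have "dist (I y t) (I w t) = exp (- c * (t - a)) * norm (integral {a..t} (\<lambda>s. R y s - R w s))"
      using t by (simp add: I_def dist_norm integral_diff intR flip: scaleR_diff_right)
    also have "\<dots> \<le> exp (- c * (t - a)) * (exp (c * (t - a)) * (1 / 2 * dist y w))"
      by (intro mult_left_mono le) auto
    also have "\<dots> = 1 / 2 * dist y w" by (simp flip: mult.assoc exp_add)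
    finally show ?thesis .
  qed
  have cl: "clamp a b t \<in> {a..b}" for t
    using clamp_in_interval[of a b t] ab by (simp add: box_real)
  have "dist (\<Phi> y) (\<Phi> w) \<le> 1 / 2 * dist y w" for y w
    by (rule dist_bound) (unfold \<Phi>, rule Idist[OF cl])
  then have "\<exists>!y. \<Phi> y = y"
    using banach_fix_type[of "1/2" \<Phi>] by auto
  then obtain y where y: "\<Phi> y = y" by auto
  define z where "z t = exp (c * (t - a)) *\<^sub>R y t" for t
  have z_eq: "z t = z0 + integral {a..t} (\<lambda>s. F s (z s))" if "t \<in> {a..b}" for t
  proof -
    have "y t = I y t" using \<Phi>[of y t] y that clamp_cancel_cbox[of t a b] by (simp add: box_real)
    then have "z t = z0 + integral {a..t} (R y)"
      by (simp add: z_def I_def flip: exp_add)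
    moreover have "R y = (\<lambda>s. F s (z s))" by (simp add: R_def z_def fun_eq_iff)
    ultimately show ?thesis by simp
  qed
  show thesis
  proof (rule that)
    show "z a = z0" using z_eq[of a] ab by simp
    show "ode_solution_on F {a..b} z" unfolding ode_solution_on_def
    proof
      fix t assume t: "t \<in> {a..b}"
      have cF: "continuous_on {a..b} (\<lambda>s. F s (z s))"
        using contR[of y] by (simp add: R_def[abs_def] z_def)
      have "((\<lambda>u. z0 + integral {a..u} (\<lambda>s. F s (z s))) has_vector_derivative F t (z t)) (at t within {a..b})"
        using integral_has_vector_derivative[OF cF t]
        by (auto intro!: derivative_eq_intros)
      then show "(z has_vector_derivative F t (z t)) (at t within {a..b})"
        by (rule has_vector_derivative_transform[rotated 2]) (use t z_eq in auto)
    qed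
  qed
qed

text \<open>
  Gronwall's argument: \<open>exp(- 2 L (t - a)) |y - z|^2\<close> does not increase.
\<close>

lemma ode_unique_lipschitz:
  fixes F :: "real \<Rightarrow> 'a::real_inner \<Rightarrow> 'a"
  assumes lip: "\<And>t. t \<in> {a..b} \<Longrightarrow> L-lipschitz_on X (F t)"
    and y: "ode_solution_on F {a..b} y" "\<And>t. t \<in> {a..b} \<Longrightarrow> y t \<in> X"
    and z: "ode_solution_on F {a..b} z" "\<And>t. t \<in> {a..b} \<Longrightarrow> z t \<in> X"
    and eq: "y a = z a" and t: "t \<in> {a..b}"
  shows "y t = z t"
proof -
  define w where "w s = exp (- (2 * L) * (s - a)) * ((y s - z s) \<bullet> (y s - z s))" for s
  have cont: "continuous_on {a..t} w"
    unfolding w_def using t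
    by (auto intro!: continuous_intros continuous_on_subset[OF ode_solution_on_imp_continuous_on[OF y(1)]]
        continuous_on_subset[OF ode_solution_on_imp_continuous_on[OF z(1)]])
  have "w a \<ge> w t"
  proof (rule DERIV_nonpos_imp_decreasing_open[OF _ _ cont])
    show "a \<le> t" using t by simp
    fix s assume s: "a < s" "s < t"
    then have sab: "s \<in> {a..b}" "s \<in> {a<..<b}" using t by auto
    have at: "at s within {a..b} = at s" by (rule at_within_Icc_at) (use sab(2) in auto)
    have d: "(y has_vector_derivative F s (y s)) (at s)" "(z has_vector_derivative F s (z s)) (at s)"
      using y(1) z(1) sab(1) unfolding ode_solution_on_def at[symmetric] by blast+
    have "((\<lambda>s. (y s - z s) \<bullet> (y s - z s)) has_vector_derivative
        (y s - z s) \<bullet> (F s (y s) - F s (z s)) + (F s (y s) - F s (z s)) \<bullet> (y s - z s)) (at s)"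
      by (intro bounded_bilinear.has_vector_derivative[OF bounded_bilinear_inner] has_vector_derivative_diff d)
    then have dq: "((\<lambda>s. (y s - z s) \<bullet> (y s - z s)) has_real_derivative
        2 * ((y s - z s) \<bullet> (F s (y s) - F s (z s)))) (at s)"
      by (simp add: has_real_derivative_iff_has_vector_derivative inner_commute)
    have de: "((\<lambda>s. exp (- (2 * L) * (s - a))) has_real_derivative
        exp (- (2 * L) * (s - a)) * (- (2 * L))) (at s)"
      by (auto intro!: derivative_eq_intros)
    have alg: "E * (- (2 * L)) * q + (2 * p) * E = E * (2 * p - 2 * L * q)" for E p q :: real
      by (simp add: algebra_simps)
    have "(w has_real_derivative exp (- (2 * L) * (s - a)) *
        (2 * ((y s - z s) \<bullet> (F s (y s) - F s (z s))) - 2 * L * ((y s - z s) \<bullet> (y s - z s)))) (at s)"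
      unfolding w_def by (rule DERIV_cong[OF DERIV_mult[OF de dq] alg])
    moreover have "(y s - z s) \<bullet> (F s (y s) - F s (z s)) \<le> L * ((y s - z s) \<bullet> (y s - z s))"
    proof -
      have "(y s - z s) \<bullet> (F s (y s) - F s (z s)) \<le> norm (y s - z s) * norm (F s (y s) - F s (z s))"
        by (rule norm_cauchy_schwarz)
      also have "\<dots> \<le> norm (y s - z s) * (L * norm (y s - z s))"
        using lipschitz_onD[OF lip[OF sab(1)] y(2)[OF sab(1)] z(2)[OF sab(1)]]
        by (intro mult_left_mono) (auto simp: dist_norm)
      finally show ?thesis by (simp add: dot_square_norm power2_eq_square mult.left_commute)
    qed
    ultimately show "\<exists>d. (w has_real_derivative d) (at s) \<and> d \<le> 0"
      by (intro exI conjI) (auto intro!: mult_nonneg_nonpos)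
  qed
  moreover have "w a = 0" by (simp add: w_def eq)
  moreover have "w t \<ge> 0" by (simp add: w_def)
  ultimately have "w t = 0" by simp
  then show ?thesis by (simp add: w_def)
qed

lemma local_lipschitz_on_cball:
  fixes F :: "real \<Rightarrow> 'a::euclidean_space \<Rightarrow> 'a"
  assumes cont: "continuous_on ({a..} \<times> UNIV) (\<lambda>(t, z). F t z)"
    and lip: "local_lipschitz {a..} UNIV F"
  shows "\<exists>L. \<forall>t\<in>{a..b}. L-lipschitz_on (cball 0 \<rho>) (F t)"
proof -
  have ll: "local_lipschitz {a..b} (cball 0 \<rho>) F"
    using lip by (rule local_lipschitz_subset) auto
  have c: "continuous_on {a..b} (\<lambda>t. F t x)" for x
  proof -
    have "continuous_on {a..b} (\<lambda>t. (t, x))" by (intro continuous_intros)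
    moreover have "(\<lambda>t. (t, x)) ` {a..b} \<subseteq> {a..} \<times> UNIV" by auto
    ultimately have "continuous_on {a..b} (\<lambda>t. case (t, x) of (t, z) \<Rightarrow> F t z)"
      by (rule continuous_on_compose2[OF cont])
    then show ?thesis by simp
  qed
  show ?thesis
    by (rule local_lipschitz_compact_implies_lipschitz[OF ll compact_cball compact_Icc c]) blast
qed

lemma ode_unique_local_lipschitz:
  fixes F :: "real \<Rightarrow> 'a::euclidean_space \<Rightarrow> 'a"
  assumes cont: "continuous_on ({a..} \<times> UNIV) (\<lambda>(t, z). F t z)"
    and lip: "local_lipschitz {a..} UNIV F"
    and y: "ode_solution_on F {a..b} y" and z: "ode_solution_on F {a..b} z"
    and eq: "y a = z a" and t: "t \<in> {a..b}"
  shows "y t = z t"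
proof -
  have "bounded (y ` {a..b})" "bounded (z ` {a..b})"
    by (rule compact_imp_bounded[OF compact_continuous_image[OF ode_solution_on_imp_continuous_on[OF y] compact_Icc]],
        rule compact_imp_bounded[OF compact_continuous_image[OF ode_solution_on_imp_continuous_on[OF z] compact_Icc]])
  then have "bounded (y ` {a..b} \<union> z ` {a..b})" by simp
  then obtain \<rho> where \<rho>: "\<forall>x\<in>y ` {a..b} \<union> z ` {a..b}. norm x \<le> \<rho>"
    unfolding bounded_iff ..
  obtain L where L: "\<forall>t\<in>{a..b}. L-lipschitz_on (cball 0 \<rho>) (F t)"
    using local_lipschitz_on_cball[OF cont lip] ..
  show ?thesis
  proof (rule ode_unique_lipschitz[OF _ y _ z _ eq t])
    fix s assume s: "s \<in> {a..b}"
    show "L-lipschitz_on (cball 0 \<rho>) (F s)" by (rule L[rule_format, OF s])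
    show "y s \<in> cball 0 \<rho>" "z s \<in> cball 0 \<rho>" using \<rho> s by auto
  qed
qed

lemma first_time_norm_eq:
  fixes z :: "real \<Rightarrow> 'a::real_normed_vector"
  assumes cont: "continuous_on {a..b} z" and a: "norm (z a) < \<rho>"
    and t: "t \<in> {a..b}" "norm (z t) \<ge> \<rho>"
  obtains \<tau> where "\<tau> \<in> {a..b}" "norm (z \<tau>) = \<rho>" "\<And>s. s \<in> {a..\<tau>} \<Longrightarrow> norm (z s) \<le> \<rho>"
proof -
  define S where "S = {s \<in> {a..b}. norm (z s) = \<rho>}"
  have hit: "\<exists>s\<in>S. s \<le> r" if r: "r \<in> {a..b}" "norm (z r) \<ge> \<rho>" for r
  proof -
    have "\<exists>s\<ge>a. s \<le> r \<and> norm (z s) = \<rho>"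
      by (rule IVT') (use r a in \<open>auto intro!: continuous_intros continuous_on_subset[OF cont]\<close>)
    then show ?thesis using r by (auto simp: S_def)
  qed
  have "closed S"
  proof -
    have "closed ({a..b} \<inter> (\<lambda>s. norm (z s)) -` {\<rho>})"
      by (rule continuous_closed_preimage) (auto intro!: continuous_intros cont)
    moreover have "{a..b} \<inter> (\<lambda>s. norm (z s)) -` {\<rho>} = S" by (auto simp: S_def)
    ultimately show ?thesis by simp
  qed
  moreover have "bounded S"
    by (rule bounded_subset[of "{a..b}"]) (auto simp: S_def)
  ultimately have "compact S" by (simp add: compact_eq_bounded_closed)
  moreover have "S \<noteq> {}" using hit[OF t] by auto
  ultimately obtain \<tau> where \<tau>: "\<tau> \<in> S" "\<And>s. s \<in> S \<Longrightarrow> \<tau> \<le> s"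
    using compact_attains_inf by metis
  show thesis
  proof (rule that[of \<tau>])
    fix s assume s: "s \<in> {a..\<tau>}"
    show "norm (z s) \<le> \<rho>"
    proof (rule ccontr)
      assume gt: "\<not> norm (z s) \<le> \<rho>"
      then obtain r where "r \<in> S" "r \<le> s" using hit[of s] s \<tau>(1) by (auto simp: S_def)
      then have "s = \<tau>" using \<tau>(2)[of r] s by auto
      then show False using gt \<tau>(1) by (auto simp: S_def)
    qed
  qed (use \<tau>(1) in \<open>auto simp: S_def\<close>)
qed

text \<open>
  The right-hand side is made globally Lipschitz by composing it with the projection onto a ball
  whose radius exceeds the a priori bound. A solution of the modified equation solves the original
  one until it leaves that ball, and the bound forbids it to reach the boundary.
\<close>

lemma ode_exists_on_interval:
  fixes F :: "real \<Rightarrow> 'a::euclidean_space \<Rightarrow> 'a"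
  assumes ab: "a \<le> b"
    and cont: "continuous_on ({a..} \<times> UNIV) (\<lambda>(t, z). F t z)"
    and lip: "local_lipschitz {a..} UNIV F"
    and bound: "\<And>c z. c \<in> {a..b} \<Longrightarrow> ode_solution_on F {a..c} z \<Longrightarrow> z a = z0 \<Longrightarrow> norm (z c) \<le> M"
  obtains z where "z a = z0" "ode_solution_on F {a..b} z"
proof -
  define \<rho> where "\<rho> = max M (norm z0) + 1"
  have \<rho>: "\<rho> > M" "\<rho> > norm z0" "\<rho> > 0" using norm_ge_zero[of z0] unfolding \<rho>_def by linarith+
  define pr where "pr = closest_point (cball (0::'a) \<rho>)"
  have pr_in: "pr z \<in> cball 0 \<rho>" for z
    unfolding pr_def by (rule closest_point_in_set) (use \<rho> in auto)
  have pr_id: "pr z = z" if "norm z \<le> \<rho>" for z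
    unfolding pr_def by (rule closest_point_self) (use that in auto)
  have pr_lip: "dist (pr y) (pr z) \<le> dist y z" for y z
    unfolding pr_def by (rule closest_point_lipschitz) (use \<rho> in auto)
  have pr_cont: "continuous_on UNIV pr"
    unfolding pr_def by (rule continuous_on_closest_point) (use \<rho> in auto)
  obtain L where L: "\<And>t. t \<in> {a..b} \<Longrightarrow> L-lipschitz_on (cball 0 \<rho>) (F t)"
    using local_lipschitz_on_cball[OF cont lip] by blast
  have L0: "L \<ge> 0" using L[of a] ab by (auto simp: lipschitz_on_def)
  define Fr where "Fr t z = F t (pr z)" for t z
  have contr: "continuous_on ({a..b} \<times> UNIV) (\<lambda>(t, z). Fr t z)"
  proof -
    have "continuous_on ({a..b} \<times> UNIV) (\<lambda>p. (fst p, pr (snd p)))"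
      by (intro continuous_on_Pair continuous_on_fst continuous_on_id
          continuous_on_compose2[OF pr_cont continuous_on_snd[OF continuous_on_id]]) simp
    moreover have "(\<lambda>p. (fst p, pr (snd p))) ` ({a..b} \<times> UNIV) \<subseteq> {a..} \<times> UNIV" by auto
    ultimately have "continuous_on ({a..b} \<times> UNIV) (\<lambda>p. case (fst p, pr (snd p)) of (t, z) \<Rightarrow> F t z)"
      by (rule continuous_on_compose2[OF cont])
    then show ?thesis by (simp add: Fr_def split_beta)
  qed
  have lipr: "L-lipschitz_on UNIV (Fr t)" if "t \<in> {a..b}" for t
  proof (rule lipschitz_onI)
    fix y z
    have "dist (Fr t y) (Fr t z) \<le> L * dist (pr y) (pr z)"
      unfolding Fr_def by (rule lipschitz_onD[OF L[OF that] pr_in pr_in])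
    also have "\<dots> \<le> L * dist y z" by (rule mult_left_mono[OF pr_lip L0])
    finally show "dist (Fr t y) (Fr t z) \<le> L * dist y z" .
  qed (rule L0)
  obtain z where z: "z a = z0" "ode_solution_on Fr {a..b} z"
    by (rule ode_exists_globally_lipschitz[OF ab contr lipr, of z0])
  have cz: "continuous_on {a..b} z" using z(2) by (rule ode_solution_on_imp_continuous_on)
  have orig: "ode_solution_on F {a..c} z" if "c \<in> {a..b}" "\<And>s. s \<in> {a..c} \<Longrightarrow> norm (z s) \<le> \<rho>" for c
    unfolding ode_solution_on_def
  proof
    fix t assume t: "t \<in> {a..c}"
    have "ode_solution_on Fr {a..c} z"
      using ode_solution_on_subset[OF z(2)] that(1) by simp
    then have "(z has_vector_derivative Fr t (z t)) (at t within {a..c})"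
      using t unfolding ode_solution_on_def by blast
    then show "(z has_vector_derivative F t (z t)) (at t within {a..c})"
      using pr_id[OF that(2)[OF t]] by (simp add: Fr_def)
  qed
  have "norm (z t) < \<rho>" if t: "t \<in> {a..b}" for t
  proof (rule ccontr)
    assume "\<not> norm (z t) < \<rho>"
    then obtain \<tau> where \<tau>: "\<tau> \<in> {a..b}" "norm (z \<tau>) = \<rho>" "\<And>s. s \<in> {a..\<tau>} \<Longrightarrow> norm (z s) \<le> \<rho>"
      using first_time_norm_eq[OF cz _ t, of \<rho>] z(1) \<rho>(2) by (metis not_less)
    from bound[OF \<tau>(1) orig[OF \<tau>(1,3)] z(1)] \<tau>(2) \<rho> show False by simp
  qed
  then have "ode_solution_on F {a..b} z" using orig[of b] ab less_imp_le by fastforce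
  then show thesis using that z(1) by blast
qed

theorem ode_exists_global:
  fixes F :: "real \<Rightarrow> 'a::euclidean_space \<Rightarrow> 'a"
  assumes cont: "continuous_on ({a..} \<times> UNIV) (\<lambda>(t, z). F t z)"
    and lip: "local_lipschitz {a..} UNIV F"
    and bound: "\<And>b. b > a \<Longrightarrow> \<exists>M. \<forall>c\<in>{a..b}. \<forall>z. ode_solution_on F {a..c} z \<and> z a = z0 \<longrightarrow> norm (z c) \<le> M"
  obtains z where "z a = z0" "ode_solution_on F {a..} z"
proof -
  have "\<exists>z. z a = z0 \<and> ode_solution_on F {a..b} z" if ba: "b > a" for b
  proof -
    obtain M where M: "\<forall>c\<in>{a..b}. \<forall>z. ode_solution_on F {a..c} z \<and> z a = z0 \<longrightarrow> norm (z c) \<le> M"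
      using bound[OF ba] by blast
    show ?thesis
      by (rule ode_exists_on_interval[OF less_imp_le[OF ba] cont lip, of z0 M]) (use M in auto)
  qed
  then obtain zs where zs: "\<And>b. b > a \<Longrightarrow> zs b a = z0" "\<And>b. b > a \<Longrightarrow> ode_solution_on F {a..b} (zs b)"
    by metis
  have agree: "zs b t = zs c t" if "a < b" "b \<le> c" "t \<in> {a..b}" for b c t
    by (rule ode_unique_local_lipschitz[OF cont lip zs(2)[OF that(1)] ode_solution_on_subset[OF zs(2)] _ that(3)])
      (use that zs in auto)
  (* By uniqueness the solutions on the intervals [a, b] agree, so each time may choose its own interval. *)
  define z where "z t = zs (t + 1) t" for t
  have z_eq: "z t = zs b t" if "a < b" "t \<in> {a..b}" for b t
  proof (cases "b \<le> t + 1")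
    case True
    then show ?thesis using agree[of b "t + 1" t] that by (simp add: z_def)
  next
    case False
    then show ?thesis using agree[of "t + 1" b t] that by (simp add: z_def)
  qed
  show thesis
  proof (rule that)
    show "z a = z0" by (simp add: z_def zs)
    show "ode_solution_on F {a..} z" unfolding ode_solution_on_def
    proof
      fix t assume t: "t \<in> {a..}"
      have at: "at t within {a..} = at t within {a..t+1}"
        by (rule at_within_nhd[of _ "{..<t+1}"]) auto
      have "(zs (t + 1) has_vector_derivative F t (zs (t + 1) t)) (at t within {a..t+1})"
        using zs(2)[of "t + 1"] t by (auto simp: ode_solution_on_def)
      then have "(z has_vector_derivative F t (zs (t + 1) t)) (at t within {a..t+1})"
        by (rule has_vector_derivative_transform[rotated 2]) (use t z_eq[of "t + 1"] in auto)
      then show "(z has_vector_derivative F t (z t)) (at t within {a..})"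
        unfolding at by (simp add: z_def)
    qed
  qed
qed

text \<open>
  Osgood's criterion. Whenever \<open>v \<ge> c\<close>, the primitive of \<open>1 / U\<close> along
  \<open>v\<close> grows at rate at most \<open>K\<close>; after its last visit to the level
  \<open>c\<close>, the function \<open>v\<close> hence cannot climb to a level \<open>m\<close>
  whose distance from \<open>c\<close>, measured by that primitive, exceeds
  \<open>K (b - a)\<close>.
\<close>

lemma comparison_bound:
  fixes v v' U :: "real \<Rightarrow> real"
  assumes U: "continuous_on {0<..} U" "\<And>x. x > 0 \<Longrightarrow> U x > 0"
    and c: "0 < c" "c \<le> m" "v a < c"
    and cont: "continuous_on {a..b} v"
    and deriv: "\<And>t. t \<in> {a<..<b} \<Longrightarrow> (v has_real_derivative v' t) (at t)"
    and le: "\<And>t. t \<in> {a<..<b} \<Longrightarrow> v t \<ge> c \<Longrightarrow> v' t \<le> K * U (v t)"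
    and K: "K \<ge> 0" "integral {c..m} (\<lambda>x. 1 / U x) > K * (b - a)"
    and t: "t \<in> {a..b}"
  shows "v t < m"
proof (rule ccontr)
  assume "\<not> v t < m"
  then have vt: "v t \<ge> m" by simp
  (* The maximum of S is the last time at which v is at most c. *)
  define S where "S = {s \<in> {a..t}. v s \<le> c}"
  have cont': "continuous_on {a..t} v" using cont t by (auto intro: continuous_on_subset)
  have "closed S"
  proof -
    have "closed ({a..t} \<inter> v -` {..c})"
      by (rule continuous_closed_preimage) (auto intro!: cont')
    moreover have "{a..t} \<inter> v -` {..c} = S" by (auto simp: S_def)
    ultimately show ?thesis by simp
  qed
  moreover have "bounded S"
    by (rule bounded_subset[of "{a..t}"]) (auto simp: S_def)
  ultimately have "compact S" by (simp add: compact_eq_bounded_closed)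
  moreover have "a \<in> S" using c t by (auto simp: S_def)
  ultimately obtain \<tau> where \<tau>: "\<tau> \<in> S" "\<And>s. s \<in> S \<Longrightarrow> s \<le> \<tau>"
    using compact_attains_sup[of S] by auto
  have at: "\<tau> \<in> {a..t}" "v \<tau> \<le> c" using \<tau>(1) by (auto simp: S_def)
  have above: "v s > c" if "s \<in> {\<tau><..t}" for s
  proof (rule ccontr)
    assume "\<not> v s > c"
    then have "s \<in> S" using that at by (simp add: S_def)
    then show False using \<tau>(2)[of s] that by simp
  qed
  have pos: "{c..v t} \<subseteq> {0<..}" using c by auto
  have Unz: "\<forall>x\<in>{0<..}. U x \<noteq> 0"
  proof
    fix x :: real assume "x \<in> {0<..}"
    then show "U x \<noteq> 0" using U(2)[of x] by simp
  qed
  have contU: "continuous_on {0<..} (\<lambda>x. 1 / U x)"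
    by (intro continuous_on_divide continuous_on_const U(1) Unz)
  have U_int: "(\<lambda>x. 1 / U x) integrable_on {p..q}" if "p > 0" for p q
    using that by (intro integrable_continuous_real continuous_on_subset[OF contU]) auto
  have "v \<tau> = c"
  proof (rule ccontr)
    assume "v \<tau> \<noteq> c"
    then have "v \<tau> < c" using at by simp
    moreover have "continuous_on {\<tau>..t} v" using at by (intro continuous_on_subset[OF cont']) simp
    ultimately obtain s where "\<tau> \<le> s" "s \<le> t" "v s = c"
      using IVT'[of v \<tau> c t] at vt c by auto
    then have "s \<in> S" using at by (auto simp: S_def)
    then have "s = \<tau>" using \<tau>(2)[of s] \<open>\<tau> \<le> s\<close> by simp
    then show False using \<open>v s = c\<close> \<open>v \<tau> < c\<close> by simp
  qed
  have ge_c: "v s \<ge> c" if "s \<in> {\<tau>..t}" for s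
    using above[of s] that \<open>v \<tau> = c\<close> by (cases "s = \<tau>") (simp_all add: less_imp_le)
  have "bounded (v ` {\<tau>..t})"
    using at by (intro compact_imp_bounded compact_continuous_image continuous_on_subset[OF cont']) auto
  then have "bdd_above (v ` {\<tau>..t})" by (rule bounded_imp_bdd_above)
  then obtain W where W: "\<And>s. s \<in> {\<tau>..t} \<Longrightarrow> v s \<le> W"
    by (meson bdd_above.unfold imageI)
  define \<Psi> where "\<Psi> x = integral {c..x} (\<lambda>x. 1 / U x)" for x
  have d\<Psi>: "(\<Psi> has_real_derivative 1 / U x) (at x)" if "x > c" for x
  proof -
    have "(\<Psi> has_real_derivative 1 / U x) (at x within {c..x+1})"
      unfolding \<Psi>_def
      by (rule integral_has_real_derivative) (use that c in \<open>auto intro!: continuous_on_subset[OF contU]\<close>)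
    then show ?thesis using that by (simp add: at_within_Icc_at)
  qed
  have cont\<Psi>: "continuous_on {c..W} \<Psi>"
    unfolding \<Psi>_def by (rule indefinite_integral_continuous_1[OF U_int[OF c(1)]])
  define g where "g s = \<Psi> (v s) - K * s" for s
  have "g \<tau> \<ge> g t"
  proof (rule DERIV_nonpos_imp_decreasing_open[where f = g])
    show "\<tau> \<le> t" using at by simp
    have "continuous_on {\<tau>..t} v" using at by (intro continuous_on_subset[OF cont']) simp
    moreover have "v ` {\<tau>..t} \<subseteq> {c..W}" using ge_c W by fastforce
    ultimately have "continuous_on {\<tau>..t} (\<lambda>s. \<Psi> (v s))" by (rule continuous_on_compose2[OF cont\<Psi>])
    then show "continuous_on {\<tau>..t} g" unfolding g_def by (intro continuous_intros)
    fix s assume s: "\<tau> < s" "s < t"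
    then have sab: "s \<in> {a<..<b}" using at t by auto
    have vs: "v s > c" using above s by auto
    have Us: "U (v s) > 0" using U(2) vs c by auto
    have "((\<lambda>s. \<Psi> (v s)) has_real_derivative 1 / U (v s) * v' s) (at s)"
      by (rule DERIV_chain2[OF d\<Psi>[OF vs] deriv[OF sab]])
    then have "(g has_real_derivative 1 / U (v s) * v' s - K) (at s)"
      unfolding g_def by (rule DERIV_diff[OF _ DERIV_cmult_Id])
    moreover have "1 / U (v s) * v' s - K \<le> 0"
      using le[OF sab less_imp_le[OF vs]] Us by (simp add: divide_le_eq)
    ultimately show "\<exists>d. (g has_real_derivative d) (at s) \<and> d \<le> 0" by blast
  qed
  then have "\<Psi> (v t) \<le> \<Psi> c + K * (t - \<tau>)"
    by (simp add: g_def \<open>v \<tau> = c\<close> algebra_simps)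
  also have "\<dots> = K * (t - \<tau>)" by (simp add: \<Psi>_def)
  also have "\<dots> \<le> K * (b - a)" using K at t by (intro mult_left_mono) auto
  also have "\<dots> < \<Psi> m" using K by (simp add: \<Psi>_def)
  also have "\<Psi> m \<le> \<Psi> (v t)" unfolding \<Psi>_def
  proof (rule integral_subset_le)
    show "(\<lambda>x. 1 / U x) integrable_on {c..m}" "(\<lambda>x. 1 / U x) integrable_on {c..v t}"
      by (rule U_int[OF c(1)])+
    show "{c..m} \<subseteq> {c..v t}" using vt by simp
    show "\<forall>x\<in>{c..v t}. 0 \<le> 1 / U x"
    proof
      fix x assume "x \<in> {c..v t}"
      then show "0 \<le> 1 / U x" using U(2)[of x] c(1) by simp
    qed
  qed
  finally show False by simp
qed

section \<open>Roots that depend on a parameter\<close>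

lemma dist_Pair_le_add: "dist (a, b) (c, d) \<le> dist a c + dist b d"
  by (simp add: dist_Pair_Pair sqrt_sum_squares_le_sum)

text \<open>
  A root \<open>\<eta> p\<close> of \<open>\<Psi> p\<close>, unique and nondegenerate, where only
  continuity in the parameter is required. The implicit function theorem is thus needed in a form
  without derivatives in \<open>p\<close>: in the application the parameter contains the time, in
  which the equation is merely continuous.
\<close>

locale parametrized_root =
  fixes S :: "'p::metric_space set" and \<Psi> :: "'p \<Rightarrow> 'a::euclidean_space \<Rightarrow> 'a"
    and D :: "'p \<Rightarrow> 'a \<Rightarrow> 'a \<Rightarrow>\<^sub>L 'a" and \<eta> :: "'p \<Rightarrow> 'a"
  assumes cont: "continuous_on (S \<times> UNIV) (\<lambda>(p, u). \<Psi> p u)"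
    and deriv: "\<And>p u. p \<in> S \<Longrightarrow> (\<Psi> p has_derivative D p u) (at u)"
    and contD: "continuous_on (S \<times> UNIV) (\<lambda>(p, u). D p u)"
    and root: "\<And>p. p \<in> S \<Longrightarrow> \<Psi> p (\<eta> p) = 0"
    and uniq: "\<And>p u. p \<in> S \<Longrightarrow> \<Psi> p u = 0 \<Longrightarrow> u = \<eta> p"
    and inj: "\<And>p v. p \<in> S \<Longrightarrow> D p (\<eta> p) v = 0 \<Longrightarrow> v = 0"
begin

text \<open>
  The simplified Newton map \<open>u - \<Gamma> (\<Psi> q u)\<close>, with \<open>\<Gamma>\<close>
  the inverse of the derivative at the reference point, is a contraction near that point for all
  nearby \<open>q\<close>. Its fixed point is the root, and the distance of any point from the root
  is controlled by the residual at that point. Continuity and Lipschitz continuity of the root both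
  follow from this estimate.
\<close>

lemma root_distance_le_residual:
  assumes p: "p \<in> S"
  shows "\<exists>\<delta>>0. \<exists>K\<ge>0. \<forall>q\<in>S \<inter> ball p \<delta>. \<forall>r\<in>S \<inter> ball p \<delta>. norm (\<eta> q - \<eta> r) \<le> K * norm (\<Psi> q (\<eta> r))"
proof -
  define u0 where "u0 = \<eta> p"
  let ?D0 = "blinfun_apply (D p u0)"
  have lin: "linear ?D0" by (rule bounded_linear.linear[OF blinfun.bounded_linear_right])
  moreover have "inj ?D0" unfolding linear_injective_0[OF lin] using inj[OF p] by (simp add: u0_def)
  ultimately obtain \<Gamma> where \<Gamma>: "linear \<Gamma>" "\<Gamma> \<circ> ?D0 = id"
    using linear_injective_left_inverse by blast
  have \<Gamma>D: "\<Gamma> (?D0 v) = v" for v using \<Gamma>(2) by (metis comp_apply id_apply)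
  have "?D0 \<circ> \<Gamma> = id" using linear_inverse_left[OF lin \<Gamma>(1)] \<Gamma>(2) by simp
  then have \<Gamma>0: "x = 0" if "\<Gamma> x = 0" for x
    using that by (metis blinfun.zero_right comp_apply id_apply)
  have bl\<Gamma>: "bounded_linear \<Gamma>" using \<Gamma>(1) by (simp add: linear_conv_bounded_linear)
  obtain K where K: "K > 0" "\<And>x. norm (\<Gamma> x) \<le> norm x * K"
    using bounded_linear.pos_bounded[OF bl\<Gamma>] by blast
  obtain \<epsilon>0 where \<epsilon>0: "\<epsilon>0 > 0"
    "\<And>q u. q \<in> S \<Longrightarrow> dist (q, u) (p, u0) < \<epsilon>0 \<Longrightarrow> dist (D q u) (D p u0) < 1 / (2 * K)"
    using contD[unfolded continuous_on_iff, rule_format, of "(p, u0)" "1 / (2 * K)"] p K(1) by auto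
  (* A third for the unknown and a half for the parameter keep the pair within distance \<epsilon>0. *)
  define \<epsilon> where "\<epsilon> = \<epsilon>0 / 3"
  have \<epsilon>: "\<epsilon> > 0" using \<epsilon>0 by (simp add: \<epsilon>_def)
  obtain \<delta>1 where \<delta>1: "\<delta>1 > 0"
    "\<And>q u. q \<in> S \<Longrightarrow> dist (q, u) (p, u0) < \<delta>1 \<Longrightarrow> dist (\<Psi> q u) (\<Psi> p u0) < \<epsilon> / (2 * K)"
    using cont[unfolded continuous_on_iff, rule_format, of "(p, u0)" "\<epsilon> / (2 * K)"] p K(1) \<epsilon> by auto
  define \<delta> where "\<delta> = min (\<epsilon>0 / 2) \<delta>1"
  define T where "T q u = u - \<Gamma> (\<Psi> q u)" for q u
  have contr: "norm (T q u - T q v) \<le> 1 / 2 * norm (u - v)"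
    if q: "q \<in> S" "dist q p < \<delta>" and u: "u \<in> cball u0 \<epsilon>" and v: "v \<in> cball u0 \<epsilon>" for q u v
  proof (rule differentiable_bound[OF convex_cball _ _ u v])
    fix x assume x: "x \<in> cball u0 \<epsilon>"
    have dT: "(T q has_derivative (\<lambda>h. h - \<Gamma> (D q x h))) (at x)"
      unfolding T_def
      by (intro has_derivative_diff has_derivative_ident
          bounded_linear.has_derivative[OF bl\<Gamma> deriv[OF q(1)]])
    then show "(T q has_derivative (\<lambda>h. h - \<Gamma> (D q x h))) (at x within cball u0 \<epsilon>)"
      by (rule has_derivative_at_withinI)
    show "onorm (\<lambda>h. h - \<Gamma> (D q x h)) \<le> 1 / 2"
    proof (rule onorm_le)
      fix h
      have "dist (q, x) (p, u0) \<le> dist q p + dist x u0" by (rule dist_Pair_le_add)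
      also have "\<dots> < \<epsilon>0" using q(2) x \<epsilon>0(1) by (simp add: \<epsilon>_def \<delta>_def dist_commute)
      finally have near: "norm (D q x - D p u0) \<le> 1 / (2 * K)"
        using \<epsilon>0(2)[OF q(1)] by (simp add: dist_norm less_imp_le)
      have "h - \<Gamma> (D q x h) = - \<Gamma> ((D q x - D p u0) h)"
        by (simp add: blinfun.diff_left linear_diff[OF \<Gamma>(1)] \<Gamma>D)
      then have "norm (h - \<Gamma> (D q x h)) \<le> norm ((D q x - D p u0) h) * K"
        using K(2) by simp
      also have "\<dots> \<le> (norm (D q x - D p u0) * norm h) * K"
        using K(1) by (intro mult_right_mono norm_blinfun) auto
      also have "\<dots> \<le> (1 / (2 * K) * norm h) * K"
        using K(1) by (intro mult_right_mono near) auto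
      also have "\<dots> = 1 / 2 * norm h" using K(1) by simp
      finally show "norm (h - \<Gamma> (D q x h)) \<le> 1 / 2 * norm h" .
    qed
  qed
  have near: "\<eta> q \<in> cball u0 \<epsilon>" if q: "q \<in> S" "dist q p < \<delta>" for q
  proof -
    have "norm (\<Psi> q u0) < \<epsilon> / (2 * K)"
      using \<delta>1(2)[OF q(1), of u0] q(2) root[OF p] by (simp add: \<delta>_def dist_Pair_Pair u0_def)
    then have small: "norm (\<Psi> q u0) * K \<le> \<epsilon> / 2" using K(1) by (simp add: field_simps)
    have into: "T q u \<in> cball u0 \<epsilon>" if u: "u \<in> cball u0 \<epsilon>" for u
    proof -
      have "norm (T q u - u0) \<le> norm (T q u - T q u0) + norm (T q u0 - u0)"
        using norm_triangle_ineq[of "T q u - T q u0" "T q u0 - u0"] by simp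
      also have "\<dots> \<le> 1 / 2 * norm (u - u0) + norm (\<Psi> q u0) * K"
        using contr[OF q u, of u0] \<epsilon> K(2)[of "\<Psi> q u0"] by (intro add_mono) (auto simp: T_def)
      also have "\<dots> \<le> \<epsilon> / 2 + \<epsilon> / 2"
        using u small by (intro add_mono) (auto simp: dist_norm norm_minus_commute)
      finally show ?thesis by (simp add: dist_norm norm_minus_commute)
    qed
    have "\<exists>!u. u \<in> cball u0 \<epsilon> \<and> T q u = u"
      by (rule Banach_fix[where c = "1 / 2"])
        (use \<epsilon> into contr[OF q] in \<open>auto simp: complete_eq_closed dist_norm image_subset_iff\<close>)
    then obtain u where u: "u \<in> cball u0 \<epsilon>" "T q u = u" by auto
    then have "\<Psi> q u = 0" using \<Gamma>0 by (simp add: T_def)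
    then show ?thesis using uniq[OF q(1)] u(1) by simp
  qed
  show ?thesis
  proof (intro exI conjI ballI)
    show "\<delta> > 0" using \<epsilon>0 \<delta>1 by (simp add: \<delta>_def)
    show "2 * K \<ge> 0" using K by simp
    fix q r assume q: "q \<in> S \<inter> ball p \<delta>" and r: "r \<in> S \<inter> ball p \<delta>"
    have \<eta>q: "T q (\<eta> q) = \<eta> q" using root[of q] q linear_0[OF \<Gamma>(1)] by (simp add: T_def)
    have "norm (\<eta> q - \<eta> r) \<le> norm (T q (\<eta> q) - T q (\<eta> r)) + norm (T q (\<eta> r) - \<eta> r)"
      using norm_triangle_ineq[of "T q (\<eta> q) - T q (\<eta> r)" "T q (\<eta> r) - \<eta> r"] by (simp add: \<eta>q)
    also have "\<dots> \<le> 1 / 2 * norm (\<eta> q - \<eta> r) + norm (\<Psi> q (\<eta> r)) * K"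
      using contr[of q "\<eta> q" "\<eta> r"] near[of q] near[of r] q r K(2)[of "\<Psi> q (\<eta> r)"]
      by (intro add_mono) (auto simp: dist_commute T_def)
    finally show "norm (\<eta> q - \<eta> r) \<le> 2 * K * norm (\<Psi> q (\<eta> r))" by (simp add: mult_ac)
  qed
qed

lemma root_continuous_on:
  "continuous_on S \<eta>"
  unfolding continuous_on_iff
proof (intro ballI allI impI)
  fix p and e :: real assume p: "p \<in> S" and e: "e > 0"
  obtain \<delta> K where \<delta>: "\<delta> > 0" and K: "K \<ge> 0" and
    le: "\<forall>q\<in>S \<inter> ball p \<delta>. \<forall>r\<in>S \<inter> ball p \<delta>. norm (\<eta> q - \<eta> r) \<le> K * norm (\<Psi> q (\<eta> r))"
    using root_distance_le_residual[OF p] by blast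
  obtain d where d: "d > 0" "\<And>q u. q \<in> S \<Longrightarrow> dist (q, u) (p, \<eta> p) < d \<Longrightarrow> dist (\<Psi> q u) (\<Psi> p (\<eta> p)) < e / (K + 1)"
    using cont[unfolded continuous_on_iff, rule_format, of "(p, \<eta> p)" "e / (K + 1)"] p e K by auto
  show "\<exists>d>0. \<forall>q\<in>S. dist q p < d \<longrightarrow> dist (\<eta> q) (\<eta> p) < e"
  proof (intro exI conjI ballI impI)
    show "min \<delta> d > 0" using \<delta> d by simp
    fix q assume q: "q \<in> S" "dist q p < min \<delta> d"
    have "dist (\<eta> q) (\<eta> p) \<le> K * norm (\<Psi> q (\<eta> p))"
      using le[rule_format, of q p] p q \<delta> by (simp add: dist_norm dist_commute)
    also have "\<dots> \<le> K * (e / (K + 1))"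
      using d(2)[OF q(1), of "\<eta> p"] q root[OF p] K
      by (intro mult_left_mono) (auto simp: dist_Pair_Pair intro: less_imp_le)
    also have "\<dots> < e" using K e by (simp add: field_simps)
    finally show "dist (\<eta> q) (\<eta> p) < e" .
  qed
qed

text \<open>
  The relation \<open>R\<close> selects the pairs of parameters for which a Lipschitz estimate is
  available: pairs at the same time when \<open>f\<close> is Lipschitz in space only, all pairs when
  it is Lipschitz in time as well.
\<close>

lemma root_locally_lipschitz:
  assumes p: "p \<in> S"
    and lip: "\<delta>0 > 0" "M \<ge> 0" "\<And>q r v. q \<in> S \<inter> ball p \<delta>0 \<Longrightarrow> r \<in> S \<inter> ball p \<delta>0 \<Longrightarrow> R q r \<Longrightarrow>
       v \<in> cball (\<eta> p) 1 \<Longrightarrow> norm (\<Psi> q v - \<Psi> r v) \<le> M * dist q r"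
  shows "\<exists>\<delta>>0. \<exists>L\<ge>0. \<forall>q\<in>S \<inter> ball p \<delta>. \<forall>r\<in>S \<inter> ball p \<delta>. R q r \<longrightarrow> norm (\<eta> q - \<eta> r) \<le> L * dist q r"
proof -
  obtain \<delta>1 K where \<delta>1: "\<delta>1 > 0" and K: "K \<ge> 0" and
    le: "\<forall>q\<in>S \<inter> ball p \<delta>1. \<forall>r\<in>S \<inter> ball p \<delta>1. norm (\<eta> q - \<eta> r) \<le> K * norm (\<Psi> q (\<eta> r))"
    using root_distance_le_residual[OF p] by blast
  obtain \<delta>2 where \<delta>2: "\<delta>2 > 0" "\<And>q. q \<in> S \<Longrightarrow> dist q p < \<delta>2 \<Longrightarrow> dist (\<eta> q) (\<eta> p) < 1"
    using root_continuous_on p unfolding continuous_on_iff by (meson zero_less_one)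
  show ?thesis
  proof (rule exI[of _ "min \<delta>0 (min \<delta>1 \<delta>2)"], intro exI[of _ "K * M"] conjI ballI impI)
    show "min \<delta>0 (min \<delta>1 \<delta>2) > 0" using lip(1) \<delta>1 \<delta>2 by simp
    show "K * M \<ge> 0" using K lip(2) by simp
    fix q r assume q: "q \<in> S \<inter> ball p (min \<delta>0 (min \<delta>1 \<delta>2))" and r: "r \<in> S \<inter> ball p (min \<delta>0 (min \<delta>1 \<delta>2))"
      and R: "R q r"
    have "norm (\<eta> q - \<eta> r) \<le> K * norm (\<Psi> q (\<eta> r) - \<Psi> r (\<eta> r))"
      using le[rule_format, of q r] q r root[of r] by simp
    also have "\<dots> \<le> K * (M * dist q r)"
      using q r R \<delta>2(2)[of r] K by (intro mult_left_mono lip(3)) (auto simp: dist_commute intro: less_imp_le)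
    finally show "norm (\<eta> q - \<eta> r) \<le> K * M * dist q r" by (simp add: mult_ac)
  qed
qed

end

section \<open>Euler steps with a contracting correction\<close>

text \<open>
  \<open>F\<close> is the slope of the differential component, \<open>N\<close> the corrector for
  the algebraic component, which is only required to halve the distance to the root
  \<open>\<eta>\<close>. The estimates are needed on a ball whose radius exceeds the bound
  \<open>M\<close> for the exact solution by \<open>1\<close>, because for small steps the discrete
  trajectory stays within distance \<open>1\<close> of the exact one. The induction carries the
  error of the differential component, bounded by \<open>c h (i h) exp(\<Lambda> i h)\<close>,
  together with the distance of \<open>u_i\<close> from \<open>\<eta>(t_i, z_i)\<close>, bounded by
  \<open>c1 h\<close>, where \<open>c1 h\<close> is also a bound for the displacement of the root in
  one step.
\<close>

lemma euler_newton_converges: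
  fixes z :: "real \<Rightarrow> 'a::real_normed_vector" and \<eta> :: "real \<times> 'a \<Rightarrow> 'a"
    and F N :: "real \<Rightarrow> 'a \<Rightarrow> 'a \<Rightarrow> 'a"
  assumes tT: "t0 < T"
    and z: "\<And>t. t \<in> {t0..T} \<Longrightarrow> z t \<in> X \<inter> cball 0 M"
    and eta: "\<And>t z. t \<in> {t0..T} \<Longrightarrow> z \<in> X \<inter> cball 0 (M + 1) \<Longrightarrow> \<eta> (t, z) \<in> Y \<inter> cball 0 M'"
    and eta_lip: "L1-lipschitz_on ({t0..T} \<times> (X \<inter> cball 0 (M + 1))) \<eta>"
    and F_lip: "L2 \<ge> 0" "\<And>t z z' u u'. t \<in> {t0..T} \<Longrightarrow> z \<in> X \<inter> cball 0 (M + 1) \<Longrightarrow> z' \<in> X \<inter> cball 0 (M + 1) \<Longrightarrow>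
        u \<in> Y \<inter> cball 0 (M' + 1) \<Longrightarrow> u' \<in> Y \<inter> cball 0 (M' + 1) \<Longrightarrow>
        norm (F t z u - F t z' u') \<le> L2 * (norm (z - z') + norm (u - u'))"
    and F_bound: "K \<ge> 0" "\<And>t z u. t \<in> {t0..T} \<Longrightarrow> z \<in> X \<inter> cball 0 (M + 1) \<Longrightarrow>
        u \<in> Y \<inter> cball 0 (M' + 1) \<Longrightarrow> norm (F t z u) \<le> K"
    and consistent: "K' \<ge> 0" "\<And>t h. h \<ge> 0 \<Longrightarrow> t \<in> {t0..T} \<Longrightarrow> t + h \<in> {t0..T} \<Longrightarrow>
        norm (z (t + h) - z t - h *\<^sub>R F t (z t) (\<eta> (t, z t))) \<le> K' * h\<^sup>2"
    and halves: "\<delta> > 0" "\<And>t z u. t \<in> {t0..T} \<Longrightarrow> z \<in> X \<inter> cball 0 (M + 1) \<Longrightarrow> u \<in> Y \<Longrightarrow>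
        norm (u - \<eta> (t, z)) \<le> \<delta> \<Longrightarrow> norm (N t z u - \<eta> (t, z)) \<le> 1 / 2 * norm (u - \<eta> (t, z))"
    and F_in: "\<And>t h z u. z \<in> X \<Longrightarrow> u \<in> Y \<Longrightarrow> z + h *\<^sub>R F t z u \<in> X"
    and N_in: "\<And>t z u. t \<in> {t0..T} \<Longrightarrow> z \<in> X \<Longrightarrow> u \<in> Y \<Longrightarrow> N t z u \<in> Y"
  obtains C h0 where "C \<ge> 0" "h0 > 0"
    "\<And>h zs us n i. 0 < h \<Longrightarrow> h \<le> h0 \<Longrightarrow> t0 + real n * h \<le> T \<Longrightarrow> zs 0 = z t0 \<Longrightarrow> us 0 = \<eta> (t0, z t0) \<Longrightarrow>
       (\<And>i. i < n \<Longrightarrow> zs (Suc i) = zs i + h *\<^sub>R F (t0 + real i * h) (zs i) (us i)) \<Longrightarrow>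
       (\<And>i. i < n \<Longrightarrow> us (Suc i) = N (t0 + real (Suc i) * h) (zs (Suc i)) (us i)) \<Longrightarrow> i \<le> n \<Longrightarrow>
       norm (zs i - z (t0 + real i * h)) \<le> C * h \<and>
       norm (us i - \<eta> (t0 + real i * h, z (t0 + real i * h))) \<le> C * h"
proof -
  have L1: "L1 \<ge> 0" using eta_lip by (simp add: lipschitz_on_def)
  have M0: "z t0 \<in> X" using z[of t0] tT by auto
  define c1 where "c1 = L1 * (1 + K)"
  define \<Lambda> where "\<Lambda> = L2 * (1 + L1)"
  define c where "c = L2 * c1 + K'"
  define Cz where "Cz = c * (T - t0) * exp (\<Lambda> * (T - t0))"
  have nn: "c1 \<ge> 0" "\<Lambda> \<ge> 0" "c \<ge> 0" "Cz \<ge> 0"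
    using L1 F_lip(1) F_bound(1) consistent(1) tT by (auto simp: c1_def \<Lambda>_def c_def Cz_def)
  (* The three bounds keep the predictor within the range \<delta> of the corrector, the algebraic component
     within distance 1 of the root, and the differential component within distance 1 of the solution. *)
  define h0 where "h0 = Min {\<delta> / (2 * c1 + 1), 1 / (c1 + 1), 1 / (Cz + 1)}"
  have h0: "h0 > 0" using nn halves(1) by (auto simp: h0_def)
  show thesis
  proof (rule that)
    show "Cz + c1 + L1 * Cz \<ge> 0" using nn L1 by simp
    show "h0 > 0" by (rule h0)
    fix h and zs us :: "nat \<Rightarrow> 'a" and n i
    assume h: "0 < h" "h \<le> h0" and nT: "t0 + real n * h \<le> T"
      and init: "zs 0 = z t0" "us 0 = \<eta> (t0, z t0)"
      and zs: "\<And>i. i < n \<Longrightarrow> zs (Suc i) = zs i + h *\<^sub>R F (t0 + real i * h) (zs i) (us i)"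
      and us: "\<And>i. i < n \<Longrightarrow> us (Suc i) = N (t0 + real (Suc i) * h) (zs (Suc i)) (us i)"
      and i: "i \<le> n"
    define t where "t i = t0 + real i * h" for i
    have tin: "t i \<in> {t0..T}" if "i \<le> n" for i
    proof -
      have "real i * h \<le> real n * h" using that h by (intro mult_right_mono) auto
      moreover have "0 \<le> real i * h" using h by simp
      ultimately show ?thesis using nT unfolding t_def atLeastAtMost_iff by linarith
    qed
    have tSuc: "t (Suc i) = t i + h" for i by (simp add: t_def algebra_simps)
    have "h \<le> \<delta> / (2 * c1 + 1)" "h \<le> 1 / (c1 + 1)" "h \<le> 1 / (Cz + 1)"
      using h(2) by (auto simp: h0_def)
    then have hs: "h * (2 * c1 + 1) \<le> \<delta>" "h * (c1 + 1) \<le> 1" "h * (Cz + 1) \<le> 1"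
      using nn by (simp_all add: pos_le_divide_eq)
    then have small: "2 * c1 * h \<le> \<delta>" "c1 * h \<le> 1" "Cz * h \<le> 1"
      using h by (auto simp: algebra_simps)
    (* The error recursion is e (i+1) \<le> (1 + h \<Lambda>) e i + c h^2, and E satisfies the reverse inequality. *)
    define E where "E i = c * h * (real i * h) * exp (\<Lambda> * (real i * h))" for i
    have E_le: "E i \<le> Cz * h" if "i \<le> n" for i
    proof -
      have "real i * h \<le> T - t0" using tin[OF that] by (simp add: t_def)
      then have "(c * h) * (real i * h) * exp (\<Lambda> * (real i * h)) \<le> (c * h) * (T - t0) * exp (\<Lambda> * (T - t0))"
        using nn h tT by (intro mult_mono) (auto intro!: mult_left_mono)
      then show ?thesis by (simp add: E_def Cz_def mult_ac)
    qed
    have zball: "x \<in> cball 0 (M + 1)" if "j \<le> n" "norm (x - z (t j)) \<le> E j" for x j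
    proof -
      have "norm x \<le> norm (x - z (t j)) + norm (z (t j))"
        using norm_triangle_ineq[of "x - z (t j)" "z (t j)"] by simp
      then show ?thesis using that E_le[OF that(1)] small(3) z[OF tin[OF that(1)]] by simp
    qed
    have zt: "z (t j) \<in> X \<inter> cball 0 (M + 1)" if "j \<le> n" for j
      using z[OF tin[OF that]] by auto
    have inv: "zs i \<in> X \<and> us i \<in> Y \<and> norm (zs i - z (t i)) \<le> E i \<and> norm (us i - \<eta> (t i, zs i)) \<le> c1 * h"
      if "i \<le> n" for i
      using that
    proof (induction i)
      case 0
      have "\<eta> (t0, z t0) \<in> Y" using eta[of t0 "z t0"] z[of t0] tT by auto
      then show ?case using M0 nn h by (simp add: init t_def E_def)
    next
      case (Suc i)
      then have i: "i < n" and i': "i \<le> n" by auto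
      have IH: "zs i \<in> X" "us i \<in> Y" "norm (zs i - z (t i)) \<le> E i" "norm (us i - \<eta> (t i, zs i)) \<le> c1 * h"
        using Suc.IH[OF i'] by auto
      have zi: "zs i \<in> X \<inter> cball 0 (M + 1)" using zball[OF i' IH(3)] IH(1) by auto
      have eta_i: "\<eta> (t i, zs i) \<in> Y \<inter> cball 0 M'" by (rule eta[OF tin[OF i'] zi])
      have eta_t: "\<eta> (t i, z (t i)) \<in> Y \<inter> cball 0 M'" by (rule eta[OF tin[OF i'] zt[OF i']])
      have "norm (us i) \<le> norm (us i - \<eta> (t i, zs i)) + norm (\<eta> (t i, zs i))"
        using norm_triangle_ineq[of "us i - \<eta> (t i, zs i)" "\<eta> (t i, zs i)"] by simp
      then have ui: "us i \<in> Y \<inter> cball 0 (M' + 1)"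
        using IH(2,4) small(2) eta_i by auto
      have step: "zs (Suc i) = zs i + h *\<^sub>R F (t i) (zs i) (us i)" using zs[OF i] by (simp add: t_def)
      have zX: "zs (Suc i) \<in> X" unfolding step by (rule F_in) (use zi ui in auto)
      have du: "norm (us i - \<eta> (t i, z (t i))) \<le> c1 * h + L1 * E i"
      proof -
        have "norm (us i - \<eta> (t i, z (t i))) \<le> norm (us i - \<eta> (t i, zs i)) + norm (\<eta> (t i, zs i) - \<eta> (t i, z (t i)))"
          using norm_triangle_ineq[of "us i - \<eta> (t i, zs i)" "\<eta> (t i, zs i) - \<eta> (t i, z (t i))"] by simp
        also have "norm (\<eta> (t i, zs i) - \<eta> (t i, z (t i))) \<le> L1 * dist (t i, zs i) (t i, z (t i))"
          unfolding dist_norm[of "\<eta> _", symmetric]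
          by (rule lipschitz_onD[OF eta_lip]) (use zi zt[OF i'] tin[OF i'] in auto)
        also have "\<dots> \<le> L1 * E i" using L1 IH(3) by (intro mult_left_mono) (auto simp: dist_Pair_Pair dist_norm)
        finally show ?thesis using IH(4) by simp
      qed
      have zE: "norm (zs (Suc i) - z (t (Suc i))) \<le> E (Suc i)"
      proof -
        have split: "zs (Suc i) - z (t (Suc i)) = (zs i - z (t i))
            + h *\<^sub>R (F (t i) (zs i) (us i) - F (t i) (z (t i)) (\<eta> (t i, z (t i))))
            - (z (t i + h) - z (t i) - h *\<^sub>R F (t i) (z (t i)) (\<eta> (t i, z (t i))))"
          by (simp add: step tSuc algebra_simps)
        have "norm (zs (Suc i) - z (t (Suc i))) \<le> norm (zs i - z (t i))
            + norm (h *\<^sub>R (F (t i) (zs i) (us i) - F (t i) (z (t i)) (\<eta> (t i, z (t i)))))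
            + norm (z (t i + h) - z (t i) - h *\<^sub>R F (t i) (z (t i)) (\<eta> (t i, z (t i))))"
          unfolding split
          by (rule order_trans[OF norm_triangle_ineq4 add_right_mono[OF norm_triangle_ineq]])
        also have "\<dots> \<le> E i + h * (L2 * (E i + (c1 * h + L1 * E i))) + K' * h\<^sup>2"
        proof (intro add_mono IH(3))
          have "norm (F (t i) (zs i) (us i) - F (t i) (z (t i)) (\<eta> (t i, z (t i))))
              \<le> L2 * (norm (zs i - z (t i)) + norm (us i - \<eta> (t i, z (t i))))"
            by (rule F_lip(2)[OF tin[OF i'] zi zt[OF i'] ui]) (use eta_t in auto)
          also have "\<dots> \<le> L2 * (E i + (c1 * h + L1 * E i))"
            by (intro mult_left_mono add_mono IH(3) du F_lip(1))
          finally show "norm (h *\<^sub>R (F (t i) (zs i) (us i) - F (t i) (z (t i)) (\<eta> (t i, z (t i)))))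
              \<le> h * (L2 * (E i + (c1 * h + L1 * E i)))"
            using h by simp
          show "norm (z (t i + h) - z (t i) - h *\<^sub>R F (t i) (z (t i)) (\<eta> (t i, z (t i)))) \<le> K' * h\<^sup>2"
            by (rule consistent(2)) (use h tin[OF i'] tin[OF Suc.prems] tSuc[of i] in auto)
        qed
        also have "\<dots> = (1 + h * \<Lambda>) * E i + c * h\<^sup>2"
          by (simp add: \<Lambda>_def c_def power2_eq_square algebra_simps)
        also have "\<dots> \<le> exp (\<Lambda> * h) * E i + c * h\<^sup>2 * exp (\<Lambda> * (real (Suc i) * h))"
        proof (rule add_mono)
          have "E i \<ge> 0" using nn h by (simp add: E_def)
          then show "(1 + h * \<Lambda>) * E i \<le> exp (\<Lambda> * h) * E i"
            using exp_ge_add_one_self[of "\<Lambda> * h"] by (intro mult_right_mono) (auto simp: mult_ac)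
          have "1 \<le> exp (\<Lambda> * (real (Suc i) * h))" using nn h by simp
          then show "c * h\<^sup>2 \<le> c * h\<^sup>2 * exp (\<Lambda> * (real (Suc i) * h))"
            using mult_left_mono[of 1 _ "c * h\<^sup>2"] nn by simp
        qed
        also have "exp (\<Lambda> * h) * E i = c * h * (real i * h) * exp (\<Lambda> * (real (Suc i) * h))"
          by (simp add: E_def algebra_simps exp_add)
        also have "\<dots> + c * h\<^sup>2 * exp (\<Lambda> * (real (Suc i) * h)) = E (Suc i)"
          by (simp add: E_def power2_eq_square algebra_simps)
        finally show ?thesis .
      qed
      have zi': "zs (Suc i) \<in> X \<inter> cball 0 (M + 1)" using zball[OF Suc.prems zE] zX by auto
      have pred: "norm (us i - \<eta> (t (Suc i), zs (Suc i))) \<le> 2 * c1 * h"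
      proof -
        have "norm (us i - \<eta> (t (Suc i), zs (Suc i))) \<le> norm (us i - \<eta> (t i, zs i)) + norm (\<eta> (t i, zs i) - \<eta> (t (Suc i), zs (Suc i)))"
          using norm_triangle_ineq[of "us i - \<eta> (t i, zs i)" "\<eta> (t i, zs i) - \<eta> (t (Suc i), zs (Suc i))"] by simp
        also have "norm (\<eta> (t i, zs i) - \<eta> (t (Suc i), zs (Suc i))) \<le> L1 * dist (t i, zs i) (t (Suc i), zs (Suc i))"
          unfolding dist_norm[of "\<eta> _", symmetric]
          by (rule lipschitz_onD[OF eta_lip]) (use zi zi' tin[OF i'] tin[OF Suc.prems] in auto)
        also have "L1 * dist (t i, zs i) (t (Suc i), zs (Suc i)) \<le> L1 * (h + h * K)"
        proof (rule mult_left_mono[OF _ L1])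
          have "dist (t i, zs i) (t (Suc i), zs (Suc i)) \<le> dist (t i) (t (Suc i)) + dist (zs i) (zs (Suc i))"
            by (simp add: dist_Pair_Pair sqrt_sum_squares_le_sum)
          also have "dist (t i) (t (Suc i)) = h" using h by (simp add: tSuc dist_norm)
          also have "dist (zs i) (zs (Suc i)) \<le> h * K"
            using F_bound(2)[OF tin[OF i'] zi ui] h by (simp add: step dist_norm)
          finally show "dist (t i, zs i) (t (Suc i), zs (Suc i)) \<le> h + h * K" by simp
        qed
        finally show ?thesis using IH(4) by (simp add: c1_def algebra_simps)
      qed
      have step_u: "us (Suc i) = N (t (Suc i)) (zs (Suc i)) (us i)" using us[OF i] by (simp add: t_def)
      have "norm (us (Suc i) - \<eta> (t (Suc i), zs (Suc i))) \<le> 1 / 2 * norm (us i - \<eta> (t (Suc i), zs (Suc i)))"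
        unfolding step_u by (rule halves(2)[OF tin[OF Suc.prems] zi' IH(2)]) (use pred small(1) in linarith)
      then have "norm (us (Suc i) - \<eta> (t (Suc i), zs (Suc i))) \<le> c1 * h" using pred by simp
      moreover have "us (Suc i) \<in> Y" unfolding step_u by (rule N_in[OF tin[OF Suc.prems] zX IH(2)])
      ultimately show ?case using zX zE by simp
    qed
    have I: "zs i \<in> X" "norm (zs i - z (t i)) \<le> E i" "norm (us i - \<eta> (t i, zs i)) \<le> c1 * h"
      using inv[OF i] by auto
    have zi: "zs i \<in> X \<inter> cball 0 (M + 1)" using zball[OF i I(2)] I(1) by auto
    have "norm (us i - \<eta> (t i, z (t i))) \<le> norm (us i - \<eta> (t i, zs i)) + norm (\<eta> (t i, zs i) - \<eta> (t i, z (t i)))"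
      using norm_triangle_ineq[of "us i - \<eta> (t i, zs i)" "\<eta> (t i, zs i) - \<eta> (t i, z (t i))"] by simp
    also have "norm (\<eta> (t i, zs i) - \<eta> (t i, z (t i))) \<le> L1 * dist (t i, zs i) (t i, z (t i))"
      unfolding dist_norm[of "\<eta> _", symmetric]
      by (rule lipschitz_onD[OF eta_lip]) (use zi zt[OF i] tin[OF i] in auto)
    also have "\<dots> \<le> L1 * (Cz * h)"
      using L1 I(2) E_le[OF i] by (intro mult_left_mono) (auto simp: dist_Pair_Pair dist_norm)
    finally have "norm (us i - \<eta> (t i, z (t i))) \<le> c1 * h + L1 * (Cz * h)" using I(3) by simp
    moreover have "norm (zs i - z (t i)) \<le> Cz * h" using I(2) E_le[OF i] by simp
    ultimately show "norm (zs i - z (t0 + real i * h)) \<le> (Cz + c1 + L1 * Cz) * h \<and>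
       norm (us i - \<eta> (t0 + real i * h, z (t0 + real i * h))) \<le> (Cz + c1 + L1 * Cz) * h"
      using nn L1 h unfolding t_def by (auto simp: algebra_simps intro: order_trans add_increasing add_increasing2)
  qed
qed

section \<open>The reduced system of an index-one equation\<close>

definition matrix_blinfun :: "real^'n^'m \<Rightarrow> (real^'n) \<Rightarrow>\<^sub>L (real^'m)" where
  "matrix_blinfun M = Blinfun ((*v) M)"

lemma matrix_blinfun_apply [simp]: "blinfun_apply (matrix_blinfun M) = (*v) M"
  unfolding matrix_blinfun_def by (rule bounded_linear_Blinfun_apply) simp

lemma bounded_linear_matrix_blinfun: "bounded_linear (matrix_blinfun :: real^'n^'m \<Rightarrow> _)"
proof -
  have "linear (matrix_blinfun :: real^'n^'m \<Rightarrow> _)"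
    by (rule linearI) (auto intro!: blinfun_eqI
        simp: blinfun.add_left blinfun.scaleR_left matrix_vector_mult_add_rdistrib scaleR_matrix_vector_assoc)
  then show ?thesis by (simp add: linear_conv_bounded_linear)
qed

lemmas continuous_on_matrix_blinfun [continuous_intros] =
  bounded_linear.continuous_on[OF bounded_linear_matrix_blinfun]

lemma matrix_vector_norm_bound:
  fixes M :: "real^'n^'m"
  shows "\<exists>K>0. \<forall>x. norm (M *v x) \<le> K * norm x"
  using bounded_linear.pos_bounded[OF matrix_vector_mul_bounded_linear[of M]] by (simp add: mult.commute)

lemma x_derivative_has_derivative:
  assumes "continuous_with_x_derivative f" "t \<ge> 0"
  shows "(f t has_derivative matrix_blinfun (jacobian (f t) (at x))) (at x)"
  using assms jacobian_works by (auto simp: continuous_with_x_derivative_def)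

lemma x_derivative_continuous_on:
  fixes f :: "real \<Rightarrow> real^'n \<Rightarrow> real^'m" and t :: "'p::topological_space \<Rightarrow> real"
  assumes f: "continuous_with_x_derivative f"
    and "continuous_on S t" "continuous_on S x" "\<And>p. p \<in> S \<Longrightarrow> t p \<ge> 0"
  shows "continuous_on S (\<lambda>p. f (t p) (x p))"
    and "continuous_on S (\<lambda>p. jacobian (f (t p)) (at (x p)))"
proof -
  have c: "continuous_on S (\<lambda>p. (t p, x p))" by (intro continuous_intros assms)
  have s: "(\<lambda>p. (t p, x p)) ` S \<subseteq> {0..} \<times> UNIV" using assms by auto
  have "continuous_on ({0..} \<times> UNIV) (\<lambda>(t, x). f t x)"
    "continuous_on ({0..} \<times> UNIV) (\<lambda>(t, x). jacobian (f t) (at x))"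
    using f by (auto simp: continuous_with_x_derivative_def)
  from this[THEN continuous_on_compose2, OF c s]
  show "continuous_on S (\<lambda>p. f (t p) (x p))" "continuous_on S (\<lambda>p. jacobian (f (t p)) (at (x p)))"
    by simp_all
qed

lemma x_derivative_lipschitz:
  assumes f: "continuous_with_x_derivative f"
  shows "\<exists>L\<ge>0. \<forall>t\<in>{0..b}. L-lipschitz_on (cball 0 \<rho>) (f t)"
proof -
  define D where "D p = matrix_blinfun (jacobian (f (fst p)) (at (snd p)))" for p
  have "continuous_on ({0..b} \<times> cball 0 \<rho>) D"
    unfolding D_def
    by (intro continuous_intros x_derivative_continuous_on(2)[OF f]) auto
  then have "bounded (D ` ({0..b} \<times> cball 0 \<rho>))"
    by (intro compact_imp_bounded compact_continuous_image compact_Times) auto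
  then obtain L where L: "\<And>p. p \<in> {0..b} \<times> cball 0 \<rho> \<Longrightarrow> norm (D p) \<le> L"
    unfolding bounded_iff by blast
  show ?thesis
  proof (intro exI conjI ballI)
    show "max L 0 \<ge> 0" by simp
    fix t assume t: "t \<in> {0..b}"
    show "(max L 0)-lipschitz_on (cball 0 \<rho>) (f t)"
    proof (rule lipschitz_onI)
      fix x y :: "real^'a" assume xy: "x \<in> cball 0 \<rho>" "y \<in> cball 0 \<rho>"
      show "dist (f t x) (f t y) \<le> max L 0 * dist x y"
        unfolding dist_norm
      proof (rule differentiable_bound[OF convex_cball _ _ xy])
        fix x :: "real^'a" assume x: "x \<in> cball 0 \<rho>"
        show "(f t has_derivative D (t, x)) (at x within cball 0 \<rho>)"
          unfolding D_def using x_derivative_has_derivative[OF f] t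
          by (auto intro: has_derivative_at_withinI)
        show "onorm (D (t, x)) \<le> max L 0"
          using L[of "(t, x)"] t x by (simp add: norm_blinfun.rep_eq[symmetric])
      qed
    qed simp
  qed
qed

lemma C1_on_lipschitz:
  assumes C1: "C1_on S g" and K: "compact K" "convex K" "K \<subseteq> S"
  shows "\<exists>L. L-lipschitz_on K g"
proof -
  obtain g' where g': "\<And>p. p \<in> S \<Longrightarrow> (g has_derivative blinfun_apply (g' p)) (at p within S)"
    "continuous_on S g'"
    using C1 unfolding C1_on_def by blast
  have "bounded (g' ` K)"
    using K g' by (intro compact_imp_bounded compact_continuous_image) (auto intro: continuous_on_subset)
  then obtain L where L: "\<And>p. p \<in> K \<Longrightarrow> norm (g' p) \<le> L"
    unfolding bounded_iff by blast
  have "(max L 0)-lipschitz_on K g"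
  proof (rule lipschitz_onI)
    fix x y assume xy: "x \<in> K" "y \<in> K"
    show "dist (g x) (g y) \<le> max L 0 * dist x y"
      unfolding dist_norm
    proof (rule differentiable_bound[OF K(2) _ _ xy])
      fix x assume x: "x \<in> K"
      show "(g has_derivative g' x) (at x within K)"
        using has_derivative_subset[OF g'(1)] x K by blast
      show "onorm (g' x) \<le> max L 0" using L[OF x] by (simp add: norm_blinfun.rep_eq[symmetric])
    qed
  qed simp
  then show ?thesis by blast
qed

text \<open>
  The data that remain after multiplication by the inverse of \<open>G\<close>: \<open>N1\<close>,
  \<open>N2\<close> and \<open>M\<close> stand for its products with \<open>Q1\<close>,
  \<open>Q2\<close> and \<open>B\<close>. The system is \<open>z' = N1 f(t, z + u) - M z\<close>,
  \<open>u = N2 f(t, z + u)\<close> with \<open>z\<close> in the range of \<open>P1\<close> and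
  \<open>u\<close> in the range of \<open>P2\<close>.
\<close>

locale index1_dae =
  fixes P1 P2 N1 N2 M :: "real^'n^'n" and f :: "real \<Rightarrow> real^'n \<Rightarrow> real^'n"
  assumes P_sum: "P1 + P2 = mat 1" and P12: "P1 ** P2 = 0" and P21: "P2 ** P1 = 0"
    and N1: "P1 ** N1 = N1" and N2: "P2 ** N2 = N2" and M: "P1 ** M ** P1 = M ** P1"
    and f: "continuous_with_x_derivative f"
    and root_exists: "t \<ge> 0 \<Longrightarrow> z \<in> range ((*v) P1) \<Longrightarrow> \<exists>u\<in>range ((*v) P2). u = N2 *v f t (z + u)"
    and root_unique: "t \<ge> 0 \<Longrightarrow> z \<in> range ((*v) P1) \<Longrightarrow> u \<in> range ((*v) P2) \<Longrightarrow> u = N2 *v f t (z + u) \<Longrightarrow>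
       u' \<in> range ((*v) P2) \<Longrightarrow> u' = N2 *v f t (z + u') \<Longrightarrow> u = u'"
    and root_nondegenerate: "t \<ge> 0 \<Longrightarrow> z \<in> range ((*v) P1) \<Longrightarrow> u \<in> range ((*v) P2) \<Longrightarrow>
       u = N2 *v f t (z + u) \<Longrightarrow> v \<in> range ((*v) P2) \<Longrightarrow>
       v = N2 *v (jacobian (f t) (at (z + u)) *v v) \<Longrightarrow> v = 0"
begin

lemma P_apply_sum: "P1 *v x + P2 *v x = x"
  by (metis P_sum matrix_vector_mult_add_rdistrib matrix_vector_mul_lid)

lemma P_apply [simp]:
  "P1 *v (P2 *v x) = 0" "P2 *v (P1 *v x) = 0" "P1 *v (P1 *v x) = P1 *v x" "P2 *v (P2 *v x) = P2 *v x"
proof -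
  show 1: "P1 *v (P2 *v x) = 0" "P2 *v (P1 *v x) = 0" by (simp_all add: matrix_vector_mul_assoc P12 P21)
  show "P1 *v (P1 *v x) = P1 *v x" "P2 *v (P2 *v x) = P2 *v x"
    using P_apply_sum[of "P1 *v x"] P_apply_sum[of "P2 *v x"] 1 by simp_all
qed

lemma in_range_P: "x \<in> range ((*v) P1) \<longleftrightarrow> P1 *v x = x" "x \<in> range ((*v) P2) \<longleftrightarrow> P2 *v x = x"
  using rangeI[of "(*v) P1" x] rangeI[of "(*v) P2" x] by fastforce+

lemma P_complement: "P1 *v x = x \<longleftrightarrow> P2 *v x = 0" "P2 *v x = x \<longleftrightarrow> P1 *v x = 0"
proof -
  show "P1 *v x = x \<longleftrightarrow> P2 *v x = 0"
    using P_apply_sum[of x] P_apply(2)[of x] by (metis add.right_neutral)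
  show "P2 *v x = x \<longleftrightarrow> P1 *v x = 0"
    using P_apply_sum[of x] P_apply(1)[of x] by (metis add.left_neutral)
qed

lemma N_apply [simp]: "P1 *v (N1 *v x) = N1 *v x" "P2 *v (N2 *v x) = N2 *v x"
  by (simp_all add: matrix_vector_mul_assoc N1 N2)

lemma M_apply [simp]: "P1 *v (M *v (P1 *v x)) = M *v (P1 *v x)"
  using M by (simp add: matrix_vector_mul_assoc matrix_mul_assoc)

text \<open>
  The solution \<open>u\<close> of the algebraic equation. It is extended to all \<open>z\<close>
  through \<open>P1\<close>, so that it becomes a function on a full Euclidean space instead of a
  subspace.
\<close>

definition eta :: "real \<Rightarrow> real^'n \<Rightarrow> real^'n" where
  "eta t z = (SOME u. u \<in> range ((*v) P2) \<and> u = N2 *v f t (P1 *v z + u))"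

lemma eta:
  assumes "t \<ge> 0"
  shows "P2 *v eta t z = eta t z" "P1 *v eta t z = 0" "N2 *v f t (P1 *v z + eta t z) = eta t z"
proof -
  have "\<exists>u. u \<in> range ((*v) P2) \<and> u = N2 *v f t (P1 *v z + u)"
    using root_exists[OF assms, of "P1 *v z"] by blast
  from someI_ex[OF this, folded eta_def]
  show "P2 *v eta t z = eta t z" "P1 *v eta t z = 0" "N2 *v f t (P1 *v z + eta t z) = eta t z"
    using P_complement by (auto simp: in_range_P)
qed

lemma eta_unique:
  assumes "t \<ge> 0" "u = N2 *v f t (P1 *v z + P2 *v u)"
  shows "u = eta t z"
proof (rule root_unique[OF assms(1)])
  have u: "P2 *v u = u" using assms(2) N_apply(2) by metis
  show "P1 *v z \<in> range ((*v) P1)" by simp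
  show "u \<in> range ((*v) P2)" using u by (simp add: in_range_P)
  show "u = N2 *v f t (P1 *v z + u)" using assms(2) by (simp only: u)
  show "eta t z \<in> range ((*v) P2)" using eta[OF assms(1)] by (simp add: in_range_P)
  show "eta t z = N2 *v f t (P1 *v z + eta t z)" using eta[OF assms(1)] by simp
qed

text \<open>
  Inserting the projections makes the algebraic equation an equation on the whole space: as
  \<open>N2\<close> maps into the range of \<open>P2\<close>, every root lies there automatically,
  and its derivative is an endomorphism.
\<close>

definition residual :: "real \<times> (real^'n) \<Rightarrow> real^'n \<Rightarrow> real^'n" where
  "residual p u = u - N2 *v f (fst p) (P1 *v snd p + P2 *v u)"

definition residual_deriv :: "real \<times> (real^'n) \<Rightarrow> real^'n \<Rightarrow> ((real^'n) \<Rightarrow>\<^sub>L (real^'n))" where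
  "residual_deriv p u = id_blinfun - (matrix_blinfun N2 o\<^sub>L
     matrix_blinfun (jacobian (f (fst p)) (at (P1 *v snd p + P2 *v u))) o\<^sub>L matrix_blinfun P2)"

lemma continuous_on_matrix_vector [continuous_intros]:
  fixes g :: "'p::topological_space \<Rightarrow> real^'k" and N :: "real^'k^'m"
  shows "continuous_on S g \<Longrightarrow> continuous_on S (\<lambda>p. N *v g p)"
  by (rule bounded_linear.continuous_on[OF matrix_vector_mul_bounded_linear])

lemma residual_continuous: "S \<subseteq> {0..} \<times> UNIV \<Longrightarrow> continuous_on (S \<times> UNIV) (\<lambda>(p, u). residual p u)"
  unfolding residual_def split_beta
  by (intro continuous_intros x_derivative_continuous_on(1)[OF f]) auto

lemma residual_deriv_continuous: "S \<subseteq> {0..} \<times> UNIV \<Longrightarrow> continuous_on (S \<times> UNIV) (\<lambda>(p, u). residual_deriv p u)"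
  unfolding residual_deriv_def split_beta
  by (intro continuous_intros x_derivative_continuous_on(2)[OF f]) auto

lemma residual_has_derivative:
  assumes "fst p \<ge> 0"
  shows "(residual p has_derivative residual_deriv p u) (at u)"
proof -
  let ?J = "jacobian (f (fst p)) (at (P1 *v snd p + P2 *v u))"
  have "((\<lambda>u. P1 *v snd p + P2 *v u) has_derivative (\<lambda>h. 0 + P2 *v h)) (at u)"
    by (intro has_derivative_add has_derivative_const bounded_linear.has_derivative[OF matrix_vector_mul_bounded_linear]
        has_derivative_ident)
  from has_derivative_compose[OF this x_derivative_has_derivative[OF f assms]]
  have "((\<lambda>u. f (fst p) (P1 *v snd p + P2 *v u)) has_derivative (\<lambda>h. ?J *v (P2 *v h))) (at u)"
    by simp
  from bounded_linear.has_derivative[OF matrix_vector_mul_bounded_linear[of N2] this]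
  have "(residual p has_derivative (\<lambda>h. h - N2 *v (?J *v (P2 *v h)))) (at u)"
    unfolding residual_def[abs_def] by (intro has_derivative_diff has_derivative_ident)
  moreover have "blinfun_apply (residual_deriv p u) = (\<lambda>h. h - N2 *v (?J *v (P2 *v h)))"
    by (simp add: fun_eq_iff residual_deriv_def blinfun.diff_left)
  ultimately show ?thesis by simp
qed

lemma residual_root: "fst p \<ge> 0 \<Longrightarrow> residual p (eta (fst p) (snd p)) = 0"
  by (simp add: residual_def eta)

lemma residual_root_unique: "fst p \<ge> 0 \<Longrightarrow> residual p u = 0 \<Longrightarrow> u = eta (fst p) (snd p)"
  by (rule eta_unique) (simp_all add: residual_def)

lemma residual_deriv_root_injective:
  assumes "fst p \<ge> 0" "residual_deriv p (eta (fst p) (snd p)) v = 0"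
  shows "v = 0"
proof -
  let ?t = "fst p" and ?z = "P1 *v snd p" and ?u = "eta (fst p) (snd p)"
  have v: "v = N2 *v (jacobian (f ?t) (at (?z + ?u)) *v (P2 *v v))"
    using assms(2) by (simp add: residual_deriv_def blinfun.diff_left eta[OF assms(1)])
  then have P2v: "P2 *v v = v" using N_apply(2) by metis
  show ?thesis
    by (rule root_nondegenerate[of ?t ?z ?u]) (use v P2v eta[OF assms(1)] assms(1) in_range_P in \<open>simp_all\<close>)
qed

lemma residual_parametrized_root:
  assumes "I \<subseteq> {0..}"
  shows "parametrized_root (I \<times> UNIV) residual residual_deriv (\<lambda>p. eta (fst p) (snd p))"
proof
  have S: "I \<times> UNIV \<subseteq> {0..} \<times> (UNIV :: (real^'n) set)" using assms by auto
  show "continuous_on ((I \<times> UNIV) \<times> UNIV) (\<lambda>(p, u). residual p u)"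
    "continuous_on ((I \<times> UNIV) \<times> UNIV) (\<lambda>(p, u). residual_deriv p u)"
    by (rule residual_continuous[OF S] residual_deriv_continuous[OF S])+
  fix q :: "real \<times> (real^'n)" and u assume "q \<in> I \<times> UNIV"
  then have q: "fst q \<ge> 0" using assms by auto
  show "(residual q has_derivative residual_deriv q u) (at u)" by (rule residual_has_derivative[OF q])
  show "residual q (eta (fst q) (snd q)) = 0" by (rule residual_root[OF q])
  show "u = eta (fst q) (snd q)" if "residual q u = 0" by (rule residual_root_unique[OF q that])
  show "u = 0" if "residual_deriv q (eta (fst q) (snd q)) u = 0" by (rule residual_deriv_root_injective[OF q that])
qed

lemma eta_continuous_on: "continuous_on ({0..} \<times> UNIV) (\<lambda>p. eta (fst p) (snd p))"
  by (rule parametrized_root.root_continuous_on[OF residual_parametrized_root]) simp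

lemma eta_continuous_on' [continuous_intros]:
  "continuous_on S t \<Longrightarrow> continuous_on S z \<Longrightarrow> (\<And>p. p \<in> S \<Longrightarrow> t p \<ge> 0) \<Longrightarrow> continuous_on S (\<lambda>p. eta (t p) (z p))"
  using continuous_on_compose2[OF eta_continuous_on, of S "\<lambda>p. (t p, z p)"]
  by (auto intro: continuous_on_Pair)

text \<open>
  Used with equality of times for the differential equation, where \<open>f\<close> is only
  continuous in time, and without any restriction for the convergence proof.
\<close>

lemma eta_locally_lipschitz:
  assumes I: "I \<subseteq> {0..}" and p: "p \<in> I \<times> UNIV"
    and lip: "\<And>\<rho>. \<exists>d>0. \<exists>L\<ge>0. \<forall>s\<in>I \<inter> ball (fst p) d. \<forall>t\<in>I \<inter> ball (fst p) d. \<forall>x\<in>cball 0 \<rho>. \<forall>y\<in>cball 0 \<rho>.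
       R s t \<longrightarrow> norm (f s x - f t y) \<le> L * (dist s t + dist x y)"
  shows "\<exists>\<delta>>0. \<exists>L\<ge>0. \<forall>q\<in>I \<times> UNIV \<inter> ball p \<delta>. \<forall>r\<in>I \<times> UNIV \<inter> ball p \<delta>. R (fst q) (fst r) \<longrightarrow>
       norm (eta (fst q) (snd q) - eta (fst r) (snd r)) \<le> L * dist q r"
proof -
  obtain K1 where K1: "K1 > 0" "\<And>x. norm (P1 *v x) \<le> K1 * norm x" using matrix_vector_norm_bound[of P1] by blast
  obtain K2 where K2: "K2 > 0" "\<And>x. norm (P2 *v x) \<le> K2 * norm x" using matrix_vector_norm_bound[of P2] by blast
  obtain K3 where K3: "K3 > 0" "\<And>x. norm (N2 *v x) \<le> K3 * norm x" using matrix_vector_norm_bound[of N2] by blast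
  define \<rho> where "\<rho> = K1 * (norm (snd p) + 1) + K2 * (norm (eta (fst p) (snd p)) + 1)"
  obtain d L where d: "d > 0" and L: "L \<ge> 0" and
    fl: "\<And>s t x y. s \<in> I \<inter> ball (fst p) d \<Longrightarrow> t \<in> I \<inter> ball (fst p) d \<Longrightarrow> x \<in> cball 0 \<rho> \<Longrightarrow> y \<in> cball 0 \<rho> \<Longrightarrow>
       R s t \<Longrightarrow> norm (f s x - f t y) \<le> L * (dist s t + dist x y)"
    using lip[of \<rho>] by blast
  define \<delta> where "\<delta> = min d 1"
  have near: "fst q \<in> ball (fst p) d" "norm (snd q) \<le> norm (snd p) + 1" if "q \<in> ball p \<delta>" for q
  proof -
    have "dist (fst p) (fst q) < d" "dist (snd p) (snd q) < 1"
      using that dist_fst_le[of p q] dist_snd_le[of p q] by (auto simp: \<delta>_def)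
    moreover have "norm (snd q) \<le> norm (snd p) + dist (snd p) (snd q)"
      by (metis dist_commute dist_norm norm_triangle_sub)
    ultimately show "fst q \<in> ball (fst p) d" "norm (snd q) \<le> norm (snd p) + 1" by auto
  qed
  have arg: "P1 *v snd q + P2 *v v \<in> cball 0 \<rho>" if "q \<in> ball p \<delta>" "v \<in> cball (eta (fst p) (snd p)) 1" for q v
  proof -
    have "norm v \<le> norm (eta (fst p) (snd p)) + dist (eta (fst p) (snd p)) v"
      by (metis dist_commute dist_norm norm_triangle_sub)
    then have v: "norm v \<le> norm (eta (fst p) (snd p)) + 1" using that(2) by simp
    have "norm (P1 *v snd q + P2 *v v) \<le> K1 * norm (snd q) + K2 * norm v"
      by (rule order_trans[OF norm_triangle_ineq add_mono[OF K1(2) K2(2)]])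
    also have "\<dots> \<le> \<rho>"
      unfolding \<rho>_def using near(2)[OF that(1)] v K1 K2 by (intro add_mono mult_left_mono) auto
    finally show ?thesis by simp
  qed
  have \<delta>0: "\<delta> > 0" using d by (simp add: \<delta>_def)
  have "norm (residual q v - residual r v) \<le> K3 * L * (1 + K1) * dist q r"
    if q: "q \<in> I \<times> UNIV \<inter> ball p \<delta>" and r: "r \<in> I \<times> UNIV \<inter> ball p \<delta>" and R: "R (fst q) (fst r)"
      and v: "v \<in> cball (eta (fst p) (snd p)) 1" for q r v
  proof -
    have "residual q v - residual r v = N2 *v (f (fst r) (P1 *v snd r + P2 *v v) - f (fst q) (P1 *v snd q + P2 *v v))"
      by (simp add: residual_def matrix_vector_mult_diff_distrib)
    then have "norm (residual q v - residual r v) \<le> K3 * norm (f (fst r) (P1 *v snd r + P2 *v v) - f (fst q) (P1 *v snd q + P2 *v v))"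
      using K3(2) by simp
    also have "\<dots> = K3 * norm (f (fst q) (P1 *v snd q + P2 *v v) - f (fst r) (P1 *v snd r + P2 *v v))"
      by (simp add: norm_minus_commute)
    also have "\<dots> \<le> K3 * (L * (dist (fst q) (fst r) + dist (P1 *v snd q + P2 *v v) (P1 *v snd r + P2 *v v)))"
      using K3(1) near(1) q r R arg[OF _ v] by (intro mult_left_mono fl) auto
    also have "dist (P1 *v snd q + P2 *v v) (P1 *v snd r + P2 *v v) = norm (P1 *v (snd q - snd r))"
      by (simp add: dist_norm matrix_vector_mult_diff_distrib)
    also have "K3 * (L * (dist (fst q) (fst r) + norm (P1 *v (snd q - snd r)))) \<le> K3 * (L * (dist q r + K1 * dist q r))"
    proof -
      have "norm (P1 *v (snd q - snd r)) \<le> K1 * dist (snd q) (snd r)" using K1(2) by (simp add: dist_norm)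
      also have "\<dots> \<le> K1 * dist q r" using K1(1) by (intro mult_left_mono dist_snd_le) simp
      finally show ?thesis using K3(1) L by (intro mult_left_mono add_mono dist_fst_le) auto
    qed
    finally show ?thesis by (simp add: algebra_simps)
  qed
  note residual_lip = this
  have K0: "K3 * L * (1 + K1) \<ge> 0" using K1 K3 L by simp
  show ?thesis
    by (rule parametrized_root.root_locally_lipschitz[OF residual_parametrized_root[OF I] p \<delta>0 K0, where R = "\<lambda>q r. R (fst q) (fst r)"])
      (rule residual_lip)
qed

definition rhs :: "real \<Rightarrow> real^'n \<Rightarrow> real^'n" where
  "rhs t z = N1 *v f t (P1 *v z + eta t z) - M *v (P1 *v z)"

lemma P1_rhs [simp]: "P1 *v rhs t z = rhs t z"
  by (simp add: rhs_def matrix_vector_mult_diff_distrib)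

lemma rhs_continuous_on:
  "continuous_on S t \<Longrightarrow> continuous_on S z \<Longrightarrow> (\<And>p. p \<in> S \<Longrightarrow> t p \<ge> 0) \<Longrightarrow> continuous_on S (\<lambda>p. rhs (t p) (z p))"
  unfolding rhs_def
  by (intro continuous_intros x_derivative_continuous_on(1)[OF f]) auto

text \<open>
  Composition of the Lipschitz estimates for \<open>f\<close> and \<open>eta\<close> on a compact
  neighbourhood.
\<close>

lemma rhs_local_lipschitz: "local_lipschitz {0..} UNIV rhs"
proof (rule local_lipschitzI)
  fix t :: real and z :: "real^'n" assume t: "t \<in> {0..}"
  have loc: "\<exists>d>0. \<exists>L\<ge>0. \<forall>s\<in>{0..} \<inter> ball t d. \<forall>t\<in>{0..} \<inter> ball t d. \<forall>x\<in>cball 0 \<rho>. \<forall>y\<in>cball 0 \<rho>.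
       s = t \<longrightarrow> norm (f s x - f t y) \<le> L * (dist s t + dist x y)" for \<rho>
  proof -
    obtain L where L: "L \<ge> 0" "\<And>s. s \<in> {0..t+1} \<Longrightarrow> L-lipschitz_on (cball 0 \<rho>) (f s)"
      using x_derivative_lipschitz[OF f] by blast
    show ?thesis
    proof (intro exI conjI ballI impI)
      show "(1::real) > 0" "L \<ge> 0" by (auto simp: L)
      fix s r and x y :: "real^'n" assume "s \<in> {0..} \<inter> ball t 1" "r \<in> {0..} \<inter> ball t 1"
        "x \<in> cball 0 \<rho>" "y \<in> cball 0 \<rho>" and [simp]: "s = r"
      then show "norm (f s x - f r y) \<le> L * (dist s r + dist x y)"
        using lipschitz_onD[OF L(2)[of r], of x y] by (auto simp: dist_norm abs_less_iff)
    qed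
  qed
  have "\<exists>\<delta>>0. \<exists>L\<ge>0. \<forall>q\<in>{0..} \<times> UNIV \<inter> ball (t, z) \<delta>. \<forall>r\<in>{0..} \<times> UNIV \<inter> ball (t, z) \<delta>.
      fst q = fst r \<longrightarrow> norm (eta (fst q) (snd q) - eta (fst r) (snd r)) \<le> L * dist q r"
    by (rule eta_locally_lipschitz) (use t loc in simp_all)
  then obtain \<delta> Le where \<delta>: "\<delta> > 0" "Le \<ge> 0"
    "\<And>q r. q \<in> {0..} \<times> UNIV \<inter> ball (t, z) \<delta> \<Longrightarrow> r \<in> {0..} \<times> UNIV \<inter> ball (t, z) \<delta> \<Longrightarrow> fst q = fst r \<Longrightarrow>
       norm (eta (fst q) (snd q) - eta (fst r) (snd r)) \<le> Le * dist q r"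
    by metis
  define d where "d = \<delta> / 3"
  have d: "d > 0" using \<delta> by (simp add: d_def)
  have eta_l: "norm (eta s x - eta s y) \<le> Le * norm (x - y)"
    if "s \<in> cball t d \<inter> {0..}" "x \<in> cball z d" "y \<in> cball z d" for s x y
  proof -
    have "dist (t, z) (s, w) < \<delta>" if "w \<in> cball z d" for w
    proof -
      have "dist (t, z) (s, w) \<le> dist t s + dist z w" by (rule dist_Pair_le_add)
      then show ?thesis using that \<open>s \<in> cball t d \<inter> {0..}\<close> \<delta>(1) by (simp add: d_def)
    qed
    then show ?thesis using \<delta>(3)[of "(s, x)" "(s, y)"] that by (simp add: dist_Pair_Pair dist_norm)
  qed
  obtain K1 where K1: "K1 > 0" "\<And>x. norm (P1 *v x) \<le> K1 * norm x" using matrix_vector_norm_bound[of P1] by blast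
  obtain K2 where K2: "K2 > 0" "\<And>x. norm (N1 *v x) \<le> K2 * norm x" using matrix_vector_norm_bound[of N1] by blast
  obtain K3 where K3: "K3 > 0" "\<And>x. norm ((M ** P1) *v x) \<le> K3 * norm x" using matrix_vector_norm_bound[of "M ** P1"] by blast
  have "continuous_on ((cball t d \<inter> {0..}) \<times> cball z d) (\<lambda>p. P1 *v snd p + eta (fst p) (snd p))"
    by (intro continuous_intros) auto
  then have "bounded ((\<lambda>p. P1 *v snd p + eta (fst p) (snd p)) ` ((cball t d \<inter> {0..}) \<times> cball z d))"
    by (intro compact_imp_bounded compact_continuous_image compact_Times compact_Int_closed) auto
  then obtain \<rho> where \<rho>: "\<And>p. p \<in> (cball t d \<inter> {0..}) \<times> cball z d \<Longrightarrow> norm (P1 *v snd p + eta (fst p) (snd p)) \<le> \<rho>"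
    unfolding bounded_iff by blast
  obtain L where L: "L \<ge> 0" "\<And>s. s \<in> {0..t+d} \<Longrightarrow> L-lipschitz_on (cball 0 \<rho>) (f s)"
    using x_derivative_lipschitz[OF f] by blast
  have "(K2 * (L * (K1 + Le)) + K3)-lipschitz_on (cball z d \<inter> UNIV) (rhs s)" if s: "s \<in> cball t d \<inter> {0..}" for s
  proof (rule lipschitz_onI)
    show "K2 * (L * (K1 + Le)) + K3 \<ge> 0" using K1 K2 K3 L \<delta> by simp
    fix x y assume xy: "x \<in> cball z d \<inter> UNIV" "y \<in> cball z d \<inter> UNIV"
    have "dist (rhs s x) (rhs s y) =
       norm (N1 *v (f s (P1 *v x + eta s x) - f s (P1 *v y + eta s y)) - (M ** P1) *v (x - y))"
      by (simp add: dist_norm rhs_def matrix_vector_mult_diff_distrib diff_diff_eq2 diff_add_eq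
          flip: matrix_vector_mul_assoc) (simp add: algebra_simps)
    also have "\<dots> \<le> norm (N1 *v (f s (P1 *v x + eta s x) - f s (P1 *v y + eta s y))) + norm ((M ** P1) *v (x - y))"
      by (rule norm_triangle_ineq4)
    also have "\<dots> \<le> K2 * norm (f s (P1 *v x + eta s x) - f s (P1 *v y + eta s y)) + K3 * norm (x - y)"
      by (intro add_mono K2 K3)
    also have "\<dots> \<le> K2 * (L * (K1 * norm (x - y) + Le * norm (x - y))) + K3 * norm (x - y)"
    proof (intro add_right_mono mult_left_mono)
      have "norm (f s (P1 *v x + eta s x) - f s (P1 *v y + eta s y))
          \<le> L * dist (P1 *v x + eta s x) (P1 *v y + eta s y)"
        unfolding dist_norm[of "f _ _", symmetric]
        by (rule lipschitz_onD[OF L(2)]) (use s xy \<rho>[of "(s, x)"] \<rho>[of "(s, y)"] in \<open>auto simp: dist_real_def\<close>)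
      also have "dist (P1 *v x + eta s x) (P1 *v y + eta s y) = norm (P1 *v (x - y) + (eta s x - eta s y))"
        by (simp add: dist_norm matrix_vector_mult_diff_distrib algebra_simps)
      also have "L * \<dots> \<le> L * (K1 * norm (x - y) + Le * norm (x - y))"
        using xy s L(1)
        by (intro mult_left_mono order_trans[OF norm_triangle_ineq] add_mono K1 eta_l) auto
      finally show "norm (f s (P1 *v x + eta s x) - f s (P1 *v y + eta s y))
          \<le> L * (K1 * norm (x - y) + Le * norm (x - y))" .
    qed (use K2 in simp)
    finally show "dist (rhs s x) (rhs s y) \<le> (K2 * (L * (K1 + Le)) + K3) * dist x y"
      by (simp add: dist_norm algebra_simps)
  qed
  then show "\<exists>u>0. \<exists>L. \<forall>t\<in>cball t u \<inter> {0..}. L-lipschitz_on (cball z u \<inter> UNIV) (rhs t)"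
    using d by blast
qed

lemma eta_lipschitz_compact:
  assumes "a \<ge> 0" and C1: "C1_on ({a..b} \<times> UNIV) (\<lambda>(t, x). f t x)"
  shows "\<exists>L. L-lipschitz_on ({a..b} \<times> cball 0 \<rho>) (\<lambda>p. eta (fst p) (snd p))"
proof -
  have loc: "\<exists>d>0. \<exists>L\<ge>0. \<forall>s\<in>{a..b} \<inter> ball t d. \<forall>t\<in>{a..b} \<inter> ball t d. \<forall>x\<in>cball 0 \<rho>. \<forall>y\<in>cball 0 \<rho>.
       True \<longrightarrow> norm (f s x - f t y) \<le> L * (dist s t + dist x y)" for \<rho> t
  proof -
    have "\<exists>L. L-lipschitz_on ({a..b} \<times> cball 0 \<rho>) (\<lambda>(t, x). f t x)"
      by (rule C1_on_lipschitz[OF C1]) (auto intro!: compact_Times convex_Times)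
    then obtain L where L: "L-lipschitz_on ({a..b} \<times> cball 0 \<rho>) (\<lambda>(t, x). f t x)" ..
    then have L0: "L \<ge> 0" by (simp add: lipschitz_on_def)
    show ?thesis
    proof (intro exI conjI ballI impI)
      show "(1::real) > 0" "L \<ge> 0" by (auto simp: L0)
      fix s r and x y :: "real^'n" assume "s \<in> {a..b} \<inter> ball t 1" "r \<in> {a..b} \<inter> ball t 1" "x \<in> cball 0 \<rho>" "y \<in> cball 0 \<rho>"
      then have "norm (f s x - f r y) \<le> L * dist (s, x) (r, y)"
        using lipschitz_onD[OF L, of "(s, x)" "(r, y)"] by (simp add: dist_norm)
      also have "\<dots> \<le> L * (dist s r + dist x y)" by (rule mult_left_mono[OF dist_Pair_le_add L0])
      finally show "norm (f s x - f r y) \<le> L * (dist s r + dist x y)" .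
    qed
  qed
  have ll: "local_lipschitz {0::real} ({a..b} \<times> cball 0 \<rho>) (\<lambda>_ p. eta (fst p) (snd p))"
  proof (rule local_lipschitzI)
    fix t0 :: real and p :: "real \<times> (real^'n)" assume p: "p \<in> {a..b} \<times> cball 0 \<rho>"
    have "\<exists>\<delta>>0. \<exists>L\<ge>0. \<forall>q\<in>{a..b} \<times> UNIV \<inter> ball p \<delta>. \<forall>r\<in>{a..b} \<times> UNIV \<inter> ball p \<delta>.
      True \<longrightarrow> norm (eta (fst q) (snd q) - eta (fst r) (snd r)) \<le> L * dist q r"
      by (rule eta_locally_lipschitz[OF _ _ loc]) (use p assms(1) in auto)
    then obtain \<delta> L where \<delta>: "\<delta> > 0" "L \<ge> 0"
      "\<And>q r. q \<in> {a..b} \<times> UNIV \<inter> ball p \<delta> \<Longrightarrow> r \<in> {a..b} \<times> UNIV \<inter> ball p \<delta> \<Longrightarrow>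
       norm (eta (fst q) (snd q) - eta (fst r) (snd r)) \<le> L * dist q r"
      by metis
    have "L-lipschitz_on (cball p (\<delta> / 2) \<inter> ({a..b} \<times> cball 0 \<rho>)) (\<lambda>p. eta (fst p) (snd p))"
    proof (rule lipschitz_onI)
      fix q r assume "q \<in> cball p (\<delta> / 2) \<inter> ({a..b} \<times> cball 0 \<rho>)" "r \<in> cball p (\<delta> / 2) \<inter> ({a..b} \<times> cball 0 \<rho>)"
      then show "dist (eta (fst q) (snd q)) (eta (fst r) (snd r)) \<le> L * dist q r"
        using \<delta>(3)[of q r] \<delta>(1) by (auto simp: dist_norm)
    qed (rule \<delta>(2))
    then show "\<exists>u>0. \<exists>L. \<forall>t\<in>cball t0 u \<inter> {0}. L-lipschitz_on (cball p u \<inter> ({a..b} \<times> cball 0 \<rho>)) (\<lambda>p. eta (fst p) (snd p))"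
      using \<delta>(1) by (intro exI[of _ "\<delta> / 2"]) auto
  qed
  have "compact ({a..b} \<times> cball (0::real^'n) \<rho>)" by (intro compact_Times compact_Icc compact_cball)
  then show ?thesis
    by (rule local_lipschitz_compact_implies_lipschitz[OF ll _ compact_sing continuous_on_const]) blast
qed

end

section \<open>A priori bounds and convergence for the reduced system\<close>

lemma self_adjoint_positive_coercive:
  fixes H :: "real^'n^'n"
  assumes W: "subspace W" and H: "self_adjoint_positive W H"
  shows "\<exists>m>0. \<forall>x\<in>W. m * (norm x)\<^sup>2 \<le> (H *v x) \<bullet> x"
proof (cases "W \<inter> sphere 0 1 = {}")
  case True
  have "x = 0" if "x \<in> W" for x
  proof (rule ccontr)
    assume "x \<noteq> 0"
    then have "(1 / norm x) *\<^sub>R x \<in> W \<inter> sphere 0 1"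
      using subspace_scale[OF W that] by simp
    then show False using True by blast
  qed
  then have "1 * (norm x)\<^sup>2 \<le> (H *v x) \<bullet> x" if "x \<in> W" for x
    using that by fastforce
  then show ?thesis using zero_less_one by blast
next
  case False
  have "compact (W \<inter> sphere 0 1)"
    by (rule closed_Int_compact[OF closed_subspace[OF W] compact_sphere])
  moreover have "continuous_on (W \<inter> sphere 0 1) (\<lambda>x. (H *v x) \<bullet> x)"
    by (intro continuous_intros bounded_linear.continuous_on[OF matrix_vector_mul_bounded_linear])
  ultimately obtain x0 where x0: "x0 \<in> W \<inter> sphere 0 1"
    and le: "\<And>x. x \<in> W \<inter> sphere 0 1 \<Longrightarrow> (H *v x0) \<bullet> x0 \<le> (H *v x) \<bullet> x"
    using continuous_attains_inf[of "W \<inter> sphere 0 1" "\<lambda>x. (H *v x) \<bullet> x"] False by blast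
  have "(H *v x0) \<bullet> x0 * (norm x)\<^sup>2 \<le> (H *v x) \<bullet> x" if x: "x \<in> W" for x
  proof (cases "x = 0")
    case False
    define y where "y = (1 / norm x) *\<^sub>R x"
    have "y \<in> W \<inter> sphere 0 1" using subspace_scale[OF W x] False by (simp add: y_def)
    then have "(H *v x0) \<bullet> x0 * (norm x)\<^sup>2 \<le> (H *v y) \<bullet> y * (norm x)\<^sup>2"
      by (intro mult_right_mono le) auto
    also have "\<dots> = (H *v x) \<bullet> x"
      using False by (simp add: y_def matrix_vector_mult_scaleR power2_eq_square)
    finally show ?thesis .
  qed simp
  moreover have "(H *v x0) \<bullet> x0 > 0"
    using H x0 by (auto simp: self_adjoint_positive_def)
  ultimately show ?thesis by blast
qed

text \<open>
  A Lipschitz derivative suffices for a local error of order \<open>h^2\<close>; second derivatives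
  are not available here.
\<close>

lemma euler_local_error:
  fixes z :: "real \<Rightarrow> 'a::real_normed_vector"
  assumes z: "\<And>s. s \<in> {a..b} \<Longrightarrow> (z has_vector_derivative g s) (at s within {a..b})"
    and g: "K-lipschitz_on {a..b} g"
    and h: "h \<ge> 0" "t \<in> {a..b}" "t + h \<in> {a..b}"
  shows "norm (z (t + h) - z t - h *\<^sub>R g t) \<le> K * h\<^sup>2"
proof -
  have K: "K \<ge> 0" using g by (simp add: lipschitz_on_def)
  have sub: "{t..t+h} \<subseteq> {a..b}" using h by auto
  have "norm (z (t + h) - z t - (t + h - t) *\<^sub>R g t) \<le> norm (t + h - t) * (K * h)"
  proof (rule vector_differentiable_bound_linearization[where S = "{t..t+h}"])
    fix s assume s: "s \<in> {t..t+h}"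
    show "(z has_vector_derivative g s) (at s within {t..t+h})"
      using z[of s] s sub has_vector_derivative_within_subset by blast
    have "norm (g s - g t) \<le> K * dist s t"
      using lipschitz_onD[OF g, of s t] s sub h by (auto simp: dist_norm)
    also have "\<dots> \<le> K * h" using s K by (intro mult_left_mono) (auto simp: dist_real_def)
    finally show "norm (g s - g t) \<le> K * h" .
  qed (use h in \<open>auto simp: closed_segment_eq_real_ivl\<close>)
  then show ?thesis using h by (simp add: power2_eq_square mult_ac)
qed

context index1_dae
begin

lemma P2_rhs [simp]: "P2 *v rhs t z = 0"
  using P_complement(1) P1_rhs by blast

lemma rhs_eq:
  "P1 *v z = z \<Longrightarrow> rhs t z = N1 *v f t (z + eta t z) - M *v z"
  by (simp add: rhs_def)

lemma solution_stays_in_range: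
  assumes "ode_solution_on rhs {a..c} z" "P1 *v z a = z a" "t \<in> {a..c}"
  shows "P1 *v z t = z t"
proof -
  have "((\<lambda>t. P2 *v z t) has_vector_derivative 0) (at t within {a..c})" if "t \<in> {a..c}" for t
    using bounded_linear.has_vector_derivative[OF matrix_vector_mul_bounded_linear[of P2]] assms(1) that
    by (fastforce simp: ode_solution_on_def)
  then obtain k where "\<And>t. t \<in> {a..c} \<Longrightarrow> P2 *v z t = k"
    using has_vector_derivative_zero_constant[of "{a..c}" "\<lambda>t. P2 *v z t"] by auto
  then have "P2 *v z t = P2 *v z a" using assms(3) by auto
  then show ?thesis using assms(2) by (simp add: P_complement)
qed

lemma subspace_range_P1: "subspace (range ((*v) P1))"
  by (rule linear_subspace_image) auto

text \<open>
  Along a solution the derivative of \<open>V = (H z, z) / 2\<close> is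
  \<open>(H z, rhs t z)\<close>, so the comparison lemma bounds \<open>V\<close>, and coercivity of
  \<open>H\<close> on the range of \<open>P1\<close> turns this into a bound for \<open>z\<close>.
\<close>

lemma solution_a_priori_bound:
  assumes H: "self_adjoint_positive (range ((*v) P1)) H"
    and K: "K \<ge> 0" and U: "continuous_on {0<..} U" "\<And>v. v > 0 \<Longrightarrow> U v > 0"
    and div: "\<And>c. c > 0 \<Longrightarrow> filterlim (\<lambda>b. integral {c..b} (\<lambda>v. 1 / U v)) at_top at_top"
    and growth: "\<And>t z. t \<in> {a..b} \<Longrightarrow> P1 *v z = z \<Longrightarrow> norm z \<ge> R \<Longrightarrow>
       (H *v z) \<bullet> rhs t z \<le> K * U (((H *v z) \<bullet> z) / 2)"
    and z0: "P1 *v z0 = z0"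
  shows "\<exists>B. \<forall>c\<in>{a..b}. \<forall>z. ode_solution_on rhs {a..c} z \<and> z a = z0 \<longrightarrow> norm (z c) \<le> B"
proof -
  define V where "V z = ((H *v z) \<bullet> z) / 2" for z
  obtain KH where KH: "KH > 0" "\<And>x. norm (H *v x) \<le> KH * norm x"
    using matrix_vector_norm_bound[of H] by blast
  obtain m0 where m0: "m0 > 0" "\<And>x. P1 *v x = x \<Longrightarrow> m0 * (norm x)\<^sup>2 \<le> (H *v x) \<bullet> x"
    using self_adjoint_positive_coercive[OF subspace_range_P1 H] in_range_P by blast
  (* Above the level c the growth condition applies, since V z \<ge> c forces norm z \<ge> R. *)
  define c where "c = max (V z0) (KH * R\<^sup>2 / 2) + 1"
  have V0: "V z0 \<ge> 0" using m0(1) order_trans[OF _ m0(2)[OF z0], of 0] by (simp add: V_def)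
  have c: "c > 0" "V z0 < c" "KH * R\<^sup>2 / 2 < c" using V0 by (auto simp: c_def)
  have large: "norm z \<ge> R" if "V z \<ge> c" for z
  proof (rule ccontr)
    assume "\<not> norm z \<ge> R"
    then have "(norm z)\<^sup>2 \<le> R\<^sup>2" by (intro power_mono) auto
    have "V z \<le> norm (H *v z) * norm z / 2" using norm_cauchy_schwarz[of "H *v z" z] by (simp add: V_def)
    also have "\<dots> \<le> KH * norm z * norm z / 2" using KH(2)[of z] by (intro divide_right_mono mult_right_mono) auto
    also have "\<dots> \<le> KH * R\<^sup>2 / 2" using KH(1) \<open>(norm z)\<^sup>2 \<le> R\<^sup>2\<close> by (simp add: power2_eq_square)
    finally show False using that c by simp
  qed
  have "\<forall>\<^sub>F m in at_top. K * (b - a) < integral {c..m} (\<lambda>v. 1 / U v)"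
    using div[OF c(1)] by (simp add: filterlim_at_top_dense)
  then have "\<forall>\<^sub>F m in at_top. K * (b - a) < integral {c..m} (\<lambda>v. 1 / U v) \<and> c \<le> m"
    using eventually_ge_at_top by (rule eventually_conj)
  then obtain m where m: "K * (b - a) < integral {c..m} (\<lambda>v. 1 / U v)" "c \<le> m"
    using eventually_happens by fastforce
  have "norm (z d) \<le> sqrt (2 * m / m0)" if d: "d \<in> {a..b}" and z: "ode_solution_on rhs {a..d} z" "z a = z0" for d z
  proof -
    have zP: "P1 *v z t = z t" if "t \<in> {a..d}" for t
      by (rule solution_stays_in_range[OF z(1) _ that]) (simp add: z(2) z0)
    have "V (z d) < m"
    proof (rule comparison_bound[where v' = "\<lambda>t. (H *v z t) \<bullet> rhs t (z t)" and v = "\<lambda>t. V (z t)" and a = a and b = d,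
          OF U c(1) m(2) _ _ _ _ K])
      show "V (z a) < c" using c z by simp
      show "continuous_on {a..d} (\<lambda>t. V (z t))"
        unfolding V_def by (intro continuous_intros ode_solution_on_imp_continuous_on[OF z(1)]
            bounded_linear.continuous_on[OF matrix_vector_mul_bounded_linear]) simp
      show "K * (d - a) < integral {c..m} (\<lambda>x. 1 / U x)"
        using m(1) K d mult_left_mono[of "d - a" "b - a" K] by auto
      show "d \<in> {a..d}" using d by simp
      fix t assume t: "t \<in> {a<..<d}"
      then have t': "t \<in> {a..d}" by auto
      have at: "at t within {a..d} = at t" by (rule at_within_Icc_at) (use t in auto)
      have dz: "(z has_vector_derivative rhs t (z t)) (at t)"
        using z(1) t' unfolding ode_solution_on_def at[symmetric] by blast
      have dH: "((\<lambda>t. H *v z t) has_vector_derivative H *v rhs t (z t)) (at t)"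
        by (rule bounded_linear.has_vector_derivative[OF matrix_vector_mul_bounded_linear dz])
      have sym: "(H *v rhs t (z t)) \<bullet> z t = rhs t (z t) \<bullet> (H *v z t)"
        using H in_range_P(1) P1_rhs zP[OF t'] unfolding self_adjoint_positive_def by blast
      have two: "(H *v z t) \<bullet> rhs t (z t) + (H *v rhs t (z t)) \<bullet> z t = 2 * ((H *v z t) \<bullet> rhs t (z t))"
        unfolding sym by (simp add: inner_commute)
      have "((\<lambda>t. (H *v z t) \<bullet> z t) has_vector_derivative
          (H *v z t) \<bullet> rhs t (z t) + (H *v rhs t (z t)) \<bullet> z t) (at t)"
        by (rule bounded_bilinear.has_vector_derivative[OF bounded_bilinear_inner dH dz])
      then have "((\<lambda>t. (H *v z t) \<bullet> z t) has_real_derivative 2 * ((H *v z t) \<bullet> rhs t (z t))) (at t)"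
        unfolding has_real_derivative_iff_has_vector_derivative two .
      from DERIV_cdivide[OF this, of 2]
      show "((\<lambda>t. V (z t)) has_real_derivative (H *v z t) \<bullet> rhs t (z t)) (at t)"
        by (simp add: V_def)
      show "(H *v z t) \<bullet> rhs t (z t) \<le> K * U (V (z t))" if "c \<le> V (z t)"
        unfolding V_def by (rule growth) (use t d zP[OF t'] large[OF that] in auto)
    qed
    then have "m0 * (norm (z d))\<^sup>2 < 2 * m"
      using m0(2)[OF zP[of d]] d by (simp add: V_def)
    then have "(norm (z d))\<^sup>2 \<le> 2 * m / m0" using m0(1) by (simp add: field_simps)
    then show ?thesis using real_le_rsqrt by blast
  qed
  then show ?thesis by blast
qed

definition newton :: "real \<Rightarrow> real^'n \<Rightarrow> real^'n \<Rightarrow> real^'n" where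
  "newton t z u = u - matrix_inv (mat 1 - N2 ** jacobian (f t) (at (z + u))) *v (u - N2 *v f t (z + u))"

lemma newton_matrix_invertible:
  assumes "\<And>v. v = N2 *v (jacobian (f t) (at (z + u)) *v v) \<Longrightarrow> v = 0"
  shows "invertible (mat 1 - N2 ** jacobian (f t) (at (z + u)))"
proof -
  have "v = 0" if "(mat 1 - N2 ** jacobian (f t) (at (z + u))) *v v = 0" for v
    using that by (intro assms) (simp add: matrix_vector_mult_diff_rdistrib matrix_vector_mul_assoc)
  then show ?thesis
    using invertible_left_inverse matrix_left_invertible_ker by blast
qed

lemma newton_equation:
  assumes nd: "\<And>v. v = N2 *v (jacobian (f t) (at (z + u)) *v v) \<Longrightarrow> v = 0"
  defines "J \<equiv> jacobian (f t) (at (z + u))"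
  shows "newton t z u - N2 *v (J *v newton t z u) = N2 *v (f t (z + u) - J *v u)"
proof -
  let ?A = "mat 1 - N2 ** J"
  have inv: "invertible ?A" unfolding J_def by (rule newton_matrix_invertible[OF nd])
  have A: "?A *v x = x - N2 *v (J *v x)" for x
    by (simp add: matrix_vector_mult_diff_rdistrib matrix_vector_mul_assoc)
  have "?A *v newton t z u = ?A *v u - ?A *v (matrix_inv ?A *v (u - N2 *v f t (z + u)))"
    unfolding newton_def J_def by (rule matrix_vector_mult_diff_distrib)
  also have "?A *v (matrix_inv ?A *v (u - N2 *v f t (z + u))) = u - N2 *v f t (z + u)"
    by (simp only: matrix_vector_mul_assoc matrix_inv_inverse(1)[OF inv] matrix_vector_mul_lid)
  finally have "?A *v newton t z u = ?A *v u - (u - N2 *v f t (z + u))" .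
  then show ?thesis unfolding A by (simp add: matrix_vector_mult_diff_distrib)
qed

lemma newton_in_range:
  assumes "\<And>v. v = N2 *v (jacobian (f t) (at (z + u)) *v v) \<Longrightarrow> v = 0"
  shows "P2 *v newton t z u = newton t z u"
proof -
  have "newton t z u = N2 *v (f t (z + u) - jacobian (f t) (at (z + u)) *v u +
      jacobian (f t) (at (z + u)) *v newton t z u)"
    using newton_equation[OF assms] by (simp add: matrix_vector_right_distrib diff_eq_eq)
  then show ?thesis using N_apply(2) by metis
qed

text \<open>
  With \<open>w = eta t z\<close> the Newton matrix maps the new error to
  \<open>N2 (f(z + u) - f(z + w) - J (u - w))\<close>, with \<open>J\<close> the Jacobian at
  \<open>z + u\<close>. Uniform continuity of the Jacobian makes this small relative to
  \<open>|u - w|\<close>, and compactness bounds the Newton matrices uniformly from below.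
\<close>

lemma newton_halves_error:
  assumes t0: "0 \<le> t0"
    and nd: "\<And>t z u v. t \<in> {t0..T} \<Longrightarrow> P1 *v z = z \<Longrightarrow> P2 *v u = u \<Longrightarrow>
       v = N2 *v (jacobian (f t) (at (z + u)) *v v) \<Longrightarrow> v = 0"
    and bound: "\<And>t z. t \<in> {t0..T} \<Longrightarrow> z \<in> cball 0 r \<Longrightarrow> norm (eta t z) \<le> M'"
  shows "\<exists>\<delta>>0. \<forall>t\<in>{t0..T}. \<forall>z u. P1 *v z = z \<longrightarrow> z \<in> cball 0 r \<longrightarrow> P2 *v u = u \<longrightarrow>
    norm (u - eta t z) \<le> \<delta> \<longrightarrow> norm (newton t z u - eta t z) \<le> 1 / 2 * norm (u - eta t z)"
proof (cases "\<exists>t\<in>{t0..T}. \<exists>z\<in>cball (0::real^'n) r. True")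
  case False
  then have empty: "\<not> (t \<in> {t0..T} \<and> z \<in> cball 0 r)" for t and z :: "real^'n" by blast
  show ?thesis
    by (rule exI[of _ 1], rule conjI[OF zero_less_one]) (use empty in blast)
next
  case True
  then obtain t' and z' :: "real^'n" where tz: "t' \<in> {t0..T}" "z' \<in> cball 0 r" by blast
  have ne: "t0 \<in> {t0..T}" using tz(1) by simp
  have nn: "r \<ge> 0" "M' \<ge> 0"
    using tz(2) order_trans[OF norm_ge_zero bound[OF tz]] order_trans[OF norm_ge_zero, of z' r] by simp_all
  define J where "J t x = jacobian (f t) (at x)" for t x
  define \<rho> where "\<rho> = r + (M' + 1)"
  obtain K where K: "K > 0" "\<And>x. norm (N2 *v x) \<le> K * norm x"
    using matrix_vector_norm_bound[of N2] by blast
  (* The Newton matrices are bounded below on this compact set: E measures the image of a unit vector. *)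
  define KK where "KK = {t0..T} \<times> (cball 0 r \<inter> {z. P1 *v z = z}) \<times> (cball 0 (M' + 1) \<inter> {u. P2 *v u = u}) \<times> sphere (0::real^'n) 1"
  define E where "E p = (case p of (t, z, u, v) \<Rightarrow> norm (v - N2 *v (matrix_blinfun (J t (z + u)) v)))" for p
  have "compact KK" unfolding KK_def
    by (intro compact_Times compact_Icc compact_Int_closed compact_cball compact_sphere closed_Collect_eq continuous_intros)
  moreover have "KK \<noteq> {}"
  proof -
    obtain v :: "real^'n" where "norm v = 1" by (rule vector_choose_size[of 1]) simp_all
    then have "(t0, 0, 0, v) \<in> KK" using ne nn by (simp add: KK_def)
    then show ?thesis by blast
  qed
  moreover have "continuous_on KK E"
    unfolding E_def split_beta J_def
    by (intro continuous_intros x_derivative_continuous_on(2)[OF f]) (use t0 in \<open>auto simp: KK_def\<close>)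
  ultimately obtain p0 where p0: "p0 \<in> KK" "\<And>p. p \<in> KK \<Longrightarrow> E p0 \<le> E p"
    using continuous_attains_inf[of KK E] by blast
  obtain t1 z1 u1 v1 where p0_eq: "p0 = (t1, z1, u1, v1)" by (cases p0)
  have m: "E p0 > 0"
  proof (rule ccontr)
    assume "\<not> E p0 > 0"
    then have "E p0 = 0" by (simp add: E_def p0_eq)
    then have "v1 = N2 *v (J t1 (z1 + u1) *v v1)" by (simp add: E_def p0_eq)
    moreover have p: "t1 \<in> {t0..T}" "P1 *v z1 = z1" "P2 *v u1 = u1" "norm v1 = 1"
      using p0(1) by (simp_all add: p0_eq KK_def)
    ultimately have "v1 = 0" unfolding J_def by (intro nd[OF p(1-3)])
    then show False using p(4) by simp
  qed
  have coercive: "E p0 * norm v \<le> norm (v - N2 *v (J t (z + u) *v v))"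
    if "t \<in> {t0..T}" "P1 *v z = z" "z \<in> cball 0 r" "P2 *v u = u" "u \<in> cball 0 (M' + 1)" for t z u v
  proof (cases "v = 0")
    case False
    define w where "w = (1 / norm v) *\<^sub>R v"
    have "(t, z, u, w) \<in> KK" using that False by (simp add: KK_def w_def)
    from p0(2)[OF this] have "E p0 \<le> norm (w - N2 *v (J t (z + u) *v w))"
      by (simp add: E_def[of "(t, z, u, w)"])
    then have "E p0 * norm v \<le> norm v * norm (w - N2 *v (J t (z + u) *v w))"
      using mult_left_mono[OF _ norm_ge_zero[of v]] by (metis mult.commute)
    also have "\<dots> = norm (norm v *\<^sub>R (w - N2 *v (J t (z + u) *v w)))" by simp
    also have "norm v *\<^sub>R (w - N2 *v (J t (z + u) *v w)) = v - N2 *v (J t (z + u) *v v)"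
      using False by (simp add: w_def matrix_vector_mult_scaleR scaleR_diff_right)
    finally show ?thesis .
  qed simp
  define \<epsilon> where "\<epsilon> = E p0 / (2 * K)"
  have \<epsilon>: "\<epsilon> > 0" using m K by (simp add: \<epsilon>_def)
  have "uniformly_continuous_on ({t0..T} \<times> cball 0 \<rho>) (\<lambda>p. matrix_blinfun (J (fst p) (snd p)))"
    unfolding J_def
    by (intro compact_uniformly_continuous compact_Times compact_Icc compact_cball continuous_intros
        x_derivative_continuous_on(2)[OF f]) (use t0 in auto)
  from this[unfolded uniformly_continuous_on_def, rule_format, OF \<epsilon>]
  obtain d where d: "d > 0" and J_close: "\<forall>p\<in>{t0..T} \<times> cball 0 \<rho>. \<forall>q\<in>{t0..T} \<times> cball 0 \<rho>.
      dist q p < d \<longrightarrow> dist (matrix_blinfun (J (fst q) (snd q))) (matrix_blinfun (J (fst p) (snd p))) < \<epsilon>"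
    by blast
  define \<delta> where "\<delta> = min (d / 2) 1"
  have \<delta>: "\<delta> > 0" "\<delta> < d" "\<delta> \<le> 1" using d by (auto simp: \<delta>_def)
  have main: "norm (newton t z u - eta t z) \<le> 1 / 2 * norm (u - eta t z)"
    if t: "t \<in> {t0..T}" and z: "P1 *v z = z" "z \<in> cball 0 r" and u: "P2 *v u = u" and near: "norm (u - eta t z) \<le> \<delta>" for t z u
  proof -
    have t': "t \<ge> 0" using t t0 by simp
    define w where "w = eta t z"
    have w: "norm w \<le> M'" "N2 *v f t (z + w) = w"
      using bound[OF t z(2)] eta(3)[OF t', of z] z by (auto simp: w_def)
    have "norm u \<le> norm (u - w) + norm w" using norm_triangle_ineq[of "u - w" w] by simp
    then have ub: "u \<in> cball 0 (M' + 1)" using near w \<delta> by (simp add: w_def)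
    define S where "S = cball (z + u) \<delta> \<inter> cball 0 \<rho>"
    have "norm (z + u) \<le> \<rho>" "norm (z + w) \<le> \<rho>"
      using z(2) ub w(1) norm_triangle_ineq[of z u] norm_triangle_ineq[of z w]
      by (simp_all add: \<rho>_def)
    then have zu: "z + u \<in> S" "z + w \<in> S"
      using near \<delta>(1) by (simp_all add: S_def w_def) (simp add: dist_norm)
    have "norm (f t (z + w) - f t (z + u) - matrix_blinfun (J t (z + u)) ((z + w) - (z + u))) \<le> norm ((z + w) - (z + u)) * \<epsilon>"
    proof (rule differentiable_bound_linearization[where S = S and f' = "\<lambda>x. blinfun_apply (matrix_blinfun (J t x))"])
      fix s :: real assume "s \<in> {0..1}"
      moreover have "convex S" unfolding S_def by (intro convex_Int convex_cball)
      ultimately have "(1 - s) *\<^sub>R (z + u) + s *\<^sub>R (z + w) \<in> S"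
        using zu by (intro convexD) auto
      then show "z + u + s *\<^sub>R (z + w - (z + u)) \<in> S" by (simp add: algebra_simps)
    next
      fix x assume x: "x \<in> S"
      show "(f t has_derivative blinfun_apply (matrix_blinfun (J t x))) (at x within S)"
        unfolding J_def by (rule has_derivative_at_withinI[OF x_derivative_has_derivative[OF f t']])
      have "dist (t, x) (t, z + u) < d" using x \<delta> by (simp add: S_def dist_Pair_Pair dist_commute)
      then have "dist (matrix_blinfun (J t x)) (matrix_blinfun (J t (z + u))) < \<epsilon>"
        using J_close[rule_format, of "(t, z + u)" "(t, x)"] t x zu by (simp add: S_def)
      then have "norm (matrix_blinfun (J t x) - matrix_blinfun (J t (z + u))) \<le> \<epsilon>" by (simp add: dist_norm)
      moreover have "blinfun_apply (matrix_blinfun (J t x)) - blinfun_apply (matrix_blinfun (J t (z + u)))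
          = blinfun_apply (matrix_blinfun (J t x) - matrix_blinfun (J t (z + u)))"
        by (simp add: fun_eq_iff blinfun.diff_left)
      ultimately show "onorm (blinfun_apply (matrix_blinfun (J t x)) - blinfun_apply (matrix_blinfun (J t (z + u)))) \<le> \<epsilon>"
        by (simp add: norm_blinfun.rep_eq)
    qed (rule zu)
    then have lin: "norm (f t (z + w) - f t (z + u) - J t (z + u) *v (w - u)) \<le> norm (u - w) * \<epsilon>"
      by (simp add: norm_minus_commute)
    have eq: "(newton t z u - w) - N2 *v (J t (z + u) *v (newton t z u - w))
        = - (N2 *v (f t (z + w) - f t (z + u) - J t (z + u) *v (w - u)))"
    proof -
      have "newton t z u - N2 *v (J t (z + u) *v newton t z u) = N2 *v (f t (z + u) - J t (z + u) *v u)"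
        unfolding J_def by (rule newton_equation) (use nd[OF t z(1) u] in blast)
      then show ?thesis using w(2) by (simp add: matrix_vector_mult_diff_distrib algebra_simps)
    qed
    have "E p0 * norm (newton t z u - w) \<le> norm ((newton t z u - w) - N2 *v (J t (z + u) *v (newton t z u - w)))"
      by (rule coercive[OF t z u ub])
    also have "\<dots> \<le> K * norm (f t (z + w) - f t (z + u) - J t (z + u) *v (w - u))"
      unfolding eq norm_minus_cancel by (rule K(2))
    also have "\<dots> \<le> K * (norm (u - w) * \<epsilon>)" using K(1) by (intro mult_left_mono lin) auto
    also have "\<dots> = E p0 * (1 / 2 * norm (u - w))" using K(1) by (simp add: \<epsilon>_def)
    finally show ?thesis using m by (simp add: w_def)
  qed
  show ?thesis
    by (rule exI[of _ \<delta>], rule conjI[OF \<delta>(1)], intro ballI allI impI, rule main)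
qed

text \<open>
  Continuous differentiability of \<open>f\<close> on the time interval makes \<open>f\<close>, and
  with it \<open>eta\<close>, Lipschitz in time and space on compact sets. This supplies the
  constants for the abstract convergence result; in particular the slope along the solution is
  Lipschitz in time, which gives the consistency of the Euler step.
\<close>

theorem method_converges:
  assumes t0: "0 \<le> t0" "t0 < T"
    and C1: "C1_on ({t0..T} \<times> UNIV) (\<lambda>(t, x). f t x)"
    and nd: "\<And>t z u v. t \<in> {t0..T} \<Longrightarrow> P1 *v z = z \<Longrightarrow> P2 *v u = u \<Longrightarrow>
       v = N2 *v (jacobian (f t) (at (z + u)) *v v) \<Longrightarrow> v = 0"
    and z: "ode_solution_on rhs {t0..T} z" "P1 *v z t0 = z t0"
  shows "\<exists>C\<ge>0. \<exists>h0>0. \<forall>h zs us n i. 0 < h \<longrightarrow> h \<le> h0 \<longrightarrow> t0 + real n * h \<le> T \<longrightarrow>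
       zs 0 = z t0 \<longrightarrow> us 0 = eta t0 (z t0) \<longrightarrow>
       (\<forall>i<n. zs (Suc i) = zs i + h *\<^sub>R (N1 *v f (t0 + real i * h) (zs i + us i) - M *v zs i)) \<longrightarrow>
       (\<forall>i<n. us (Suc i) = newton (t0 + real (Suc i) * h) (zs (Suc i)) (us i)) \<longrightarrow> i \<le> n \<longrightarrow>
       norm (zs i - z (t0 + real i * h)) \<le> C * h \<and>
       norm (us i - eta (t0 + real i * h) (z (t0 + real i * h))) \<le> C * h"
proof -
  define X where "X = {z. P1 *v z = z}"
  define Y where "Y = {u. P2 *v u = u}"
  define \<eta> where "\<eta> p = eta (fst p) (snd p)" for p
  define F where "F t z u = N1 *v f t (z + u) - M *v z" for t z u
  have zX: "z t \<in> X" if "t \<in> {t0..T}" for t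
    unfolding X_def using solution_stays_in_range[OF z that] by simp
  have cz: "continuous_on {t0..T} z" by (rule ode_solution_on_imp_continuous_on[OF z(1)])
  then have "bounded (z ` {t0..T})" by (intro compact_imp_bounded compact_continuous_image) auto
  then obtain r where r: "\<And>t. t \<in> {t0..T} \<Longrightarrow> norm (z t) \<le> r" unfolding bounded_iff by blast
  have eta_cont: "continuous_on ({t0..T} \<times> cball 0 (r + 1)) \<eta>"
    unfolding \<eta>_def by (intro continuous_intros) (use t0 in auto)
  then have "bounded (\<eta> ` ({t0..T} \<times> cball 0 (r + 1)))"
    by (intro compact_imp_bounded compact_continuous_image compact_Times) auto
  then obtain M' where M': "\<And>p. p \<in> {t0..T} \<times> cball 0 (r + 1) \<Longrightarrow> norm (\<eta> p) \<le> M'"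
    unfolding bounded_iff by blast
  obtain L1 where L1: "L1-lipschitz_on ({t0..T} \<times> cball 0 (r + 1)) \<eta>"
    using eta_lipschitz_compact[OF t0(1) C1] unfolding \<eta>_def by blast
  define \<rho> where "\<rho> = (r + 1) + (M' + 1)"
  have "\<exists>L. L-lipschitz_on ({t0..T} \<times> cball 0 \<rho>) (\<lambda>(t, x). f t x)"
    by (rule C1_on_lipschitz[OF C1]) (auto intro!: compact_Times convex_Times)
  then obtain Lf where Lf: "Lf-lipschitz_on ({t0..T} \<times> cball 0 \<rho>) (\<lambda>(t, x). f t x)" ..
  have L1n: "L1 \<ge> 0" and Lfn: "Lf \<ge> 0" using L1 Lf by (auto simp: lipschitz_on_def)
  obtain K1 where K1: "K1 > 0" "\<And>x. norm (N1 *v x) \<le> K1 * norm x"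
    using matrix_vector_norm_bound[of N1] by blast
  obtain K2 where K2: "K2 > 0" "\<And>x. norm (M *v x) \<le> K2 * norm x"
    using matrix_vector_norm_bound[of M] by blast
  have F_lip: "norm (F t z u - F s z' u') \<le> (K1 * Lf + K2) * (dist t s + norm (z - z') + norm (u - u'))"
    if "t \<in> {t0..T}" "s \<in> {t0..T}" "norm z \<le> r + 1" "norm z' \<le> r + 1" "norm u \<le> M' + 1" "norm u' \<le> M' + 1"
    for t s z z' u u'
  proof -
    have in_ball: "z + u \<in> cball 0 \<rho>" "z' + u' \<in> cball 0 \<rho>"
      using that norm_triangle_ineq[of z u] norm_triangle_ineq[of z' u'] by (auto simp: \<rho>_def)
    have "norm (f t (z + u) - f s (z' + u')) \<le> Lf * dist (t, z + u) (s, z' + u')"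
      using lipschitz_onD[OF Lf, of "(t, z + u)" "(s, z' + u')"] that in_ball by (simp add: dist_norm)
    also have "\<dots> \<le> Lf * (dist t s + norm (z - z') + norm (u - u'))"
    proof (rule mult_left_mono[OF _ Lfn])
      have "dist (z + u) (z' + u') = norm ((z - z') + (u - u'))" by (simp add: dist_norm algebra_simps)
      then have "dist (z + u) (z' + u') \<le> norm (z - z') + norm (u - u')" using norm_triangle_ineq by metis
      then show "dist (t, z + u) (s, z' + u') \<le> dist t s + norm (z - z') + norm (u - u')"
        using dist_Pair_le_add[of t "z + u" s "z' + u'"] by linarith
    qed
    finally have f1: "norm (f t (z + u) - f s (z' + u')) \<le> Lf * (dist t s + norm (z - z') + norm (u - u'))" .
    have "F t z u - F s z' u' = N1 *v (f t (z + u) - f s (z' + u')) - M *v (z - z')"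
      by (simp add: F_def matrix_vector_mult_diff_distrib)
    then have "norm (F t z u - F s z' u') \<le> norm (N1 *v (f t (z + u) - f s (z' + u'))) + norm (M *v (z - z'))"
      by (simp add: norm_triangle_ineq4)
    also have "\<dots> \<le> K1 * (Lf * (dist t s + norm (z - z') + norm (u - u'))) + K2 * (dist t s + norm (z - z') + norm (u - u'))"
    proof (rule add_mono)
      show "norm (N1 *v (f t (z + u) - f s (z' + u'))) \<le> K1 * (Lf * (dist t s + norm (z - z') + norm (u - u')))"
        using K1(1) by (intro order_trans[OF K1(2)] mult_left_mono f1) auto
      show "norm (M *v (z - z')) \<le> K2 * (dist t s + norm (z - z') + norm (u - u'))"
        using K2(1) by (intro order_trans[OF K2(2)] mult_left_mono) auto
    qed
    finally show ?thesis by (simp add: algebra_simps)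
  qed
  have "continuous_on ({t0..T} \<times> cball 0 (r + 1) \<times> cball 0 (M' + 1)) (\<lambda>p. F (fst p) (fst (snd p)) (snd (snd p)))"
    unfolding F_def by (intro continuous_intros x_derivative_continuous_on(1)[OF f]) (use t0 in auto)
  then have "bounded ((\<lambda>p. F (fst p) (fst (snd p)) (snd (snd p))) ` ({t0..T} \<times> cball 0 (r + 1) \<times> cball 0 (M' + 1)))"
    by (intro compact_imp_bounded compact_continuous_image compact_Times) auto
  then obtain K where K: "\<And>p. p \<in> {t0..T} \<times> cball 0 (r + 1) \<times> cball 0 (M' + 1) \<Longrightarrow>
      norm (F (fst p) (fst (snd p)) (snd (snd p))) \<le> K"
    unfolding bounded_iff by blast
  have K': "norm (F t z u) \<le> max K 0" if "t \<in> {t0..T}" "norm z \<le> r + 1" "norm u \<le> M' + 1" for t z u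
    using K[of "(t, z, u)"] that by auto
  have eta_in: "\<eta> (t, x) \<in> Y \<inter> cball 0 M'" if "t \<in> {t0..T}" "norm x \<le> r + 1" for t x
    using M'[of "(t, x)"] eta(1)[of t x] that t0 by (auto simp: Y_def \<eta>_def)
  have eta_norm: "norm (\<eta> (t, z t)) \<le> M'" if "t \<in> {t0..T}" for t
    using M'[of "(t, z t)"] r[OF that] that by auto
  have rhs_F: "rhs t (z t) = F t (z t) (\<eta> (t, z t))" if "t \<in> {t0..T}" for t
    using zX[OF that] by (simp add: rhs_eq F_def \<eta>_def X_def)
  have dz: "(z has_vector_derivative F t (z t) (\<eta> (t, z t))) (at t within {t0..T})" if "t \<in> {t0..T}" for t
    using z(1) that rhs_F by (simp add: ode_solution_on_def)
  have z_lip: "norm (z t - z s) \<le> max K 0 * dist t s" if "t \<in> {t0..T}" "s \<in> {t0..T}" for t s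
  proof -
    have "norm (z t - z s) \<le> max K 0 * norm (t - s)"
    proof (rule differentiable_bound[OF _ _ _ that, where f' = "\<lambda>t h. h *\<^sub>R F t (z t) (\<eta> (t, z t))"])
      fix x assume x: "x \<in> {t0..T}"
      show "(z has_derivative (\<lambda>h. h *\<^sub>R F x (z x) (\<eta> (x, z x)))) (at x within {t0..T})"
        using dz[OF x] by (simp add: has_vector_derivative_def)
      have "norm (F x (z x) (\<eta> (x, z x))) \<le> max K 0"
        by (rule K'[OF x]) (use r[OF x] eta_norm[OF x] in auto)
      then show "onorm (\<lambda>h. h *\<^sub>R F x (z x) (\<eta> (x, z x))) \<le> max K 0"
        by (intro onorm_le) (simp add: mult.commute mult_left_mono)
    qed simp
    then show ?thesis by (simp add: dist_norm)
  qed
  define Lg where "Lg = (K1 * Lf + K2) * (1 + max K 0 + L1 * (1 + max K 0))"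
  have Lg: "Lg-lipschitz_on {t0..T} (\<lambda>t. F t (z t) (\<eta> (t, z t)))"
  proof (rule lipschitz_onI)
    fix t s assume ts: "t \<in> {t0..T}" "s \<in> {t0..T}"
    have "dist (t, z t) (s, z s) \<le> dist t s + dist (z t) (z s)" by (rule dist_Pair_le_add)
    also have "\<dots> \<le> dist t s + max K 0 * dist t s" using z_lip[OF ts] by (simp add: dist_norm)
    finally have dd: "dist (t, z t) (s, z s) \<le> (1 + max K 0) * dist t s" by (simp add: algebra_simps)
    have "norm (\<eta> (t, z t) - \<eta> (s, z s)) \<le> L1 * dist (t, z t) (s, z s)"
      unfolding dist_norm[of "\<eta> _", symmetric]
      by (rule lipschitz_onD[OF L1]) (use ts r[OF ts(1)] r[OF ts(2)] in auto)
    also have "\<dots> \<le> L1 * ((1 + max K 0) * dist t s)" by (rule mult_left_mono[OF dd L1n])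
    finally have e: "norm (\<eta> (t, z t) - \<eta> (s, z s)) \<le> L1 * ((1 + max K 0) * dist t s)" .
    have "norm (F t (z t) (\<eta> (t, z t)) - F s (z s) (\<eta> (s, z s)))
        \<le> (K1 * Lf + K2) * (dist t s + norm (z t - z s) + norm (\<eta> (t, z t) - \<eta> (s, z s)))"
      by (rule F_lip[OF ts]) (use r[OF ts(1)] r[OF ts(2)] eta_norm[OF ts(1)] eta_norm[OF ts(2)] in auto)
    also have "\<dots> \<le> (K1 * Lf + K2) * (dist t s + max K 0 * dist t s + L1 * ((1 + max K 0) * dist t s))"
      using K1 K2 Lfn by (intro mult_left_mono add_mono order_refl z_lip[OF ts] e) auto
    finally show "dist (F t (z t) (\<eta> (t, z t))) (F s (z s) (\<eta> (s, z s))) \<le> Lg * dist t s"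
      by (simp add: Lg_def dist_norm algebra_simps)
  next
    show "Lg \<ge> 0" using K1 K2 Lfn L1n by (simp add: Lg_def)
  qed
  have "\<exists>\<delta>>0. \<forall>t\<in>{t0..T}. \<forall>z u. P1 *v z = z \<longrightarrow> z \<in> cball 0 (r + 1) \<longrightarrow> P2 *v u = u \<longrightarrow>
    norm (u - eta t z) \<le> \<delta> \<longrightarrow> norm (newton t z u - eta t z) \<le> 1 / 2 * norm (u - eta t z)"
  proof (rule newton_halves_error[OF t0(1) nd])
    show "norm (eta t z) \<le> M'" if "t \<in> {t0..T}" "z \<in> cball 0 (r + 1)" for t z
      using M'[of "(t, z)"] that by (simp add: \<eta>_def)
  qed
  then obtain \<delta> where \<delta>: "\<delta> > 0"
    and halves: "\<And>t z u. t \<in> {t0..T} \<Longrightarrow> P1 *v z = z \<Longrightarrow> z \<in> cball 0 (r + 1) \<Longrightarrow> P2 *v u = u \<Longrightarrow>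
    norm (u - eta t z) \<le> \<delta> \<Longrightarrow> norm (newton t z u - eta t z) \<le> 1 / 2 * norm (u - eta t z)"
    by blast
  show ?thesis
  proof (rule euler_newton_converges[where z = z and \<eta> = \<eta> and F = F and N = newton and X = X and Y = Y
        and M = r and M' = M' and \<delta> = \<delta> and ?L2.0 = "K1 * Lf + K2" and K = "max K 0" and K' = Lg and ?L1.0 = L1, OF t0(2)])
    show "z t \<in> X \<inter> cball 0 r" if "t \<in> {t0..T}" for t using zX[OF that] r[OF that] by auto
    show "\<eta> (t, x) \<in> Y \<inter> cball 0 M'" if "t \<in> {t0..T}" "x \<in> X \<inter> cball 0 (r + 1)" for t x
      using eta_in[of t x] that by auto
    show "L1-lipschitz_on ({t0..T} \<times> (X \<inter> cball 0 (r + 1))) \<eta>"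
      by (rule lipschitz_on_subset[OF L1]) auto
    show "norm (F t x u - F t x' u') \<le> (K1 * Lf + K2) * (norm (x - x') + norm (u - u'))"
      if "t \<in> {t0..T}" "x \<in> X \<inter> cball 0 (r + 1)" "x' \<in> X \<inter> cball 0 (r + 1)"
        "u \<in> Y \<inter> cball 0 (M' + 1)" "u' \<in> Y \<inter> cball 0 (M' + 1)" for t x x' u u'
      using F_lip[of t t x x' u u'] that by auto
    show "norm (F t x u) \<le> max K 0"
      if "t \<in> {t0..T}" "x \<in> X \<inter> cball 0 (r + 1)" "u \<in> Y \<inter> cball 0 (M' + 1)" for t x u
      using K'[of t x u] that by auto
    show "norm (z (t + h) - z t - h *\<^sub>R F t (z t) (\<eta> (t, z t))) \<le> Lg * h\<^sup>2"
      if "0 \<le> h" "t \<in> {t0..T}" "t + h \<in> {t0..T}" for t h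
      by (rule euler_local_error[OF dz Lg that])
    show "norm (newton t x u - \<eta> (t, x)) \<le> 1 / 2 * norm (u - \<eta> (t, x))"
      if "t \<in> {t0..T}" "x \<in> X \<inter> cball 0 (r + 1)" "u \<in> Y" "norm (u - \<eta> (t, x)) \<le> \<delta>" for t x u
      using halves[of t x u] that by (auto simp: X_def Y_def \<eta>_def)
    show "x + h *\<^sub>R F t x u \<in> X" if "x \<in> X" "u \<in> Y" for t h x u
    proof -
      have x: "P1 *v x = x" using that by (simp add: X_def)
      have "P1 *v F t x u = F t x u"
        using M_apply[of x] by (simp add: F_def matrix_vector_mult_diff_distrib x)
      then show ?thesis using x by (simp add: X_def matrix_vector_right_distrib matrix_vector_mult_scaleR)
    qed
    show "newton t x u \<in> Y" if "t \<in> {t0..T}" "x \<in> X" "u \<in> Y" for t x u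
      using newton_in_range[OF nd[of t x u]] that by (simp add: X_def Y_def)
    show "0 \<le> K1 * Lf + K2" "0 \<le> max K 0" "0 \<le> Lg" "\<delta> > 0"
      using K1 K2 Lfn Lg \<delta> by (auto simp: lipschitz_on_def)
  next
    fix C h0 :: real
    assume "C \<ge> 0" "h0 > 0"
      "\<And>h zs us n i. 0 < h \<Longrightarrow> h \<le> h0 \<Longrightarrow> t0 + real n * h \<le> T \<Longrightarrow> zs 0 = z t0 \<Longrightarrow> us 0 = \<eta> (t0, z t0) \<Longrightarrow>
       (\<And>i. i < n \<Longrightarrow> zs (Suc i) = zs i + h *\<^sub>R F (t0 + real i * h) (zs i) (us i)) \<Longrightarrow>
       (\<And>i. i < n \<Longrightarrow> us (Suc i) = newton (t0 + real (Suc i) * h) (zs (Suc i)) (us i)) \<Longrightarrow> i \<le> n \<Longrightarrow>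
       norm (zs i - z (t0 + real i * h)) \<le> C * h \<and>
       norm (us i - \<eta> (t0 + real i * h, z (t0 + real i * h))) \<le> C * h"
    note conclusion = this(3)[unfolded F_def \<eta>_def fst_conv snd_conv]
    have bound: "norm (zs i - z (t0 + real i * h)) \<le> C * h \<and>
       norm (us i - eta (t0 + real i * h) (z (t0 + real i * h))) \<le> C * h"
      if "0 < h" "h \<le> h0" "t0 + real n * h \<le> T" "zs 0 = z t0" "us 0 = eta t0 (z t0)"
        "\<forall>i<n. zs (Suc i) = zs i + h *\<^sub>R (N1 *v f (t0 + real i * h) (zs i + us i) - M *v zs i)"
        "\<forall>i<n. us (Suc i) = newton (t0 + real (Suc i) * h) (zs (Suc i)) (us i)" "i \<le> n" for h zs us n i
      by (rule conclusion[OF that(1-5) that(6)[rule_format] that(7)[rule_format] that(8)])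
    show ?thesis
      by (rule exI[of _ C], rule conjI[OF \<open>C \<ge> 0\<close>], rule exI[of _ h0], rule conjI[OF \<open>h0 > 0\<close>],
          intro allI impI, rule bound; assumption)
  qed
qed

end

section \<open>The differential-algebraic problem and basis invertibility\<close>

lemma at_within_atLeast_neq_bot:
  fixes t a :: real
  assumes "t \<ge> a"
  shows "at t within {a..} \<noteq> bot"
proof -
  have "t islimpt {t<..<t+1}" by (rule islimpt_greaterThanLessThan1) simp
  then have "t islimpt {a..}" by (rule islimpt_subset) (use assms in auto)
  then show ?thesis by (simp add: trivial_limit_within)
qed

context index1_dae
begin

context
  fixes A B Gi :: "real^'n^'n"
  assumes GiA: "Gi ** A = P1" and Gi_inj: "\<And>x. Gi *v x = 0 \<Longrightarrow> x = 0"
    and GiN: "N1 + N2 = Gi" and GiB: "M = Gi ** B" and MP2: "M ** P2 = P2"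
begin

lemma Gi_apply_A: "Gi *v (A *v x) = P1 *v x"
  by (simp add: matrix_vector_mul_assoc GiA)

lemma Gi_apply_B: "Gi *v (B *v x) = M *v (P1 *v x) + P2 *v x"
proof -
  have "Gi *v (B *v x) = M *v (P1 *v x + P2 *v x)"
    by (simp add: matrix_vector_mul_assoc GiB P_apply_sum)
  also have "M *v (P2 *v x) = P2 *v x"
    by (simp add: matrix_vector_mul_assoc MP2)
  then have "M *v (P1 *v x + P2 *v x) = M *v (P1 *v x) + P2 *v x"
    by (simp add: matrix_vector_right_distrib)
  finally show ?thesis .
qed

lemma Gi_apply_sum: "Gi *v x = N1 *v x + N2 *v x"
  by (simp add: matrix_vector_mult_add_rdistrib flip: GiN)

lemma A_apply_P2: "P1 *v x = 0 \<Longrightarrow> A *v x = 0"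
  by (rule Gi_inj) (simp add: Gi_apply_A)

lemma ode_solution_gives_dae_solution:
  assumes t0: "t0 \<ge> 0" and z: "ode_solution_on rhs {t0..} z" and zP: "\<And>t. t \<ge> t0 \<Longrightarrow> P1 *v z t = z t"
  shows "ivp_solution_on {t0..} A B f t0 (z t0 + eta t0 (z t0)) (\<lambda>t. z t + eta t (z t))"
proof -
  have cz: "continuous_on {t0..} z" by (rule ode_solution_on_imp_continuous_on[OF z])
  have Ax: "A *v (z t + eta t (z t)) = A *v z t" if "t \<in> {t0..}" for t
    using A_apply_P2[of "eta t (z t)"] eta(2)[of t "z t"] that t0 by (simp add: matrix_vector_right_distrib)
  have dA: "((\<lambda>t. A *v (z t + eta t (z t))) has_vector_derivative A *v rhs t (z t)) (at t within {t0..})"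
    if t: "t \<in> {t0..}" for t
  proof -
    have "((\<lambda>t. A *v z t) has_vector_derivative A *v rhs t (z t)) (at t within {t0..})"
      using bounded_linear.has_vector_derivative[OF matrix_vector_mul_bounded_linear] z t
      unfolding ode_solution_on_def by blast
    then show ?thesis
      by (rule has_vector_derivative_transform[rotated 2]) (use t Ax in auto)
  qed
  have "continuous_on {t0..} (\<lambda>t. blinfun_scaleR_left (A *v rhs t (z t)))"
    by (intro bounded_linear.continuous_on[OF bounded_linear_blinfun_scaleR_left] continuous_intros rhs_continuous_on cz)
      (use t0 in auto)
  then have "C1_on {t0..} (\<lambda>t. A *v (z t + eta t (z t)))"
    unfolding C1_on_def using dA
    by (intro exI[of _ "\<lambda>t. blinfun_scaleR_left (A *v rhs t (z t))"]) (auto simp: has_vector_derivative_def)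
  moreover have "continuous_on {t0..} (\<lambda>t. z t + eta t (z t))"
    by (intro continuous_intros cz) (use t0 in auto)
  moreover have "vector_derivative (\<lambda>s. A *v (z s + eta s (z s))) (at t within {t0..}) + B *v (z t + eta t (z t))
      = f t (z t + eta t (z t))" if t: "t \<in> {t0..}" for t
  proof -
    have t': "t \<ge> 0" "t \<ge> t0" using t t0 by auto
    let ?x = "z t + eta t (z t)"
    have P1x: "P1 *v ?x = z t" and P2x: "P2 *v ?x = eta t (z t)"
      using eta[OF t'(1), of "z t"] zP[OF t'(2)] P_complement(1)[of "z t"]
      by (simp_all add: matrix_vector_right_distrib)
    have "vector_derivative (\<lambda>s. A *v (z s + eta s (z s))) (at t within {t0..}) = A *v rhs t (z t)"
      by (rule vector_derivative_within[OF at_within_atLeast_neq_bot[OF t'(2)] dA[OF t]])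
    moreover have "A *v rhs t (z t) + B *v ?x - f t ?x = 0"
    proof (rule Gi_inj)
      have "Gi *v (A *v rhs t (z t) + B *v ?x - f t ?x)
          = rhs t (z t) + (M *v z t + eta t (z t)) - (N1 *v f t ?x + N2 *v f t ?x)"
        by (simp only: matrix_vector_right_distrib[of Gi] matrix_vector_mult_diff_distrib[of Gi] Gi_apply_A
            Gi_apply_B P1x P2x Gi_apply_sum[of "f t ?x"] P1_rhs)
      also have "\<dots> = 0"
        using eta(3)[OF t'(1), of "z t"] by (simp add: rhs_def zP[OF t'(2)])
      finally show "Gi *v (A *v rhs t (z t) + B *v ?x - f t ?x) = 0" .
    qed
    ultimately show ?thesis by simp
  qed
  ultimately show ?thesis by (simp add: ivp_solution_on_def)
qed

text \<open>
  Since \<open>P1 y\<close> takes its values in the range of \<open>P1\<close>, so does its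
  derivative, which is \<open>Gi (f - B y)\<close>. Hence \<open>P2 (Gi (f - B y)) = 0\<close>, and
  this is the algebraic equation for \<open>P2 y\<close>.
\<close>

lemma dae_solution_gives_ode_solution:
  assumes t0: "t0 \<ge> 0" and y: "ivp_solution_on {t0..} A B f t0 x0 y"
  shows "ode_solution_on rhs {t0..} (\<lambda>t. P1 *v y t)"
    and "\<And>t. t \<ge> t0 \<Longrightarrow> P2 *v y t = eta t (P1 *v y t)"
proof -
  have both: "((\<lambda>t. P1 *v y t) has_vector_derivative rhs t (P1 *v y t)) (at t within {t0..}) \<and>
      P2 *v y t = eta t (P1 *v y t)" if t: "t \<in> {t0..}" for t
  proof -
    have t': "t \<ge> 0" "t \<ge> t0" using t t0 by auto
    let ?D = "vector_derivative (\<lambda>s. A *v y s) (at t within {t0..})"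
    obtain g' :: "real \<Rightarrow> real \<Rightarrow>\<^sub>L (real^'n)" where
      "((\<lambda>s. A *v y s) has_derivative g' t) (at t within {t0..})"
      using y t unfolding ivp_solution_on_def C1_on_def by blast
    then have "(\<lambda>s. A *v y s) differentiable (at t within {t0..})" by (rule differentiableI)
    then have "((\<lambda>s. A *v y s) has_vector_derivative ?D) (at t within {t0..})"
      by (simp add: vector_derivative_works)
    then have "((\<lambda>s. Gi *v (A *v y s)) has_vector_derivative Gi *v ?D) (at t within {t0..})"
      by (rule bounded_linear.has_vector_derivative[OF matrix_vector_mul_bounded_linear])
    then have d1: "((\<lambda>s. P1 *v y s) has_vector_derivative Gi *v ?D) (at t within {t0..})"
      by (simp only: Gi_apply_A)
    have "((\<lambda>s. P2 *v (P1 *v y s)) has_vector_derivative P2 *v (Gi *v ?D)) (at t within {t0..})"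
      by (rule bounded_linear.has_vector_derivative[OF matrix_vector_mul_bounded_linear d1])
    then have "((\<lambda>s. 0) has_vector_derivative P2 *v (Gi *v ?D)) (at t within {t0..})" by simp
    then have P2D: "P2 *v (Gi *v ?D) = 0"
      by (rule vector_derivative_unique_within[OF at_within_atLeast_neq_bot[OF t'(2)] _ has_vector_derivative_const])
    have "?D = f t (y t) - B *v y t" using y t by (simp add: ivp_solution_on_def eq_diff_eq)
    then have GD: "Gi *v ?D = N1 *v f t (y t) + N2 *v f t (y t) - (M *v (P1 *v y t) + P2 *v y t)"
      by (simp only: matrix_vector_mult_diff_distrib[of Gi] Gi_apply_sum[of "f t (y t)"] Gi_apply_B)
    have [simp]: "P2 *v (N1 *v x) = 0" "P2 *v (M *v (P1 *v x)) = 0" for x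
      using P_complement(1) N_apply(1) M_apply by blast+
    have P2y: "N2 *v f t (y t) = P2 *v y t"
      using P2D unfolding GD by (simp add: matrix_vector_mult_diff_distrib matrix_vector_right_distrib)
    have eta: "P2 *v y t = eta t (P1 *v y t)"
      by (rule eta_unique[OF t'(1)]) (simp add: P_apply_sum P2y)
    have "rhs t (P1 *v y t) = N1 *v f t (y t) - M *v (P1 *v y t)"
      by (simp add: rhs_def P_apply_sum flip: eta)
    then have "Gi *v ?D = rhs t (P1 *v y t)" unfolding GD P2y by simp
    then show ?thesis using d1 eta by simp
  qed
  show "ode_solution_on rhs {t0..} (\<lambda>t. P1 *v y t)" using both by (simp add: ode_solution_on_def)
  show "P2 *v y t = eta t (P1 *v y t)" if "t \<ge> t0" for t using both that by simp
qed

end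

end

lemma matrix_vector_mult_sum_left:
  "(\<Sum>k\<in>S. F k) *v v = (\<Sum>k\<in>S. F k *v (v :: real^'n))"
  by (induction S rule: infinite_finite_induct) (auto simp: matrix_vector_mult_add_rdistrib)

lemma subset_span_singleton:
  fixes S :: "(real^'n) set"
  assumes "dim S = 1"
  obtains e where "S \<subseteq> span {e}"
proof -
  obtain b where b: "S \<subseteq> span b" "card b = dim S" by (rule basis_exists[of S])
  then obtain e where "b = {e}" using assms card_1_singletonE by metis
  then show thesis using b(1) that by blast
qed

lemma invertible_op_imp_injective:
  assumes "invertible_op W Z L" "v \<in> W" "L *v v = 0"
  shows "v = 0"
proof -
  obtain L' where "\<forall>w\<in>W. L' *v (L *v w) = w"
    using assms(1) unfolding invertible_op_def by blast
  then have "L' *v (L *v v) = v" using assms(2) by blast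
  then show ?thesis using assms(3) by simp
qed

text \<open>
  The mean value theorem fails for vector-valued maps, but it holds in each component of an additive
  resolution of the identity, at a point \<open>w k\<close> of the segment that depends on the
  component \<open>k\<close>. Basis invertibility is made for exactly this choice of points.
\<close>

lemma basis_invertible_imp_injective:
  fixes g :: "real^'a \<Rightarrow> real^'b" and Dg \<Phi> :: "real^'a \<Rightarrow> real^'a^'b"
  assumes inv: "basis_invertible W Z \<Phi> a b"
    and deriv: "\<And>w. (g has_derivative (*v) (Dg w)) (at w)"
    and \<Phi>: "\<And>w v. v \<in> W \<Longrightarrow> \<Phi> w *v v = Dg w *v v"
    and in_Z: "\<And>w v. v \<in> W \<Longrightarrow> Dg w *v v \<in> Z"
    and ab: "a - b \<in> W" and eq: "g a = g b"
  shows "a = b"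
proof -
  obtain \<Theta> where res: "additive_resolution Z \<Theta>" and
    inv': "\<And>w. (\<forall>k\<in>{1..dim Z}. w k \<in> closed_segment a b) \<Longrightarrow> invertible_op W Z (\<Sum>k=1..dim Z. \<Theta> k ** \<Phi> (w k))"
    using inv unfolding basis_invertible_def by blast
  define v where "v = a - b"
  have "\<exists>w. w \<in> closed_segment a b \<and> \<Theta> k *v (Dg w *v v) = 0" if k: "k \<in> {1..dim Z}" for k
  proof -
    have "dim ((*v) (\<Theta> k) ` Z) = 1" using res k by (simp add: additive_resolution_def)
    then obtain e where e: "(*v) (\<Theta> k) ` Z \<subseteq> span {e}" by (rule subset_span_singleton)
    have dl: "((\<lambda>s. b + s *\<^sub>R v) has_derivative (\<lambda>h. h *\<^sub>R v)) (at s)" for s :: real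
      by (auto intro!: derivative_eq_intros)
    have d: "((\<lambda>s. e \<bullet> (\<Theta> k *v g (b + s *\<^sub>R v))) has_real_derivative
        e \<bullet> (\<Theta> k *v (Dg (b + s *\<^sub>R v) *v v))) (at s)" for s :: real
    proof -
      have "((\<lambda>s. e \<bullet> (\<Theta> k *v g (b + s *\<^sub>R v))) has_derivative
          (\<lambda>h. e \<bullet> (\<Theta> k *v (Dg (b + s *\<^sub>R v) *v (h *\<^sub>R v))))) (at s)"
        by (intro has_derivative_inner_right bounded_linear.has_derivative[OF matrix_vector_mul_bounded_linear]
            has_derivative_compose[OF dl deriv])
      then show ?thesis
        by (rule has_derivative_imp_has_field_derivative) (simp add: matrix_vector_mult_scaleR)
    qed
    obtain s :: real where s: "0 < s" "s < 1"
      "e \<bullet> (\<Theta> k *v g (b + 1 *\<^sub>R v)) - e \<bullet> (\<Theta> k *v g (b + 0 *\<^sub>R v)) =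
        (1 - 0) * (e \<bullet> (\<Theta> k *v (Dg (b + s *\<^sub>R v) *v v)))"
      using MVT2[of 0 1 "\<lambda>s. e \<bullet> (\<Theta> k *v g (b + s *\<^sub>R v))", OF zero_less_one d] by blast
    then have orth: "e \<bullet> (\<Theta> k *v (Dg (b + s *\<^sub>R v) *v v)) = 0" using eq by (simp add: v_def)
    have "\<Theta> k *v (Dg (b + s *\<^sub>R v) *v v) \<in> span {e}"
      using e in_Z[OF ab] unfolding v_def by blast
    then obtain c where c: "\<Theta> k *v (Dg (b + s *\<^sub>R v) *v v) = c *\<^sub>R e"
      by (auto simp: span_singleton)
    then have "\<Theta> k *v (Dg (b + s *\<^sub>R v) *v v) = 0" using orth by auto
    moreover have "b + s *\<^sub>R v \<in> closed_segment a b"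
      using s(1,2) unfolding v_def closed_segment_commute[of a b]
      by (auto simp: in_segment algebra_simps intro!: exI[of _ s])
    ultimately show ?thesis by blast
  qed
  then obtain w where w: "\<And>k. k \<in> {1..dim Z} \<Longrightarrow> w k \<in> closed_segment a b"
    "\<And>k. k \<in> {1..dim Z} \<Longrightarrow> \<Theta> k *v (Dg (w k) *v v) = 0"
    by metis
  have "(\<Sum>k=1..dim Z. \<Theta> k ** \<Phi> (w k)) *v v = (\<Sum>k=1..dim Z. \<Theta> k *v (\<Phi> (w k) *v v))"
    by (simp add: matrix_vector_mult_sum_left matrix_vector_mul_assoc)
  also have "\<dots> = 0"
    using w(2) \<Phi>[OF ab] by (intro sum.neutral) (simp add: v_def)
  finally have "(\<Sum>k=1..dim Z. \<Theta> k ** \<Phi> (w k)) *v v = 0" .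
  moreover have "invertible_op W Z (\<Sum>k=1..dim Z. \<Theta> k ** \<Phi> (w k))" using inv' w(1) by blast
  ultimately have "v = 0" using invertible_op_imp_injective ab unfolding v_def by blast
  then show ?thesis by (simp add: v_def)
qed

lemma basis_invertible_imp_injective_at:
  assumes inv: "basis_invertible W Z \<Phi> a a" and v: "v \<in> W" "\<Phi> a *v v = 0"
  shows "v = 0"
proof -
  obtain \<Theta> where "\<forall>w. (\<forall>k\<in>{1..dim Z}. w k \<in> closed_segment a a) \<longrightarrow>
      invertible_op W Z (\<Sum>k=1..dim Z. \<Theta> k ** \<Phi> (w k))"
    using inv unfolding basis_invertible_def by blast
  from this[rule_format, of "\<lambda>_. a"]
  have "invertible_op W Z (\<Sum>k=1..dim Z. \<Theta> k ** \<Phi> a)" by simp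
  moreover have "(\<Sum>k=1..dim Z. \<Theta> k ** \<Phi> a) *v v = 0"
    by (simp add: matrix_vector_mult_sum_left v flip: matrix_vector_mul_assoc)
  ultimately show ?thesis using invertible_op_imp_injective v(1) by blast
qed

lemma integral_inverse_diverges:
  fixes c :: real
  assumes c: "c > 0"
  shows "filterlim (\<lambda>b. integral {c..b} (\<lambda>v. 1 / v)) at_top at_top"
proof -
  have "\<forall>\<^sub>F b in at_top. - ln c + ln b = integral {c..b} (\<lambda>v. 1 / v)"
    using eventually_ge_at_top[of c]
  proof eventually_elim
    case (elim b)
    have "((\<lambda>v. 1 / v) has_integral ln b - ln c) {c..b}"
      by (rule fundamental_theorem_of_calculus[OF elim])
        (use c in \<open>auto intro!: derivative_eq_intros simp flip: has_real_derivative_iff_has_vector_derivative\<close>)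
    then show ?case by (simp add: integral_unique)
  qed
  moreover have "filterlim (\<lambda>b::real. - ln c + ln b) at_top at_top"
    by (rule filterlim_tendsto_add_at_top[OF tendsto_const ln_at_top])
  ultimately show ?thesis by (rule iffD1[OF filterlim_cong[OF refl refl]])
qed

section \<open>From the pencil to the reduced system\<close>

lemma jacobian_matrix_mult:
  fixes g :: "real^'a \<Rightarrow> real^'b"
  assumes "g differentiable (at x)"
  shows "jacobian (\<lambda>x. Q *v g x) (at x) = Q ** jacobian g (at x)"
proof -
  have "(g has_derivative (*v) (jacobian g (at x))) (at x)"
    by (rule iffD1[OF jacobian_works assms])
  then have "((\<lambda>x. Q *v g x) has_derivative (\<lambda>h. Q *v (jacobian g (at x) *v h))) (at x)"
    by (rule bounded_linear.has_derivative[OF matrix_vector_mul_bounded_linear])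
  then have "((\<lambda>x. Q *v g x) has_derivative (*v) (Q ** jacobian g (at x))) (at x)"
    by (simp add: matrix_vector_mul_assoc)
  then have "frechet_derivative (\<lambda>x. Q *v g x) (at x) = (*v) (Q ** jacobian g (at x))"
    by (rule frechet_derivative_at[symmetric])
  then show ?thesis by (simp only: jacobian_def[of "\<lambda>x. Q *v g x"] matrix_of_matrix_vector_mul)
qed

text \<open>
  The consequences of the spectral decomposition on which the reduction rests; the contour integrals
  are not needed beyond this point.
\<close>

locale pencil_splitting =
  fixes A B P1 P2 Q1 Q2 G :: "real^'n^'n"
  assumes P_sum: "P1 + P2 = mat 1" and Q_sum: "Q1 + Q2 = mat 1"
    and P12: "P1 ** P2 = 0" and P21: "P2 ** P1 = 0" and Q22: "Q2 ** Q2 = Q2"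
    and AP2: "A ** P2 = 0" and Q2B: "Q2 ** B = B ** P2"
    and G: "invertible G" and GiA: "matrix_inv G ** A = P1"
    and GiBP2: "matrix_inv G ** B ** P2 = P2" and GiQ1: "matrix_inv G ** Q1 = P1 ** matrix_inv G"
begin

lemma G_inverse [simp]: "G *v (matrix_inv G *v x) = x" "matrix_inv G *v (G *v x) = x"
  by (simp_all add: matrix_vector_mul_assoc matrix_inv_inverse[OF G])

lemma G_eq_B_on_range_P2:
  assumes "P2 *v u = u"
  shows "B *v u = G *v u"
proof -
  have "matrix_inv G *v (B *v u) = (matrix_inv G ** B ** P2) *v u"
    by (simp add: assms flip: matrix_vector_mul_assoc)
  also have "\<dots> = u" by (simp add: GiBP2 assms)
  finally have "G *v (matrix_inv G *v (B *v u)) = G *v u" by simp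
  then show ?thesis by (simp only: G_inverse(1))
qed

lemma Q2B_apply: "Q2 *v (B *v x) = B *v (P2 *v x)"
  by (simp add: matrix_vector_mul_assoc Q2B)

lemma Q2_B_apply_range_P2: "P2 *v u = u \<Longrightarrow> Q2 *v (B *v u) = B *v u"
  by (simp add: Q2B_apply)

lemma P2_apply_range_P1: "P1 *v z = z \<Longrightarrow> P2 *v z = 0"
  using matrix_vector_mul_assoc[of P2 P1 z] by (simp add: P21)

text \<open>
  This is where the description of the manifold \<open>L0\<close> becomes the fixed point form of
  the algebraic equation: on the two ranges \<open>Q2 B (z + u) = B u = G u\<close>.
\<close>

lemma constraint_iff_fixed_point:
  assumes "P1 *v z = z" "P2 *v u = u"
  shows "Q2 *v (B *v (z + u) - y) = 0 \<longleftrightarrow> u = (matrix_inv G ** Q2) *v y"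
proof -
  have "Q2 *v (B *v (z + u)) = B *v u"
    by (simp add: Q2B_apply matrix_vector_right_distrib[of P2] P2_apply_range_P1[OF assms(1)] assms(2))
  then have "Q2 *v (B *v (z + u) - y) = G *v u - Q2 *v y"
    by (simp add: matrix_vector_mult_diff_distrib[of Q2] G_eq_B_on_range_P2[OF assms(2)])
  moreover have "G *v u = Q2 *v y \<longleftrightarrow> u = matrix_inv G *v (Q2 *v y)"
  proof
    assume "G *v u = Q2 *v y"
    from this[symmetric] show "u = matrix_inv G *v (Q2 *v y)" by simp
  next
    assume "u = matrix_inv G *v (Q2 *v y)"
    then show "G *v u = Q2 *v y" by simp
  qed
  ultimately show ?thesis by (simp add: matrix_vector_mul_assoc)
qed

lemma linearized_constraint:
  assumes "P2 *v v = v" "v = (matrix_inv G ** Q2) *v (J *v v)"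
  shows "((Q2 ** J - B) ** P2) *v v = 0"
proof -
  have "G *v v = Q2 *v (J *v v)"
    using arg_cong[OF assms(2), of "(*v) G"]
    by (simp only: matrix_vector_mul_assoc[of "matrix_inv G", symmetric] G_inverse(1))
  then show ?thesis
    using assms(1) G_eq_B_on_range_P2[OF assms(1)]
    by (simp add: matrix_vector_mult_diff_rdistrib flip: matrix_vector_mul_assoc)
qed

lemma P1_idem: "P1 ** P1 = P1" and P2_idem: "P2 ** P2 = P2"
proof -
  have P2: "P2 = mat 1 - P1" by (simp flip: P_sum)
  show 1: "P1 ** P1 = P1" using P12 by (simp add: P2 matrix_diff_ldistrib)
  show "P2 ** P2 = P2" using P12 by (simp add: P2 matrix_diff_rdistrib)
qed

lemma range_P: "x \<in> range ((*v) P1) \<longleftrightarrow> P1 *v x = x" "x \<in> range ((*v) P2) \<longleftrightarrow> P2 *v x = x"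
  "x \<in> range ((*v) Q2) \<longleftrightarrow> Q2 *v x = x"
proof -
  have *: "x \<in> range ((*v) P) \<longleftrightarrow> P *v x = x" if "P ** P = P" for P :: "real^'n^'n" and x :: "real^'n"
  proof
    assume "x \<in> range ((*v) P)"
    then obtain y where "x = P *v y" by blast
    then show "P *v x = x" by (simp add: matrix_vector_mul_assoc that)
  next
    assume "P *v x = x"
    then show "x \<in> range ((*v) P)" using rangeI[of "(*v) P" x] by simp
  qed
  show "x \<in> range ((*v) P1) \<longleftrightarrow> P1 *v x = x" "x \<in> range ((*v) P2) \<longleftrightarrow> P2 *v x = x"
    "x \<in> range ((*v) Q2) \<longleftrightarrow> Q2 *v x = x"
    using * P1_idem P2_idem Q22 by blast+
qed

lemma reduced_system_is_index1_dae:
  assumes f: "continuous_with_x_derivative f"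
    and solvable: "\<And>t z. t \<ge> 0 \<Longrightarrow> P1 *v z = z \<Longrightarrow> \<exists>u. P2 *v u = u \<and> Q2 *v (B *v (z + u) - f t (z + u)) = 0"
    and basis_inv: "\<And>t z a b. t \<ge> 0 \<Longrightarrow> P1 *v z = z \<Longrightarrow> P2 *v a = a \<Longrightarrow> P2 *v b = b \<Longrightarrow>
       Q2 *v (B *v (z + a) - f t (z + a)) = 0 \<Longrightarrow> Q2 *v (B *v (z + b) - f t (z + b)) = 0 \<Longrightarrow>
       basis_invertible (range ((*v) P2)) (range ((*v) Q2))
         (\<lambda>w. (jacobian (\<lambda>x. Q2 *v f t x) (at (z + w)) - B) ** P2) a b"
  shows "index1_dae P1 P2 (matrix_inv G ** Q1) (matrix_inv G ** Q2) (matrix_inv G ** B) f"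
proof
  let ?Gi = "matrix_inv G"
  show "P1 + P2 = mat 1" "P1 ** P2 = 0" "P2 ** P1 = 0" by (rule P_sum P12 P21)+
  have Q2: "Q2 = mat 1 - Q1" by (simp flip: Q_sum)
  have P2: "P2 = mat 1 - P1" by (simp flip: P_sum)
  show "P1 ** (?Gi ** Q1) = ?Gi ** Q1" by (simp add: GiQ1 matrix_mul_assoc P1_idem)
  have N2: "?Gi ** Q2 = P2 ** ?Gi" by (simp add: Q2 P2 matrix_diff_ldistrib matrix_diff_rdistrib GiQ1)
  then show "P2 ** (?Gi ** Q2) = ?Gi ** Q2" by (simp add: matrix_mul_assoc P2_idem)
  have "Q1 ** B = B ** P1"
    using Q2B by (simp add: Q2 P2 matrix_diff_ldistrib matrix_diff_rdistrib)
  moreover have "P1 ** (?Gi ** B) = ?Gi ** (Q1 ** B)" by (simp add: matrix_mul_assoc GiQ1)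
  ultimately have "P1 ** (?Gi ** B) ** P1 = ?Gi ** (B ** (P1 ** P1))"
    by (simp only: matrix_mul_assoc)
  then show "P1 ** (?Gi ** B) ** P1 = ?Gi ** B ** P1"
    by (simp only: P1_idem matrix_mul_assoc)
  show "continuous_with_x_derivative f" by (rule f)
  fix t :: real and z assume t: "t \<ge> 0" and "z \<in> range ((*v) P1)"
  then have z: "P1 *v z = z" by (simp add: range_P)
  show "\<exists>u\<in>range ((*v) P2). u = (?Gi ** Q2) *v f t (z + u)"
  proof -
    obtain u where u: "P2 *v u = u" "Q2 *v (B *v (z + u) - f t (z + u)) = 0"
      using solvable[OF t z] by blast
    show ?thesis
      by (rule bexI[of _ u]) (rule iffD1[OF constraint_iff_fixed_point[OF z u(1)] u(2)], rule iffD2[OF range_P(2) u(1)])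
  qed
  have der: "(f t has_derivative (*v) (jacobian (f t) (at x))) (at x)" for x
    using f t jacobian_works by (auto simp: continuous_with_x_derivative_def)
  have jac: "jacobian (\<lambda>x. Q2 *v f t x) (at x) = Q2 ** jacobian (f t) (at x)" for x
    using der by (intro jacobian_matrix_mult differentiableI)
  have bi: "basis_invertible (range ((*v) P2)) (range ((*v) Q2))
      (\<lambda>w. (Q2 ** jacobian (f t) (at (z + w)) - B) ** P2) a b"
    if "P2 *v a = a" "P2 *v b = b" "a = (?Gi ** Q2) *v f t (z + a)" "b = (?Gi ** Q2) *v f t (z + b)" for a b
    by (rule basis_inv[OF t z that(1,2) iffD2[OF constraint_iff_fixed_point[OF z that(1)] that(3)]
          iffD2[OF constraint_iff_fixed_point[OF z that(2)] that(4)], unfolded jac])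
  show "u = u'" if "u \<in> range ((*v) P2)" "u = (?Gi ** Q2) *v f t (z + u)"
    "u' \<in> range ((*v) P2)" "u' = (?Gi ** Q2) *v f t (z + u')" for u u'
  proof -
    have u: "P2 *v u = u" and u': "P2 *v u' = u'" using that by (simp_all add: range_P)
    define g where "g w = Q2 *v (f t (z + w) - B *v w)" for w
    define Dg where "Dg w = Q2 ** (jacobian (f t) (at (z + w)) - B)" for w
    (* g is the negative of the constraint, because Q2 B z = 0 for z in the range of P1. *)
    have G_u: "g w = 0" if "P2 *v w = w" "w = (?Gi ** Q2) *v f t (z + w)" for w
    proof -
      have "Q2 *v (B *v (z + w) - f t (z + w)) = 0"
        by (rule iffD2[OF constraint_iff_fixed_point[OF z that(1)] that(2)])
      moreover have "Q2 *v (B *v z) = 0" by (simp add: Q2B_apply P2_apply_range_P1[OF z])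
      ultimately show ?thesis
        by (simp add: g_def matrix_vector_mult_diff_distrib matrix_vector_right_distrib)
    qed
    show ?thesis
    proof (rule basis_invertible_imp_injective[OF bi[OF u u' that(2,4)], where g = g and Dg = Dg])
      fix w v
      have "((\<lambda>w. z + w) has_derivative (\<lambda>h. h)) (at w)"
        by (auto intro!: derivative_eq_intros)
      from has_derivative_compose[OF this der]
      have "(g has_derivative (\<lambda>h. Q2 *v (jacobian (f t) (at (z + w)) *v h - B *v h))) (at w)"
        unfolding g_def
        by (intro bounded_linear.has_derivative[OF matrix_vector_mul_bounded_linear] has_derivative_diff has_derivative_ident)
      moreover have "(*v) (Dg w) = (\<lambda>h. Q2 *v (jacobian (f t) (at (z + w)) *v h - B *v h))"
        by (simp add: fun_eq_iff Dg_def matrix_vector_mult_diff_rdistrib flip: matrix_vector_mul_assoc)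
      ultimately show "(g has_derivative (*v) (Dg w)) (at w)" by simp
      show "((Q2 ** jacobian (f t) (at (z + w)) - B) ** P2) *v v = Dg w *v v" if "v \<in> range ((*v) P2)"
      proof -
        have v: "P2 *v v = v" using that by (simp add: range_P)
        show ?thesis using Q2_B_apply_range_P2[OF v]
          by (simp add: v Dg_def matrix_vector_mult_diff_rdistrib matrix_vector_mult_diff_distrib
              flip: matrix_vector_mul_assoc)
      qed
      show "Dg w *v v \<in> range ((*v) Q2)" by (simp add: Dg_def flip: matrix_vector_mul_assoc)
      show "u - u' \<in> range ((*v) P2)" by (simp add: range_P matrix_vector_mult_diff_distrib u u')
      show "g u = g u'" using G_u[OF u that(2)] G_u[OF u' that(4)] by simp
    qed
  qed
  show "v = 0" if "u \<in> range ((*v) P2)" "u = (?Gi ** Q2) *v f t (z + u)" "v \<in> range ((*v) P2)"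
    "v = (?Gi ** Q2) *v (jacobian (f t) (at (z + u)) *v v)" for u v
  proof -
    have u: "P2 *v u = u" and v: "P2 *v v = v" using that by (simp_all add: range_P)
    show ?thesis
      by (rule basis_invertible_imp_injective_at[OF bi[OF u u that(2) that(2)] that(3)])
        (rule linearized_constraint[OF v that(4)])
  qed
qed

end

text \<open>
  The common form of the three growth conditions on the time interval up to \<open>b\<close>: along
  the vector field \<open>w\<close> the function \<open>V = (H z, z) / 2\<close> with
  \<open>z = P x\<close> grows at most like \<open>K U(V)\<close> outside a ball, where
  \<open>U\<close> satisfies Osgood's divergence condition.
\<close>

definition osgood_growth ::
  "(real \<times> (real^'n)) set \<Rightarrow> real^'n^'n \<Rightarrow> real^'n^'n \<Rightarrow> (real \<Rightarrow> real^'n \<Rightarrow> real^'n) \<Rightarrow> real \<Rightarrow> real \<Rightarrow> bool" where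
  "osgood_growth L P H w b R \<longleftrightarrow> (\<exists>K\<ge>0. \<exists>U. continuous_on {0<..} U \<and> (\<forall>v>0. U v > 0) \<and>
     (\<forall>c>0. filterlim (\<lambda>b. integral {c..b} (\<lambda>v. 1 / U v)) at_top at_top) \<and>
     (\<forall>(t, x)\<in>L. t \<le> b \<and> norm (P *v x) \<ge> R \<longrightarrow>
        (H *v (P *v x)) \<bullet> w t x \<le> K * U (((H *v (P *v x)) \<bullet> (P *v x)) / 2)))"

text \<open>
  By coercivity of \<open>H\<close>, a bound by \<open>|z|^2\<close> is a bound by a multiple of
  \<open>V\<close>, so \<open>U(v) = v\<close> is admissible.
\<close>

lemma osgood_growth_of_quadratic_bound:
  assumes H: "self_adjoint_positive (range ((*v) P)) H" and K: "K \<ge> 0"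
    and le: "\<And>t x. (t, x) \<in> L \<Longrightarrow> t \<le> b \<Longrightarrow> norm (P *v x) \<ge> R \<Longrightarrow>
       (H *v (P *v x)) \<bullet> w t x \<le> K * (norm (P *v x))\<^sup>2"
  shows "osgood_growth L P H w b R"
proof -
  have "subspace (range ((*v) P))" by (rule linear_subspace_image) auto
  then obtain m where m: "m > 0" "\<forall>x\<in>range ((*v) P). m * (norm x)\<^sup>2 \<le> (H *v x) \<bullet> x"
    using self_adjoint_positive_coercive[OF _ H] by blast
  have "(H *v (P *v x)) \<bullet> w t x \<le> 2 * K / m * (((H *v (P *v x)) \<bullet> (P *v x)) / 2)"
    if "(t, x) \<in> L" "t \<le> b" "norm (P *v x) \<ge> R" for t x
  proof -
    have "m * (norm (P *v x))\<^sup>2 \<le> (H *v (P *v x)) \<bullet> (P *v x)" using m(2) by blast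
    then have "K * (m * (norm (P *v x))\<^sup>2) \<le> K * ((H *v (P *v x)) \<bullet> (P *v x))"
      by (rule mult_left_mono[OF _ K])
    then have "K * (norm (P *v x))\<^sup>2 \<le> 2 * K / m * (((H *v (P *v x)) \<bullet> (P *v x)) / 2)"
      using m(1) by (simp add: field_simps)
    then show ?thesis using le[OF that] by linarith
  qed
  moreover have "2 * K / m \<ge> 0" using K m by simp
  ultimately show ?thesis
    unfolding osgood_growth_def
    by (intro exI[of _ "2 * K / m"] exI[of _ "\<lambda>v. v"] conjI)
      (auto intro: integral_inverse_diverges continuous_intros)
qed

lemma inner_matrix_vector_bound:
  "\<exists>K>0. \<forall>x y. (H *v x) \<bullet> (N *v y) \<le> K * norm x * norm (y :: real^'n)"
proof -
  obtain K1 where K1: "K1 > 0" "\<And>x. norm (H *v x) \<le> K1 * norm x" using matrix_vector_norm_bound[of H] by blast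
  obtain K2 where K2: "K2 > 0" "\<And>x. norm (N *v x) \<le> K2 * norm x" using matrix_vector_norm_bound[of N] by blast
  have "(H *v x) \<bullet> (N *v y) \<le> K1 * K2 * norm x * norm y" for x y
  proof -
    have "(H *v x) \<bullet> (N *v y) \<le> norm (H *v x) * norm (N *v y)" by (rule norm_cauchy_schwarz)
    also have "\<dots> \<le> (K1 * norm x) * (K2 * norm y)" using K1 K2 by (intro mult_mono) auto
    finally show ?thesis by (simp add: mult_ac)
  qed
  then show ?thesis using mult_pos_pos[OF K1(1) K2(1)] by blast
qed

lemma osgood_growth_dissipative:
  assumes H: "self_adjoint_positive (range ((*v) P)) H"
    and le: "\<And>t x. (t, x) \<in> L \<Longrightarrow> t \<le> b \<Longrightarrow> norm (P *v x) \<ge> R \<Longrightarrow> (H *v (P *v x)) \<bullet> (Gi *v q t x) \<le> 0"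
  shows "osgood_growth L P H (\<lambda>t x. Gi *v (q t x - B *v (P *v x))) b R"
proof -
  obtain K where K: "K > 0" "\<And>x y. (H *v x) \<bullet> ((Gi ** B) *v y) \<le> K * norm x * norm y"
    using inner_matrix_vector_bound[of H "Gi ** B"] by blast
  show ?thesis
  proof (rule osgood_growth_of_quadratic_bound[OF H less_imp_le[OF K(1)]])
    fix t x assume *: "(t, x) \<in> L" "t \<le> b" "norm (P *v x) \<ge> R"
    have "- ((H *v (P *v x)) \<bullet> ((Gi ** B) *v (P *v x))) = (H *v (P *v x)) \<bullet> ((Gi ** B) *v (- (P *v x)))"
      by (simp only: linear_neg[OF matrix_vector_mul_linear] inner_minus_right)
    also have "\<dots> \<le> K * norm (P *v x) * norm (P *v x)"
      using K(2)[of "P *v x" "- (P *v x)"] by simp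
    finally have "- ((H *v (P *v x)) \<bullet> ((Gi ** B) *v (P *v x))) \<le> K * (norm (P *v x))\<^sup>2"
      by (simp add: power2_eq_square)
    moreover have "(H *v (P *v x)) \<bullet> (Gi *v (q t x - B *v (P *v x)))
        = (H *v (P *v x)) \<bullet> (Gi *v q t x) - (H *v (P *v x)) \<bullet> ((Gi ** B) *v (P *v x))"
      by (simp only: matrix_vector_mult_diff_distrib inner_diff_right matrix_vector_mul_assoc[of Gi B])
    ultimately show "(H *v (P *v x)) \<bullet> (Gi *v (q t x - B *v (P *v x))) \<le> K * (norm (P *v x))\<^sup>2"
      using le[OF *] by linarith
  qed
qed

text \<open>
  On a compact time interval the linear part and the bounded part are at most a multiple of
  \<open>|z|\<close> once \<open>|z| \<ge> 1\<close>; hence the radius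
  \<open>max R (max r 1)\<close>.
\<close>

lemma osgood_growth_linear_plus_dissipative:
  fixes L :: "(real \<times> (real^'n)) set" and S1 :: "real \<Rightarrow> real^'n^'n" and \<Xi> :: "real^'n \<Rightarrow> real^'n^'n"
  assumes H: "self_adjoint_positive (range ((*v) P)) H"
    and L: "\<And>t x. (t, x) \<in> L \<Longrightarrow> t \<ge> 0"
    and q: "\<And>t x. t \<ge> 0 \<Longrightarrow> q t x = S1 t *v (P *v x) + \<psi> t x + \<Xi> x *v e t"
    and S1: "continuous_on {0..} S1" and e: "continuous_on {0..} e"
    and \<Xi>: "\<And>x. norm (P *v x) \<ge> r \<Longrightarrow> onorm ((*v) (\<Xi> x)) \<le> C"
    and le: "\<And>t x. (t, x) \<in> L \<Longrightarrow> t \<le> b \<Longrightarrow> norm (P *v x) \<ge> R \<Longrightarrow> (H *v (P *v x)) \<bullet> (Gi *v \<psi> t x) \<le> 0"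
  shows "osgood_growth L P H (\<lambda>t x. Gi *v (q t x - B *v (P *v x))) b (max R (max r 1))"
proof -
  have "bounded ((\<lambda>t. matrix_blinfun (S1 t)) ` {0..b})" "bounded (e ` {0..b})"
    by (intro compact_imp_bounded compact_continuous_image continuous_intros compact_Icc
        continuous_on_subset[OF S1] continuous_on_subset[OF e]; simp)+
  then obtain s E where s: "\<forall>M\<in>(\<lambda>t. matrix_blinfun (S1 t)) ` {0..b}. norm M \<le> s" and E: "\<forall>v\<in>e ` {0..b}. norm v \<le> E"
    unfolding bounded_iff by blast
  obtain K where K: "K > 0" "\<And>x y. (H *v x) \<bullet> (Gi *v y) \<le> K * norm x * norm y"
    using inner_matrix_vector_bound[of H Gi] by blast
  obtain KB where KB: "KB > 0" "\<And>x. norm (B *v x) \<le> KB * norm x"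
    using matrix_vector_norm_bound[of B] by blast
  define c where "c = max s 0 + max C 0 * max E 0 + KB"
  have c: "c \<ge> 0" using KB(1) by (simp add: c_def)
  show ?thesis
  proof (rule osgood_growth_of_quadratic_bound[OF H, where K = "K * c"])
    show "K * c \<ge> 0" using K c by simp
    fix t x assume *: "(t, x) \<in> L" "t \<le> b" "norm (P *v x) \<ge> max R (max r 1)"
    have t: "t \<ge> 0" "t \<in> {0..b}" using L[OF *(1)] *(2) by auto
    define z where "z = P *v x"
    have z: "norm z \<ge> R" "norm z \<ge> r" "norm z \<ge> 1" using *(3) by (auto simp: z_def)
    define y where "y = S1 t *v z + \<Xi> x *v e t - B *v z"
    have "norm y \<le> norm (S1 t *v z) + norm (\<Xi> x *v e t) + norm (B *v z)"
      unfolding y_def by (rule order_trans[OF norm_triangle_ineq4 add_right_mono[OF norm_triangle_ineq]])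
    also have "\<dots> \<le> max s 0 * norm z + max C 0 * max E 0 * norm z + KB * norm z"
    proof (intro add_mono KB(2))
      have "norm (S1 t *v z) \<le> norm (matrix_blinfun (S1 t)) * norm z"
        using norm_blinfun[of "matrix_blinfun (S1 t)" z] by simp
      also have "\<dots> \<le> max s 0 * norm z" using s t(2) by (intro mult_right_mono) (simp_all add: le_max_iff_disj)
      finally show "norm (S1 t *v z) \<le> max s 0 * norm z" .
      have "norm (\<Xi> x *v e t) \<le> onorm ((*v) (\<Xi> x)) * norm (e t)"
        by (rule onorm) simp
      also have "\<dots> \<le> max C 0 * max E 0"
        using \<Xi>[of x] z(2) E t(2) by (intro mult_mono) (auto simp: z_def le_max_iff_disj)
      also have "\<dots> \<le> max C 0 * max E 0 * norm z"
        using mult_left_mono[OF z(3), of "max C 0 * max E 0"] by simp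
      finally show "norm (\<Xi> x *v e t) \<le> max C 0 * max E 0 * norm z" .
    qed
    finally have y: "norm y \<le> c * norm z" by (simp add: c_def distrib_right)
    have "q t x - B *v z = \<psi> t x + y" by (simp add: q[OF t(1)] y_def z_def)
    then have "(H *v z) \<bullet> (Gi *v (q t x - B *v z)) = (H *v z) \<bullet> (Gi *v \<psi> t x) + (H *v z) \<bullet> (Gi *v y)"
      by (simp add: matrix_vector_right_distrib inner_add_right)
    also have "\<dots> \<le> 0 + K * norm z * norm y"
      by (rule add_mono[OF le[OF *(1,2), folded z_def, OF z(1)] K(2)])
    also have "\<dots> \<le> K * norm z * (c * norm z)" using K(1) y by (simp add: mult_left_mono)
    finally show "(H *v (P *v x)) \<bullet> (Gi *v (q t x - B *v (P *v x))) \<le> K * c * (norm (P *v x))\<^sup>2"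
      by (simp add: z_def power2_eq_square mult_ac)
  qed
qed

text \<open>
  On a compact time interval \<open>k\<close> is bounded; its sign does not matter because
  \<open>U\<close> is positive, and the argument of \<open>U\<close> is positive because
  \<open>R > 0\<close>.
\<close>

lemma osgood_growth_time_dependent_factor:
  assumes L: "\<And>t x. (t, x) \<in> L \<Longrightarrow> t \<ge> 0"
    and H: "self_adjoint_positive (range ((*v) P)) H" and R: "R > 0"
    and k: "continuous_on {0..} k" and U: "continuous_on {0<..} U" "\<forall>v>0. U v > 0"
    and div: "\<forall>c>0. filterlim (\<lambda>b. integral {c..b} (\<lambda>v. 1 / U v)) at_top at_top"
    and le: "\<And>t x. (t, x) \<in> L \<Longrightarrow> norm (P *v x) \<ge> R \<Longrightarrow>
       (H *v (P *v x)) \<bullet> w t x \<le> k t * U (((H *v (P *v x)) \<bullet> (P *v x)) / 2)"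
  shows "osgood_growth L P H w b R"
proof -
  have "bounded (k ` {0..b})"
    by (intro compact_imp_bounded compact_continuous_image continuous_on_subset[OF k]) auto
  then obtain K where K: "\<forall>v\<in>k ` {0..b}. norm v \<le> K" unfolding bounded_iff by blast
  have "(H *v (P *v x)) \<bullet> w t x \<le> max K 0 * U (((H *v (P *v x)) \<bullet> (P *v x)) / 2)"
    if tx: "(t, x) \<in> L" "t \<le> b" "norm (P *v x) \<ge> R" for t x
  proof -
    have "P *v x \<noteq> 0" using tx(3) R by auto
    then have "(H *v (P *v x)) \<bullet> (P *v x) > 0"
      using H unfolding self_adjoint_positive_def by blast
    then have "U (((H *v (P *v x)) \<bullet> (P *v x)) / 2) > 0" using U(2) by simp
    moreover have "norm (k t) \<le> K" using K L[OF tx(1)] tx(2) by simp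
    then have "k t \<le> max K 0" by auto
    ultimately show ?thesis
      using le[OF tx(1,3)] by (meson less_imp_le mult_right_mono order_trans)
  qed
  then show ?thesis unfolding osgood_growth_def
    by (intro exI[of _ "max K 0"] exI[of _ U] conjI) (use U div in auto)
qed

section \<open>Global solvability and first-order convergence\<close>

theorem theorem4:
  fixes A B P1 P2 Q1 Q2 G :: "real^'n^'n"
    and X1 X2 Y1 Y2 :: "(real^'n) set"
    and f :: "real \<Rightarrow> real^'n \<Rightarrow> real^'n"
    and L0 :: "(real \<times> (real^'n)) set"
    and C1 C2 t0 T :: real
    and x0 :: "real^'n"
  assumes "regular_pencil A B"
    and "index_le_1_with A B C1 C2"
    and "P1 = spectral_P1 A B C2" and "P2 = mat 1 - P1"
    and "Q1 = spectral_Q1 A B C2" and "Q2 = mat 1 - Q1"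
    and "X1 = range ((*v) P1)" and "X2 = range ((*v) P2)"
    and "Y1 = range ((*v) Q1)" and "Y2 = range ((*v) Q2)"
    and "G = A + B ** P2"
    and "continuous_with_x_derivative f"
    and "L0 = {(t, x). t \<ge> 0 \<and> Q2 *v (B *v x - f t x) = 0}"
    and cond_i: "\<forall>t\<ge>0. \<forall>xp1\<in>X1. \<exists>xp2\<in>X2. (t, xp1 + xp2) \<in> L0"
    and cond_ii: "\<forall>ts\<ge>0. \<forall>xp1\<in>X1. \<forall>a\<in>X2. \<forall>b\<in>X2.
           (ts, xp1 + a) \<in> L0 \<and> (ts, xp1 + b) \<in> L0 \<longrightarrow>
           basis_invertible X2 Y2
             (\<lambda>xp2. (jacobian (\<lambda>x. Q2 *v f ts x) (at (xp1 + xp2)) - B) ** P2) a b"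
    and cond_iii:
      "(\<exists>H. self_adjoint_positive X1 H \<and>
          (\<forall>T'>0. \<exists>R>0. \<forall>(t, x)\<in>L0. 0 \<le> t \<and> t \<le> T' \<and> norm (P1 *v x) \<ge> R \<longrightarrow>
             (H *v (P1 *v x)) \<bullet> (matrix_inv G *v (Q1 *v f t x)) \<le> 0))
       \<or>
       (\<exists>(S1 :: real \<Rightarrow> real^'n^'n) (\<psi> :: real \<Rightarrow> real^'n \<Rightarrow> real^'n)
          (e :: real \<Rightarrow> real^'n) (\<Xi> :: real^'n \<Rightarrow> real^'n^'n).
          (\<forall>t\<ge>0. \<forall>x. Q1 *v f t x = S1 t *v (P1 *v x) + \<psi> t x + \<Xi> x *v e t) \<and>
          (\<forall>t\<ge>0. S1 t \<in> ops X1 Y1) \<and> continuous_on {0..} S1 \<and>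
          (\<forall>t\<ge>0. \<forall>x. \<psi> t x \<in> Y1) \<and> continuous_with_x_derivative \<psi> \<and>
          continuous_on {0..} e \<and>
          (\<forall>x. \<Xi> x \<in> ops UNIV Y1) \<and> C1_on UNIV \<Xi> \<and>
          (\<exists>C>0. \<exists>r>0. \<forall>x. norm (P1 *v x) \<ge> r \<longrightarrow> onorm ((*v) (\<Xi> x)) \<le> C) \<and>
          (\<exists>H. self_adjoint_positive X1 H \<and>
             (\<forall>T'>0. \<exists>R>0. \<forall>(t, x)\<in>L0. 0 \<le> t \<and> t \<le> T' \<and> norm (P1 *v x) \<ge> R \<longrightarrow>
                (H *v (P1 *v x)) \<bullet> (matrix_inv G *v \<psi> t x) \<le> 0)))
       \<or>
       (\<exists>H R. self_adjoint_positive X1 H \<and> R > 0 \<and>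
          (\<exists>(k :: real \<Rightarrow> real) (U :: real \<Rightarrow> real).
             continuous_on {0..} k \<and>
             continuous_on {0<..} U \<and> (\<forall>v>0. U v > 0) \<and>
             (\<forall>c>0. filterlim (\<lambda>b. integral {c..b} (\<lambda>v. 1 / U v)) at_top at_top) \<and>
             (\<forall>(t, x)\<in>L0. norm (P1 *v x) \<ge> R \<longrightarrow>
                (H *v (P1 *v x)) \<bullet> (matrix_inv G *v (Q1 *v f t x - B *v (P1 *v x)))
                  \<le> k t * U (((H *v (P1 *v x)) \<bullet> (P1 *v x)) / 2))))"
    and "(t0, x0) \<in> L0" and "T > t0"
    and "C1_on ({t0..T} \<times> UNIV) (\<lambda>(t, x). f t x)"
    and "\<forall>t\<in>{t0..T}. \<forall>z\<in>X1. \<forall>u\<in>X2.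
           invertible_op X2 Y2 ((jacobian (\<lambda>x. Q2 *v f t x) (at (z + u)) - B) ** P2)"
  shows "\<exists>x. global_ivp_solution A B f t0 x0 x \<and>
           (\<forall>y. global_ivp_solution A B f t0 x0 y \<longrightarrow> (\<forall>t\<ge>t0. y t = x t)) \<and>
           (let h = (\<lambda>N :: nat. (T - t0) / real N);
                zu = (\<lambda>N. dae_method B G Q1 Q2 f t0 (h N) (P1 *v x0) (P2 *v x0))
            in (\<lambda>N. Max ((\<lambda>i. norm (P1 *v x (t0 + real i * h N) - fst (zu N i))) ` {0..N})) \<in> O(h) \<and>
               (\<lambda>N. Max ((\<lambda>i. norm (P2 *v x (t0 + real i * h N) - snd (zu N i))) ` {0..N})) \<in> O(h))"
proof -
  have idx: "index_le_1_with A B C1 C2" and f: "continuous_with_x_derivative f"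
    and X1: "X1 = range ((*v) P1)" and X2: "X2 = range ((*v) P2)" and Y2: "Y2 = range ((*v) Q2)"
    and L0: "L0 = {(t, x). t \<ge> 0 \<and> Q2 *v (B *v x - f t x) = 0}"
    and init: "(t0, x0) \<in> L0" and T: "t0 < T"
    and C1: "C1_on ({t0..T} \<times> UNIV) (\<lambda>(t, x). f t x)"
    and nondeg: "\<forall>t\<in>{t0..T}. \<forall>z\<in>X1. \<forall>u\<in>X2.
           invertible_op X2 Y2 ((jacobian (\<lambda>x. Q2 *v f t x) (at (z + u)) - B) ** P2)"
    using assms(2,7,8,10,12,13,17,18,19,20) by simp_all
  have P2: "P2 = mat 1 - P1" and Q2: "Q2 = mat 1 - Q1" using assms(4,6) by simp_all
  note ids = spectral_projector_identities[OF idx assms(3,4,5,6,11)]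
  define Gi where "Gi = matrix_inv G"
  interpret S: pencil_splitting A B P1 P2 Q1 Q2 G
  proof
    show "P1 + P2 = mat 1" "Q1 + Q2 = mat 1" by (simp_all add: P2 Q2)
    show "P1 ** P2 = 0" "P2 ** P1 = 0" "Q2 ** Q2 = Q2" "A ** P2 = 0" "Q2 ** B = B ** P2" "invertible G"
      "matrix_inv G ** A = P1" "matrix_inv G ** B ** P2 = P2" "matrix_inv G ** Q1 = P1 ** matrix_inv G"
      by (fact ids)+
  qed
  have t0: "t0 \<ge> 0" using init unfolding L0 by simp
  have in_X1: "z \<in> X1 \<longleftrightarrow> P1 *v z = z" and in_X2: "z \<in> X2 \<longleftrightarrow> P2 *v z = z" for z
    unfolding X1 X2 by (rule S.range_P)+
  have L0_iff: "(t, x) \<in> L0 \<longleftrightarrow> t \<ge> 0 \<and> Q2 *v (B *v x - f t x) = 0" for t x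
    by (simp add: L0)
  interpret D: index1_dae P1 P2 "Gi ** Q1" "Gi ** Q2" "Gi ** B" f
  proof (rule S.reduced_system_is_index1_dae[OF f, folded Gi_def])
    show "\<exists>u. P2 *v u = u \<and> Q2 *v (B *v (z + u) - f t (z + u)) = 0" if "t \<ge> 0" "P1 *v z = z" for t z
    proof -
      have "z \<in> X1" using that(2) by (simp only: in_X1)
      then have "\<exists>u\<in>X2. (t, z + u) \<in> L0" using cond_i that(1) by simp
      then obtain u where "u \<in> X2" "(t, z + u) \<in> L0" ..
      then have "P2 *v u = u \<and> Q2 *v (B *v (z + u) - f t (z + u)) = 0" by (simp only: in_X2 L0_iff)
      then show ?thesis ..
    qed
    show "basis_invertible (range ((*v) P2)) (range ((*v) Q2))
         (\<lambda>w. (jacobian (\<lambda>x. Q2 *v f t x) (at (z + w)) - B) ** P2) a b"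
      if "t \<ge> 0" "P1 *v z = z" "P2 *v a = a" "P2 *v b = b"
        "Q2 *v (B *v (z + a) - f t (z + a)) = 0" "Q2 *v (B *v (z + b) - f t (z + b)) = 0" for t z a b
      unfolding X2[symmetric] Y2[symmetric]
    proof (rule cond_ii[rule_format, OF that(1)])
      show "z \<in> X1" "a \<in> X2" "b \<in> X2" using that by (simp_all only: in_X1 in_X2)
      show "(t, z + a) \<in> L0 \<and> (t, z + b) \<in> L0" using that unfolding L0_iff by blast
    qed
  qed
  note constraint_iff = S.constraint_iff_fixed_point[folded Gi_def]
  have N_sum: "Gi ** Q1 + Gi ** Q2 = Gi" by (simp add: Q2 matrix_diff_ldistrib)
  have GiA: "Gi ** A = P1" and GiBP2: "Gi ** B ** P2 = P2"
    using S.GiA S.GiBP2 by (simp_all add: Gi_def)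
  have Gi_inj: "x = 0" if "Gi *v x = 0" for x
  proof -
    have "G *v (Gi *v x) = 0" using that by simp
    then show ?thesis by (simp only: Gi_def S.G_inverse(1))
  qed
  have eta_L0: "(t, P1 *v z + D.eta t z) \<in> L0" if "t \<ge> 0" for t z
  proof -
    have "Q2 *v (B *v (P1 *v z + D.eta t z) - f t (P1 *v z + D.eta t z)) = 0"
      by (rule iffD2[OF constraint_iff[OF D.P_apply(3) D.eta(1)[OF that]] D.eta(3)[OF that, symmetric]])
    then show ?thesis using that by (simp add: L0_iff)
  qed
  define z0 where "z0 = P1 *v x0"
  have z0: "P1 *v z0 = z0" by (simp add: z0_def)
  have u0: "P2 *v x0 = D.eta t0 z0"
  proof (rule D.eta_unique[OF t0])
    have "Q2 *v (B *v (P1 *v x0 + P2 *v x0) - f t0 (P1 *v x0 + P2 *v x0)) = 0"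
      using init by (simp add: L0_iff D.P_apply_sum)
    from iffD1[OF constraint_iff[OF D.P_apply(3,4)] this]
    show "P2 *v x0 = (Gi ** Q2) *v f t0 (P1 *v z0 + P2 *v (P2 *v x0))"
      by (simp only: z0_def D.P_apply)
  qed

  have growth: "\<exists>H R. self_adjoint_positive X1 H \<and>
      osgood_growth L0 P1 H (\<lambda>t x. Gi *v (Q1 *v f t x - B *v (P1 *v x))) b R" if b: "b > 0" for b
    using cond_iii
  proof (elim disjE, goal_cases)
    case 1
    then obtain H R where H: "self_adjoint_positive X1 H" and
      le: "\<forall>(t, x)\<in>L0. 0 \<le> t \<and> t \<le> b \<and> norm (P1 *v x) \<ge> R \<longrightarrow>
             (H *v (P1 *v x)) \<bullet> (Gi *v (Q1 *v f t x)) \<le> 0"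
      using b unfolding Gi_def by blast
    have "osgood_growth L0 P1 H (\<lambda>t x. Gi *v (Q1 *v f t x - B *v (P1 *v x))) b R"
    proof (rule osgood_growth_dissipative[OF H[unfolded X1]])
      fix t x assume "(t, x) \<in> L0" "t \<le> b" "R \<le> norm (P1 *v x)"
      then show "(H *v (P1 *v x)) \<bullet> (Gi *v (Q1 *v f t x)) \<le> 0" using le L0_iff by fast
    qed
    then show ?thesis using H by blast
  next
    case 2
    then obtain S1 :: "real \<Rightarrow> real^'n^'n" and \<psi> :: "real \<Rightarrow> real^'n \<Rightarrow> real^'n"
      and e :: "real \<Rightarrow> real^'n" and \<Xi> :: "real^'n \<Rightarrow> real^'n^'n" and C r :: real and H where
      dec: "\<forall>t\<ge>0. \<forall>x. Q1 *v f t x = S1 t *v (P1 *v x) + \<psi> t x + \<Xi> x *v e t"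
      and cont: "continuous_on {0..} S1" "continuous_on {0..} e"
      and C: "\<forall>x. norm (P1 *v x) \<ge> r \<longrightarrow> onorm ((*v) (\<Xi> x)) \<le> C"
      and H: "self_adjoint_positive X1 H"
      and ex: "\<forall>T'>0. \<exists>R>0. \<forall>(t, x)\<in>L0. 0 \<le> t \<and> t \<le> T' \<and> norm (P1 *v x) \<ge> R \<longrightarrow>
                (H *v (P1 *v x)) \<bullet> (matrix_inv G *v \<psi> t x) \<le> 0"
      by (elim exE conjE) (rule that, assumption+)
    obtain R where
      le: "\<forall>(t, x)\<in>L0. 0 \<le> t \<and> t \<le> b \<and> norm (P1 *v x) \<ge> R \<longrightarrow>
             (H *v (P1 *v x)) \<bullet> (Gi *v \<psi> t x) \<le> 0"
      using ex b unfolding Gi_def by blast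
    have "osgood_growth L0 P1 H (\<lambda>t x. Gi *v (Q1 *v f t x - B *v (P1 *v x))) b (max R (max r 1))"
    proof (rule osgood_growth_linear_plus_dissipative[OF H[unfolded X1] _ _ cont])
      show "0 \<le> t" if "(t, x) \<in> L0" for t x using that L0_iff by blast
      show "Q1 *v f t x = S1 t *v (P1 *v x) + \<psi> t x + \<Xi> x *v e t" if "0 \<le> t" for t x
        using dec that by blast
      show "onorm ((*v) (\<Xi> x)) \<le> C" if "r \<le> norm (P1 *v x)" for x using C that by blast
      show "(H *v (P1 *v x)) \<bullet> (Gi *v \<psi> t x) \<le> 0"
        if "(t, x) \<in> L0" "t \<le> b" "R \<le> norm (P1 *v x)" for t x
        using le that L0_iff by fast
    qed
    then show ?thesis using H by blast
  next
    case 3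
    then obtain H R and k U :: "real \<Rightarrow> real" where H: "self_adjoint_positive X1 H" and R: "R > 0"
      and k: "continuous_on {0..} k" and U: "continuous_on {0<..} U" "\<forall>v>0. U v > 0"
      and div: "\<forall>c>0. filterlim (\<lambda>b. integral {c..b} (\<lambda>v. 1 / U v)) at_top at_top"
      and le: "\<forall>(t, x)\<in>L0. norm (P1 *v x) \<ge> R \<longrightarrow>
                (H *v (P1 *v x)) \<bullet> (matrix_inv G *v (Q1 *v f t x - B *v (P1 *v x)))
                  \<le> k t * U (((H *v (P1 *v x)) \<bullet> (P1 *v x)) / 2)"
      by (elim exE conjE) (rule that, assumption+)
    have "osgood_growth L0 P1 H (\<lambda>t x. Gi *v (Q1 *v f t x - B *v (P1 *v x))) b R"
    proof (rule osgood_growth_time_dependent_factor[OF _ H[unfolded X1] R k U div])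
      show "0 \<le> t" if "(t, x) \<in> L0" for t x using that L0_iff by blast
      show "(H *v (P1 *v x)) \<bullet> (Gi *v (Q1 *v f t x - B *v (P1 *v x)))
          \<le> k t * U (((H *v (P1 *v x)) \<bullet> (P1 *v x)) / 2)"
        if "(t, x) \<in> L0" "R \<le> norm (P1 *v x)" for t x
        using le that unfolding Gi_def by fast
    qed
    then show ?thesis using H by blast
  qed

  have bound: "\<exists>M. \<forall>c\<in>{t0..b}. \<forall>z. ode_solution_on D.rhs {t0..c} z \<and> z t0 = z0 \<longrightarrow> norm (z c) \<le> M"
    if b: "b > t0" for b
  proof -
    have "b > 0" using b t0 by simp
    then obtain H R where H: "self_adjoint_positive X1 H"
      and gr: "osgood_growth L0 P1 H (\<lambda>t x. Gi *v (Q1 *v f t x - B *v (P1 *v x))) b R"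
      using growth by blast
    from gr obtain K U where K: "K \<ge> 0" and U: "continuous_on {0<..} U" "\<forall>v>0. U v > 0"
      and div: "\<forall>c>0. filterlim (\<lambda>b. integral {c..b} (\<lambda>v. 1 / U v)) at_top at_top"
      and le: "\<forall>(t, x)\<in>L0. t \<le> b \<and> norm (P1 *v x) \<ge> R \<longrightarrow>
        (H *v (P1 *v x)) \<bullet> (Gi *v (Q1 *v f t x - B *v (P1 *v x))) \<le> K * U (((H *v (P1 *v x)) \<bullet> (P1 *v x)) / 2)"
      unfolding osgood_growth_def by blast
    show ?thesis
    proof (rule D.solution_a_priori_bound[OF H[unfolded X1] K U(1) U(2)[rule_format] div[rule_format] _ z0, where R = R])
      fix t z assume t: "t \<in> {t0..b}" and z: "P1 *v z = z" "R \<le> norm z"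
      have t': "t \<ge> 0" using t t0 by simp
      let ?x = "z + D.eta t z"
      have x: "P1 *v ?x = z" using D.eta(2)[OF t', of z] z by (simp add: matrix_vector_right_distrib)
      have "(t, ?x) \<in> L0" using eta_L0[OF t', of z] by (simp only: z(1))
      from bspec[OF le this]
      have "(H *v z) \<bullet> (Gi *v (Q1 *v f t ?x - B *v z)) \<le> K * U (((H *v z) \<bullet> z) / 2)"
        using t z(2) by (simp only: prod.case x atLeastAtMost_iff simp_thms)
      moreover have "D.rhs t z = Gi *v (Q1 *v f t ?x - B *v z)"
        by (simp add: D.rhs_eq[OF z(1)] matrix_vector_mult_diff_distrib flip: matrix_vector_mul_assoc)
      ultimately show "(H *v z) \<bullet> D.rhs t z \<le> K * U (((H *v z) \<bullet> z) / 2)"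
        by simp
    qed auto
  qed
  have rhs_cont: "continuous_on ({t0..} \<times> UNIV) (\<lambda>(t, z). D.rhs t z)"
    unfolding split_beta by (rule D.rhs_continuous_on) (use t0 in \<open>auto intro: continuous_intros\<close>)
  have rhs_lip: "local_lipschitz {t0..} UNIV D.rhs"
    by (rule local_lipschitz_subset[OF D.rhs_local_lipschitz]) (use t0 in auto)
  obtain z where z: "z t0 = z0" "ode_solution_on D.rhs {t0..} z"
    by (rule ode_exists_global[OF rhs_cont rhs_lip bound])
  have zP: "P1 *v z t = z t" if "t \<ge> t0" for t
    by (rule D.solution_stays_in_range[OF ode_solution_on_subset[OF z(2)], of t0 t]) (use that z(1) z0 in auto)
  define x where "x t = z t + D.eta t (z t)" for t
  have P_x: "P1 *v x t = z t" "P2 *v x t = D.eta t (z t)" if "t \<ge> t0" for t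
    using D.eta[of t "z t"] zP[OF that] that t0 D.P_complement(1)[of "z t"]
    by (simp_all add: x_def matrix_vector_right_distrib)
  have x0_eq: "z t0 + D.eta t0 (z t0) = x0"
    using D.P_apply_sum[of x0] by (simp add: z(1) z0_def u0[unfolded z0_def, symmetric])
  have sol: "global_ivp_solution A B f t0 x0 x"
    unfolding x0_eq[symmetric] x_def[abs_def]
    by (rule D.ode_solution_gives_dae_solution[OF GiA _ N_sum refl GiBP2 t0 z(2)]) (rule Gi_inj zP, assumption)+
  have unique: "y t = x t" if y: "global_ivp_solution A B f t0 x0 y" and t: "t \<ge> t0" for y t
  proof -
    have ode: "ode_solution_on D.rhs {t0..} (\<lambda>t. P1 *v y t)"
      by (rule D.dae_solution_gives_ode_solution(1)[OF GiA _ N_sum refl GiBP2 t0 y]) (rule Gi_inj)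
    have alg: "P2 *v y t = D.eta t (P1 *v y t)"
      by (rule D.dae_solution_gives_ode_solution(2)[OF GiA _ N_sum refl GiBP2 t0 y t]) (rule Gi_inj)
    have "P1 *v y t0 = z t0" using y by (simp add: ivp_solution_on_def z(1) z0_def)
    then have "P1 *v y t = z t"
      using ode_unique_local_lipschitz[OF rhs_cont rhs_lip ode_solution_on_subset[OF ode]
          ode_solution_on_subset[OF z(2)], of t t] t by auto
    then show ?thesis using alg D.P_apply_sum[of "y t"] by (simp add: x_def)
  qed

  have jac: "jacobian (\<lambda>x. Q2 *v f t x) (at x) = Q2 ** jacobian (f t) (at x)" if "t \<ge> 0" for t x
    by (rule jacobian_matrix_mult) (use f that in \<open>simp add: continuous_with_x_derivative_def\<close>)
  have nd: "v = 0" if t: "t \<in> {t0..T}" and zu: "P1 *v z = z" "P2 *v u = u"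
    and v: "v = (Gi ** Q2) *v (jacobian (f t) (at (z + u)) *v v)" for t z u v
  proof -
    have P2v: "P2 *v v = v" using v D.N_apply(2) by metis
    have t': "t \<ge> 0" using t t0 by simp
    have "invertible_op X2 Y2 ((Q2 ** jacobian (f t) (at (z + u)) - B) ** P2)"
      using nondeg t zu in_X1 in_X2 unfolding jac[OF t', symmetric] by blast
    then show ?thesis
      by (rule invertible_op_imp_injective[OF _ iffD2[OF in_X2 P2v]])
        (rule S.linearized_constraint[OF P2v v[unfolded Gi_def]])
  qed
  have "\<exists>C\<ge>0. \<exists>h0>0. \<forall>h zs us n i. 0 < h \<longrightarrow> h \<le> h0 \<longrightarrow> t0 + real n * h \<le> T \<longrightarrow>
       zs 0 = z t0 \<longrightarrow> us 0 = D.eta t0 (z t0) \<longrightarrow>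
       (\<forall>i<n. zs (Suc i) = zs i + h *\<^sub>R ((Gi ** Q1) *v f (t0 + real i * h) (zs i + us i) - (Gi ** B) *v zs i)) \<longrightarrow>
       (\<forall>i<n. us (Suc i) = D.newton (t0 + real (Suc i) * h) (zs (Suc i)) (us i)) \<longrightarrow> i \<le> n \<longrightarrow>
       norm (zs i - z (t0 + real i * h)) \<le> C * h \<and>
       norm (us i - D.eta (t0 + real i * h) (z (t0 + real i * h))) \<le> C * h"
    (is "\<exists>C\<ge>0. \<exists>h0>0. ?error_bound C h0")
  proof (rule D.method_converges[OF t0 T C1])
    show "v = 0" if "t \<in> {t0..T}" "P1 *v z = z" "P2 *v u = u"
      "v = (Gi ** Q2) *v (jacobian (f t) (at (z + u)) *v v)" for t z u v
      by (rule nd[OF that])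
    show "ode_solution_on D.rhs {t0..T} z" by (rule ode_solution_on_subset[OF z(2)]) simp
    show "P1 *v z t0 = z t0" by (rule zP[OF order_refl])
  qed
  then obtain C h0 where C: "C \<ge> 0" and h0: "h0 > 0" and conv: "?error_bound C h0"
    by (elim exE conjE) (rule that, assumption+)
  define h where "h N = (T - t0) / real N" for N
  define zu where "zu N = dae_method B G Q1 Q2 f t0 (h N) (P1 *v x0) (P2 *v x0)" for N
  have err: "norm (P1 *v x (t0 + real i * h N) - fst (zu N i)) \<le> C * h N \<and>
      norm (P2 *v x (t0 + real i * h N) - snd (zu N i)) \<le> C * h N"
    if N: "N > 0" "h N \<le> h0" and i: "i \<le> N" for N i
  proof -
    have hN: "h N > 0" "t0 + real N * h N = T" using N T by (auto simp: h_def)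
    have ti: "t0 \<le> t0 + real i * h N" using hN by simp
    have step: "fst (zu N (Suc j)) = fst (zu N j) +
          h N *\<^sub>R ((Gi ** Q1) *v f (t0 + real j * h N) (fst (zu N j) + snd (zu N j)) - (Gi ** B) *v fst (zu N j))"
      "snd (zu N (Suc j)) = D.newton (t0 + real (Suc j) * h N) (fst (zu N (Suc j))) (snd (zu N j))" for j
    proof -
      have tj: "t0 + real (Suc j) * h N \<ge> 0" using t0 hN by (intro add_nonneg_nonneg) auto
      obtain zj uj where zuj: "zu N j = (zj, uj)" by (cases "zu N j")
      have e1: "(mat 1 - h N *\<^sub>R (Gi ** B)) *v zj + h N *\<^sub>R (Gi *v (Q1 *v f (t0 + real j * h N) (zj + uj)))
          = zj + h N *\<^sub>R ((Gi ** Q1) *v f (t0 + real j * h N) (zj + uj) - (Gi ** B) *v zj)"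
        by (simp add: matrix_vector_mult_diff_rdistrib scaleR_matrix_vector_assoc[symmetric]
            matrix_vector_mul_assoc scaleR_diff_right)
      show 1: "fst (zu N (Suc j)) = fst (zu N j) +
          h N *\<^sub>R ((Gi ** Q1) *v f (t0 + real j * h N) (fst (zu N j) + snd (zu N j)) - (Gi ** B) *v fst (zu N j))"
        using zuj e1 by (simp add: zu_def Let_def Gi_def)
      have "snd (zu N (Suc j)) = snd (zu N j) - matrix_inv (mat 1 - Gi **
          jacobian (\<lambda>x. Q2 *v f (t0 + real (Suc j) * h N) x) (at (fst (zu N (Suc j)) + snd (zu N j))))
          *v (snd (zu N j) - Gi *v (Q2 *v f (t0 + real (Suc j) * h N) (fst (zu N (Suc j)) + snd (zu N j))))"
        using zuj by (simp add: zu_def Let_def Gi_def)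
      then show "snd (zu N (Suc j)) = D.newton (t0 + real (Suc j) * h N) (fst (zu N (Suc j))) (snd (zu N j))"
        unfolding jac[OF tj] D.newton_def by (simp only: matrix_mul_assoc matrix_vector_mul_assoc)
    qed
    have "norm (fst (zu N i) - z (t0 + real i * h N)) \<le> C * h N \<and>
       norm (snd (zu N i) - D.eta (t0 + real i * h N) (z (t0 + real i * h N))) \<le> C * h N"
    proof (rule conv[rule_format, where n = N and zs = "\<lambda>i. fst (zu N i)" and us = "\<lambda>i. snd (zu N i)"])
      show "fst (zu N 0) = z t0" by (simp add: zu_def z(1) z0_def)
      show "snd (zu N 0) = D.eta t0 (z t0)" by (simp add: zu_def z(1) u0)
    qed (use hN N(2) i step in simp_all)
    then show ?thesis by (simp add: P_x[OF ti] norm_minus_commute)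
  qed
  (* For N = 0 the step is T - t0 divided by 0, which is 0; the asymptotic statement ignores this case. *)
  have "(\<lambda>N. h N) \<longlonglongrightarrow> 0" unfolding h_def by (rule lim_const_over_n)
  then have "\<forall>\<^sub>F N in sequentially. h N < h0" using h0 by (rule order_tendstoD(2))
  then have small: "\<forall>\<^sub>F N in sequentially. N > 0 \<and> h N \<le> h0"
    using eventually_gt_at_top[of 0] by eventually_elim auto
  have bigo: "(\<lambda>N. Max ((\<lambda>i. norm (p N i)) ` {0..N})) \<in> O(h)"
    if p: "\<And>N i. N > 0 \<Longrightarrow> h N \<le> h0 \<Longrightarrow> i \<le> N \<Longrightarrow> norm (p N i) \<le> C * h N" for p :: "nat \<Rightarrow> nat \<Rightarrow> real^'n"
  proof (rule landau_o.bigI[where c = "C + 1"])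
    show "C + 1 > 0" using C by simp
    show "\<forall>\<^sub>F N in sequentially. norm (Max ((\<lambda>i. norm (p N i)) ` {0..N})) \<le> (C + 1) * norm (h N)"
      using small
    proof eventually_elim
      case (elim N)
      have hN: "0 \<le> h N" using T by (simp add: h_def)
      let ?m = "Max ((\<lambda>i. norm (p N i)) ` {0..N})"
      have "norm (p N 0) \<le> ?m" by (rule Max_ge) simp_all
      then have lower: "0 \<le> ?m" by (rule order_trans[OF norm_ge_zero])
      have "?m \<le> C * h N" using p elim by (intro Max.boundedI) auto
      also have "\<dots> \<le> (C + 1) * h N" using hN by (simp add: distrib_right)
      finally show ?case unfolding real_norm_def abs_of_nonneg[OF lower] abs_of_nonneg[OF hN] .
    qed
  qed
  show ?thesis
    unfolding Let_def
  proof (intro exI[of _ x] conjI allI impI)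
    show "global_ivp_solution A B f t0 x0 x" by (rule sol)
    show "y t = x t" if "global_ivp_solution A B f t0 x0 y" "t0 \<le> t" for y t
      by (rule unique[OF that])
    show "(\<lambda>N. Max ((\<lambda>i. norm (P1 *v x (t0 + real i * ((T - t0) / real N)) -
        fst (dae_method B G Q1 Q2 f t0 ((T - t0) / real N) (P1 *v x0) (P2 *v x0) i))) ` {0..N}))
        \<in> O(\<lambda>N. (T - t0) / real N)"
      using bigo[of "\<lambda>N i. P1 *v x (t0 + real i * h N) - fst (zu N i)"] err
      unfolding zu_def h_def by blast
    show "(\<lambda>N. Max ((\<lambda>i. norm (P2 *v x (t0 + real i * ((T - t0) / real N)) -
        snd (dae_method B G Q1 Q2 f t0 ((T - t0) / real N) (P1 *v x0) (P2 *v x0) i))) ` {0..N}))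
        \<in> O(\<lambda>N. (T - t0) / real N)"
      using bigo[of "\<lambda>N i. P2 *v x (t0 + real i * h N) - snd (zu N i)"] err
      unfolding zu_def h_def by blast
  qed
qed

end
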